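(* Let $(Y_{i\,j})_{i,j\in\mathbb N}$ be independent identically distributed real random variables with $\mathbb E[Y_{1\,1}]=0$ and $\mathbb E[Y_{1\,1}^2]=1$. Fix $l_1,l_2\in\mathbb N$ and assume $\mathbb E[Y_{1\,1}^{2l_1+2l_2}]<\infty$. For $p\le n$ let $\mathbf X_{p,n}=(Y_{i\,j})_{i\le p,\,j\le n}$ and $\mathbf S_{p,n}=\frac1n\mathbf X_{p,n}\mathbf X_{p,n}^T$. Then for $p\le n$ $$\operatorname{Cov}[\operatorname{tr}(\mathbf S_{p,n}^{l_1}),\operatorname{tr}(\mathbf S_{p,n}^{l_2})]=\sum_{b=1}^{(l_1+l_2)\wedge p}\Bigg[\frac{\binom{p}{b}\binom{n-b}{l_1+l_2-b}}{n^{l_1+l_2}}\Big\{C(l_1,l_2,b)+\big(\mathbb E[Y_{1\,1}^4]-3\big)D(l_1,l_2,b)\Big\}+\mathcal O\Big(\frac{p^b}{n^{b+1}}\Big)\Bigg],$$ where $$C(l_1,l_2,b):=2\,b!\,(l_1+l_2-b)!\sum_{k=0}^{b}\binom{l_1}{k}\binom{l_2}{b-k}\sum_{m=0}^{b-k}m\binom{l_1}{k+m}\binom{l_2}{b-m-k}$$ and $$D(l_1,l_2,b):=b!\,(l_1+l_2-b)!\sum_{k=0}^{b-1}\binom{l_1}{k}\binom{l_1}{k+1}\binom{l_2}{b-1-k}\binom{l_2}{b-k}.$$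
   Context: $a\wedge b=\min(a,b)$; binomial coefficients $\binom{n}{k}$ are zero when $k>n$ or $k<0$. For each $b$, the term $\mathcal O(p^b/n^{b+1})$ denotes a quantity whose absolute value is bounded by $C\,p^b/n^{b+1}$ for a constant $C$ not depending on $p,n$ (uniformly over $p\le n$). *)

theory Defs
  imports "HOL-Probability.Probability" "Jordan_Normal_Form.Matrix"
begin

definition mtrace :: "'a :: comm_monoid_add mat \<Rightarrow> 'a" where
  "mtrace A = (\<Sum>i<dim_row A. A $$ (i, i))"

text \<open>The p x n data matrix X_{p,n} = (Y i j)_{i<p, j<n} (0-based indices) at outcome w.\<close>
definition Xmat :: "(nat \<Rightarrow> nat \<Rightarrow> 'w \<Rightarrow> real) \<Rightarrow> nat \<Rightarrow> nat \<Rightarrow> 'w \<Rightarrow> real mat" where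
  "Xmat Y p n w = mat p n (\<lambda>(i, j). Y i j w)"

definition Smat :: "(nat \<Rightarrow> nat \<Rightarrow> 'w \<Rightarrow> real) \<Rightarrow> nat \<Rightarrow> nat \<Rightarrow> 'w \<Rightarrow> real mat" where
  "Smat Y p n w = (1 / real n) \<cdot>\<^sub>m (Xmat Y p n w * transpose_mat (Xmat Y p n w))"

definition covar :: "'w measure \<Rightarrow> ('w \<Rightarrow> real) \<Rightarrow> ('w \<Rightarrow> real) \<Rightarrow> real" where
  "covar M U V = (\<integral>x. U x * V x \<partial>M) - (\<integral>x. U x \<partial>M) * (\<integral>x. V x \<partial>M)"

definition Ccoef :: "nat \<Rightarrow> nat \<Rightarrow> nat \<Rightarrow> real" where
  "Ccoef l1 l2 b = 2 * fact b * fact (l1 + l2 - b) *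
     (\<Sum>k=0..b. real (l1 choose k) * real (l2 choose (b - k)) *
        (\<Sum>m=0..b-k. real m * real (l1 choose (k + m)) * real (l2 choose (b - m - k))))"

definition Dcoef :: "nat \<Rightarrow> nat \<Rightarrow> nat \<Rightarrow> real" where
  "Dcoef l1 l2 b = fact b * fact (l1 + l2 - b) *
     (\<Sum>k\<in>{0..<b}. real (l1 choose k) * real (l1 choose (k + 1))
        * real (l2 choose (b - 1 - k)) * real (l2 choose (b - k)))"

end

theory Submission
  imports Defs
begin

text \<open>
  Expanding the traces, the covariance is \<open>n ^ -(l1 + l2)\<close> times the sum, over all pairs of closed
  walks of lengths \<open>2 l1\<close> and \<open>2 l2\<close> in the complete bipartite graph on \<open>p\<close> rows and \<open>n\<close> columns, of a
  weight that depends only on edge multiplicities. A pair contributes only if every edge is traversed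
  at least twice and some edge is shared. Group the pairs by the numbers \<open>b\<close> and \<open>c\<close> of visited rows and
  columns.

  A vertex visited exactly once is the tip of a backtracking step; deleting it changes neither the
  weight nor \<open>b + c - (l1 + l2)\<close>. If there is no such vertex, all vertices are visited at least twice,
  so \<open>b + c \<le> l1 + l2\<close>, and in the case of equality both walks go once around a common cycle of length
  \<open>2 r\<close>. Hence \<open>b + c > l1 + l2\<close> contributes nothing, \<open>b + c < l1 + l2\<close> goes into the error term, and the
  case \<open>b + c = l1 + l2\<close> must be counted exactly.

  For that, sets of closing steps are counted alongside: the numbers of objects without leaves in a
  prescribed set \<open>U\<close> of places satisfy the same recursion for pairs of walks and for closing sets
  (split according to whether a further place \<open>t \<notin> U\<close> carries a leaf, and delete that leaf), and the
  leafless objects agree. The closing sets are counted by products of four binomial coefficients.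
\<close>

section \<open>Single cycles\<close>

text \<open>Reading off a bijection between extremal pairs of walks and closing sets would require a
  cyclic bracket matching; comparing two recursions avoids it. A labelling may have several leaves,
  so deleting "some" leaf would count it repeatedly; enlarging \<open>U\<close> one place at a time
  splits the sum disjointly and fixes which leaf is deleted. The argument runs under the inequality
  card P <= 2 (b + c), which deletion preserves, and so treats b + c > l1 + l2 and equality
  together. The half length r of the common cycle is invariant under deletion; it becomes the index
  m of C, and the fourth-moment correction at r = 1 gives D. The exact count contains a falling
  factorial of n of order l1 + l2 - b; replacing n by n - b, as in the statement, costs a factor 1/n
  and goes into the error. Walks live on arbitrary finite position sets with a cyclic permutation,
  so that positions can be deleted without renumbering.\<close>

text \<open>Cyclic permutations without base point or enumeration: minimality among nonempty closed
  subsets gives the induction principle directly and survives the removal of points. A fixed point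
  is allowed here; alternation of types excludes it later.\<close>

definition single_cycle :: "('a \<Rightarrow> 'a) \<Rightarrow> 'a set \<Rightarrow> bool" where
  "single_cycle s P \<longleftrightarrow> finite P \<and> P \<noteq> {} \<and> s ` P \<subseteq> P \<and>
     (\<forall>A\<subseteq>P. A \<noteq> {} \<longrightarrow> s ` A \<subseteq> A \<longrightarrow> A = P)"

lemma single_cycle_finite: "single_cycle s P \<Longrightarrow> finite P"
  by (simp add: single_cycle_def)

lemma single_cycle_ne: "single_cycle s P \<Longrightarrow> P \<noteq> {}"
  by (simp add: single_cycle_def)

lemma single_cycle_sub: "single_cycle s P \<Longrightarrow> s ` P \<subseteq> P"
  by (simp add: single_cycle_def)

lemma single_cycle_in: "single_cycle s P \<Longrightarrow> u \<in> P \<Longrightarrow> s u \<in> P"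
  by (auto simp: single_cycle_def)

lemma single_cycle_minimal:
  "single_cycle s P \<Longrightarrow> A \<subseteq> P \<Longrightarrow> A \<noteq> {} \<Longrightarrow> s ` A \<subseteq> A \<Longrightarrow> A = P"
  by (simp add: single_cycle_def)

lemma single_cycle_induct:
  assumes "single_cycle s P" "a \<in> P" "Q a" "\<And>u. u \<in> P \<Longrightarrow> Q u \<Longrightarrow> Q (s u)" "v \<in> P"
  shows "Q v"
proof -
  have "{u \<in> P. Q u} = P"
    by (rule single_cycle_minimal[OF assms(1)])
      (use assms single_cycle_in[OF assms(1)] in auto)
  with \<open>v \<in> P\<close> show ?thesis by blast
qed

lemma single_cycle_surj: "single_cycle s P \<Longrightarrow> s ` P = P"
  using single_cycle_minimal[of s P "s ` P"] single_cycle_ne single_cycle_sub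
  by (metis image_is_empty image_mono)

lemma single_cycle_inj: "single_cycle s P \<Longrightarrow> inj_on s P"
  by (simp add: single_cycle_finite single_cycle_surj eq_card_imp_inj_on)

text \<open>Walks in opposite directions are compared through the inverse. A set closed under the
  injective inverse is permuted by it, being finite, so it is closed under \<open>s\<close> as
  well.\<close>

lemma single_cycle_inv:
  assumes c: "single_cycle s P"
  shows "single_cycle (inv_into P s) P"
proof -
  let ?i = "inv_into P s"
  have bij: "bij_betw s P P"
    by (simp add: bij_betw_def c single_cycle_inj single_cycle_surj)
  have A: "A = P" if "A \<subseteq> P" "A \<noteq> {}" "?i ` A \<subseteq> A" for A
  proof -
    have "inj_on ?i A"
      using bij_betw_inv_into[OF bij] that(1) by (meson bij_betw_def inj_on_subset)
    moreover have "finite A" using that single_cycle_finite[OF c] finite_subset by blast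
    ultimately have "?i ` A = A" using that(3) by (simp add: endo_inj_surj)
    then have "s ` A = s ` ?i ` A" by simp
    also have "\<dots> = A"
      using that(1) single_cycle_surj[OF c] by (auto simp: image_image f_inv_into_f subset_iff)
    finally have "s ` A = A" .
    then show ?thesis using single_cycle_minimal[OF c that(1,2)] by simp
  qed
  have "?i ` P \<subseteq> P"
    using single_cycle_surj[OF c] by (metis image_subsetI inv_into_into)
  then show ?thesis
    using single_cycle_finite[OF c] single_cycle_ne[OF c] A unfolding single_cycle_def by simp
qed

text \<open>The enumeration is the orbit of \<open>a\<close>. A return to \<open>a\<close> after
  \<open>m\<close> steps closes up a segment of the orbit, which by minimality is all of
  \<open>P\<close>; so no return is earlier than \<open>card P\<close>.\<close>

lemma single_cycle_enum:
  assumes c: "single_cycle s P" and a: "a \<in> P"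
  obtains g :: "nat \<Rightarrow> 'a" where "g 0 = a" "bij_betw g {..<card P} P"
    "\<And>k. k < card P \<Longrightarrow> s (g k) = g (Suc k mod card P)"
proof -
  define g where "g k = (s ^^ k) a" for k
  let ?N = "card P"
  have gP: "g k \<in> P" for k
    by (induction k) (auto simp: g_def a single_cycle_in[OF c])
  have gS: "g (Suc k) = s (g k)" for k by (simp add: g_def)
  note inj = single_cycle_inj[OF c]
  have N: "?N > 0" using a single_cycle_finite[OF c] card_gt_0_iff by blast
  \<comment> \<open>Injectivity shifts a coincidence in the orbit back to the starting
    point.\<close>
  have cancel: "g i = g j \<Longrightarrow> i \<le> j \<Longrightarrow> g 0 = g (j - i)" for i j :: nat
  proof (induction i arbitrary: j)
    case (Suc i)
    then obtain j' where j: "j = Suc j'" by (cases j) auto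
    with Suc.prems have "g i = g j'" using inj gP by (auto simp: gS inj_on_def)
    with Suc j show ?case by auto
  qed auto
  have ret: "m \<ge> ?N" if "g m = g 0" "m > 0" for m
  proof -
    have "g ` {..<m} = P"
    proof (rule single_cycle_minimal[OF c])
      show "s ` g ` {..<m} \<subseteq> g ` {..<m}"
      proof safe
        fix k assume "k < m"
        show "s (g k) \<in> g ` {..<m}"
        proof (cases "Suc k < m")
          case True then show ?thesis by (auto simp: gS[symmetric])
        next
          case False
          then have "Suc k = m" using \<open>k < m\<close> by simp
          then show ?thesis using that by (metis gS imageI lessThan_iff)
        qed
      qed
    qed (use gP that in auto)
    then show ?thesis by (metis card_image_le card_lessThan finite_lessThan)
  qed
  have inj_g: "inj_on g {..<?N}"
  proof (rule linorder_inj_onI)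
    fix i j assume "i < j" "i \<in> {..<?N}" "j \<in> {..<?N}"
    then show "g i \<noteq> g j"
      using cancel[of i j] ret[of "j - i"] by fastforce
  qed auto
  have img: "g ` {..<?N} = P"
    by (rule card_subset_eq) (use gP inj_g single_cycle_finite[OF c] in \<open>auto simp: card_image\<close>)
  have gN: "g ?N = g 0"
  proof -
    obtain k where k: "k < ?N" "g ?N = g k" using gP[of ?N] img by auto
    have "g 0 = g (?N - k)" using cancel[of k ?N] k by simp
    then have "?N - k \<ge> ?N" using ret[of "?N - k"] k by simp
    with k N have "k = 0" by simp
    with k show ?thesis by simp
  qed
  show thesis
  proof (rule that[of g])
    show "g 0 = a" by (simp add: g_def)
    show "bij_betw g {..<?N} P" using inj_g img by (simp add: bij_betw_def)
    show "s (g k) = g (Suc k mod ?N)" if "k < ?N" for k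
      using that gN by (cases "Suc k = ?N") (auto simp: gS[symmetric])
  qed
qed

text \<open>The two enumerations are matched step by step; the free choice of \<open>a'\<close> is
  what later counts rotations.\<close>

lemma single_cycle_intertwiner:
  assumes c: "single_cycle s P" and c': "single_cycle s' P'" and "card P = card P'"
    and a: "a \<in> P" and a': "a' \<in> P'"
  shows "\<exists>h. bij_betw h P P' \<and> h a = a' \<and> (\<forall>u\<in>P. h (s u) = s' (h u))"
proof -
  obtain g where g: "g 0 = a" "bij_betw g {..<card P} P"
    "\<And>k. k < card P \<Longrightarrow> s (g k) = g (Suc k mod card P)"
    using single_cycle_enum[OF c a] by blast
  obtain g' where g': "g' 0 = a'" "bij_betw g' {..<card P} P'"
    "\<And>k. k < card P \<Longrightarrow> s' (g' k) = g' (Suc k mod card P)"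
    using single_cycle_enum[OF c' a'] assms(3) by metis
  define i where "i = inv_into {..<card P} g"
  have N: "card P > 0" using a single_cycle_finite[OF c] card_gt_0_iff by blast
  have ig: "i (g k) = k" if "k < card P" for k
    using that g(2) unfolding i_def by (simp add: bij_betw_inv_into_left)
  have bi: "bij_betw i P {..<card P}" unfolding i_def by (rule bij_betw_inv_into[OF g(2)])
  have "\<exists>k<card P. u = g k" if "u \<in> P" for u
    using that g(2) by (auto simp: bij_betw_def)
  then have "\<forall>u\<in>P. (g' \<circ> i) (s u) = s' ((g' \<circ> i) u)"
    using N by (auto simp: g(3) g'(3) ig) (metis N g'(3) g(3) ig mod_less_divisor)
  moreover have "(g' \<circ> i) a = a'" using ig[OF N] g g' by simp
  ultimately show ?thesis using bij_betw_trans[OF bi g'(2)] by blast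
qed

text \<open>Two consecutive points are spliced out: the predecessor of \<open>t\<close> is sent to
  \<open>s (s t)\<close>. The inequalities keep both ends of the splice outside the deleted
  pair.\<close>

lemma single_cycle_delete:
  assumes c: "single_cycle s P" and t: "t \<in> P" and st: "s t \<noteq> t" "s (s t) \<noteq> t" "s (s t) \<noteq> s t"
  shows "single_cycle (\<lambda>u. if s u = t then s (s t) else s u) (P - {t, s t})"
proof -
  let ?s = "\<lambda>u. if s u = t then s (s t) else s u"
  let ?P = "P - {t, s t}"
  note inj = single_cycle_inj[OF c] and inP = single_cycle_in[OF c]
  have in': "?s u \<in> ?P" if "u \<in> ?P" for u
    using that t st inP inj by (auto simp: inj_on_def)
  obtain q where q: "q \<in> P" "s q = t" using single_cycle_surj[OF c] t by (metis imageE)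
  have q': "q \<in> ?P" using q st by auto
  have "A = ?P" if A: "A \<subseteq> ?P" "A \<noteq> {}" "?s ` A \<subseteq> A" for A
  proof -
    \<comment> \<open>Under \<open>s\<close>, a set closed for the spliced map can be left only
      through the predecessor \<open>q\<close> of \<open>t\<close>, so the deleted pair is restored
      exactly when \<open>q\<close> belongs to \<open>A\<close>.\<close>
    define A' where "A' = A \<union> (if q \<in> A then {t, s t} else {})"
    have "s ` A' \<subseteq> A'"
    proof safe
      fix u assume u: "u \<in> A'"
      have tq: "s (s t) \<in> A" if "q \<in> A" using A(3) that q by force
      show "s u \<in> A'"
      proof (cases "u \<in> A")
        case True
        then have su: "?s u \<in> A" using A(3) by blast
        show ?thesis
        proof (cases "s u = t")
          case st: True
          then have "u = q" using q inj True A(1) by (auto simp: inj_on_def)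
          then show ?thesis using True st by (auto simp: A'_def)
        next
          case False
          then show ?thesis using su by (auto simp: A'_def)
        qed
      next
        case False
        then have "q \<in> A" "u = t \<or> u = s t" using u by (auto simp: A'_def split: if_splits)
        then show ?thesis using tq by (auto simp: A'_def)
      qed
    qed
    moreover have "A' \<subseteq> P" using A(1) t inP by (auto simp: A'_def)
    moreover have "A' \<noteq> {}" using A(2) by (auto simp: A'_def)
    ultimately have eq: "A' = P" by (intro single_cycle_minimal[OF c])
    have "q \<in> A" using eq q(1) unfolding A'_def by (cases "q \<in> A") simp_all
    then have "A \<union> {t, s t} = P" using eq unfolding A'_def by simp
    then show ?thesis using A(1) by blast
  qed
  note min = this
  show ?thesis
    unfolding single_cycle_def
  proof (intro conjI allI impI)
    show "finite ?P" using single_cycle_finite[OF c] by simp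
    show "?P \<noteq> {}" using q' by (metis empty_iff)
    show "?s ` ?P \<subseteq> ?P" by (rule image_subsetI) (rule in')
  qed (rule min)
qed

section \<open>Edge multiplicities and leaves\<close>

text \<open>If \<open>\<mu> k\<close> is the \<open>k\<close>-th moment of i.i.d. variables indexed by \<open>e\<close>, this is the expectation
  of the product over \<open>t \<in> Q\<close> of the variables with index \<open>E t\<close>.\<close>

definition multi_moment :: "(nat \<Rightarrow> real) \<Rightarrow> 'a set \<Rightarrow> ('a \<Rightarrow> 'e) \<Rightarrow> real" where
  "multi_moment \<mu> Q E = (\<Prod>e\<in>E ` Q. \<mu> (card {t \<in> Q. E t = e}))"

lemma multi_moment_cong:
  assumes "\<And>t. t \<in> Q \<Longrightarrow> E t = E' t"
  shows "multi_moment \<mu> Q E = multi_moment \<mu> Q E'"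
proof -
  have "{t \<in> Q. E t = e} = {t \<in> Q. E' t = e}" for e using assms by auto
  moreover have "E ` Q = E' ` Q" using assms by auto
  ultimately show ?thesis by (simp add: multi_moment_def)
qed

lemma multi_moment_union_disjoint:
  assumes "finite Q" "finite Q'" "E ` Q \<inter> E ` Q' = {}"
  shows "multi_moment \<mu> (Q \<union> Q') E = multi_moment \<mu> Q E * multi_moment \<mu> Q' E"
proof -
  have "{t \<in> Q \<union> Q'. E t = e} = {t \<in> Q. E t = e}" if "e \<in> E ` Q" for e
    using that assms by auto
  moreover have "{t \<in> Q \<union> Q'. E t = e} = {t \<in> Q'. E t = e}" if "e \<in> E ` Q'" for e
    using that assms by auto
  ultimately show ?thesis
    using assms unfolding multi_moment_def image_Un
    by (subst prod.union_disjoint) (auto intro!: arg_cong2[where f="(*)"] prod.cong)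
qed

text \<open>An edge with exactly two traversals contributes the factor
  \<open>\<mu> 2 = 1\<close>.\<close>

lemma multi_moment_delete_pair:
  assumes "\<mu> 2 = 1" "finite Q" "a \<in> Q" "b \<in> Q" "a \<noteq> b" "E a = E b"
    and "\<And>u. u \<in> Q \<Longrightarrow> E u = E a \<Longrightarrow> u = a \<or> u = b"
  shows "multi_moment \<mu> Q E = multi_moment \<mu> (Q - {a, b}) E"
proof -
  have "multi_moment \<mu> ({a, b} \<union> (Q - {a, b})) E
      = multi_moment \<mu> {a, b} E * multi_moment \<mu> (Q - {a, b}) E"
  proof (rule multi_moment_union_disjoint)
    have "E u \<noteq> E a" if "u \<in> Q - {a, b}" for u using assms(7)[of u] that by blast
    then show "E ` {a, b} \<inter> E ` (Q - {a, b}) = {}" using assms(6) by fastforce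
  qed (use assms in auto)
  moreover have "{a, b} \<union> (Q - {a, b}) = Q" using assms by auto
  moreover have "{t. (t = a \<or> t = b) \<and> E t = E b} = {a, b}" using assms by auto
  moreover have "multi_moment \<mu> {a, b} E = 1"
    using calculation(3) assms by (simp add: multi_moment_def numeral_2_eq_2)
  ultimately show ?thesis by simp
qed

lemma multi_moment_single_zero:
  assumes "\<mu> 1 = 0" "finite Q" "t \<in> Q" "\<And>u. u \<in> Q \<Longrightarrow> E u = E t \<Longrightarrow> u = t"
  shows "multi_moment \<mu> Q E = 0"
proof -
  have "{u \<in> Q. E u = E t} = {t}" using assms by auto
  then have "\<mu> (card {u \<in> Q. E u = E t}) = 0" using assms by simp
  then show ?thesis using assms unfolding multi_moment_def by (intro prod_zero) auto
qed

text \<open>Unordered, since both directions of traversal read the same matrix entry; the types of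
  the labels restore which end is the row.\<close>

definition edge :: "('a \<Rightarrow> 'a) \<Rightarrow> ('a \<Rightarrow> 'v) \<Rightarrow> 'a \<Rightarrow> 'v set" where
  "edge s x t = {x t, x (s t)}"

definition cov_weight ::
  "(nat \<Rightarrow> real) \<Rightarrow> ('a \<Rightarrow> 'a) \<Rightarrow> 'a set \<Rightarrow> 'a set \<Rightarrow> ('a \<Rightarrow> 'v) \<Rightarrow> real" where
  "cov_weight \<mu> s P1 P2 x = multi_moment \<mu> (P1 \<union> P2) (edge s x)
     - multi_moment \<mu> P1 (edge s x) * multi_moment \<mu> P2 (edge s x)"

lemma cov_weight_commute: "cov_weight \<mu> s P1 P2 x = cov_weight \<mu> s P2 P1 x"
  by (simp add: cov_weight_def Un_commute mult.commute)

text \<open>\<open>P1\<close> and \<open>P2\<close> are the positions of two closed walks with successor map \<open>s\<close>; \<open>ty\<close> tells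
  whether a position carries a row index or a column index, and alternates along the walks.\<close>

definition two_cycles :: "('a \<Rightarrow> 'a) \<Rightarrow> 'a set \<Rightarrow> 'a set \<Rightarrow> ('a \<Rightarrow> bool) \<Rightarrow> bool" where
  "two_cycles s P1 P2 ty \<longleftrightarrow> single_cycle s P1 \<and> single_cycle s P2 \<and> P1 \<inter> P2 = {} \<and>
     (\<forall>u\<in>P1 \<union> P2. ty (s u) = (\<not> ty u))"

lemma two_cycles_commute: "two_cycles s P1 P2 ty \<longleftrightarrow> two_cycles s P2 P1 ty"
  by (auto simp: two_cycles_def Un_commute Int_commute)

text \<open>Without a shared edge the walks involve independent variables and the expectation
  factors. An edge traversed only once in total brings the factor \<open>\<mu> 1 = 0\<close> into
  both terms.\<close>

lemma cov_weight_nonzeroD: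
  assumes "\<mu> 1 = 0" "finite P1" "finite P2" "cov_weight \<mu> s P1 P2 x \<noteq> 0"
  shows "\<exists>t1\<in>P1. \<exists>t2\<in>P2. edge s x t1 = edge s x t2"
    and "\<And>t. t \<in> P1 \<union> P2 \<Longrightarrow> \<exists>u\<in>P1 \<union> P2. u \<noteq> t \<and> edge s x u = edge s x t"
proof -
  show "\<exists>t1\<in>P1. \<exists>t2\<in>P2. edge s x t1 = edge s x t2"
  proof (rule ccontr)
    assume "\<not> ?thesis"
    then have "edge s x ` P1 \<inter> edge s x ` P2 = {}" by auto
    then have "cov_weight \<mu> s P1 P2 x = 0"
      using assms by (simp add: cov_weight_def multi_moment_union_disjoint)
    with assms show False by simp
  qed
  show "\<exists>u\<in>P1 \<union> P2. u \<noteq> t \<and> edge s x u = edge s x t" if t: "t \<in> P1 \<union> P2" for t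
  proof (rule ccontr)
    assume *: "\<not> ?thesis"
    then have "multi_moment \<mu> (P1 \<union> P2) (edge s x) = 0"
      using assms t by (intro multi_moment_single_zero[of _ _ t]) auto
    moreover have "multi_moment \<mu> P1 (edge s x) = 0 \<or> multi_moment \<mu> P2 (edge s x) = 0"
      using t
    proof
      assume "t \<in> P1"
      then have "multi_moment \<mu> P1 (edge s x) = 0"
        using assms * by (intro multi_moment_single_zero[of _ _ t]) auto
      then show ?thesis ..
    next
      assume "t \<in> P2"
      then have "multi_moment \<mu> P2 (edge s x) = 0"
        using assms * by (intro multi_moment_single_zero[of _ _ t]) auto
      then show ?thesis ..
    qed
    ultimately show False using assms by (auto simp: cov_weight_def)
  qed
qed

text \<open>A leaf is named by the position \<open>t\<close> that precedes it: it is the vertex at \<open>s t\<close> that is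
  visited only once.\<close>

definition leaf :: "('a \<Rightarrow> 'a) \<Rightarrow> 'a set \<Rightarrow> ('a \<Rightarrow> 'v) \<Rightarrow> 'a \<Rightarrow> bool" where
  "leaf s P x t \<longleftrightarrow> (\<forall>u\<in>P. x u = x (s t) \<longrightarrow> u = s t)"

locale two_cycles_loc =
  fixes s :: "'a \<Rightarrow> 'a" and P1 P2 :: "'a set" and ty :: "'a \<Rightarrow> bool"
  assumes two: "two_cycles s P1 P2 ty"
begin

abbreviation "P \<equiv> P1 \<union> P2"

lemma cyc: "single_cycle s P1" "single_cycle s P2" and dis: "P1 \<inter> P2 = {}"
  and ty_s: "u \<in> P \<Longrightarrow> ty (s u) \<longleftrightarrow> \<not> ty u"
  using two by (auto simp: two_cycles_def)

lemma fin: "finite P1" "finite P2"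
  using cyc single_cycle_finite by blast+

lemma s_in: "u \<in> P1 \<Longrightarrow> s u \<in> P1" "u \<in> P2 \<Longrightarrow> s u \<in> P2" "u \<in> P \<Longrightarrow> s u \<in> P"
  using single_cycle_in[OF cyc(1)] single_cycle_in[OF cyc(2)] by simp_all (metis UnE)

lemma s_inj: "u \<in> P \<Longrightarrow> v \<in> P \<Longrightarrow> s u = s v \<Longrightarrow> u = v"
  using inj_onD[OF single_cycle_inj[OF cyc(1)]] inj_onD[OF single_cycle_inj[OF cyc(2)]]
    s_in(1)[of u] s_in(1)[of v] s_in(2)[of u] s_in(2)[of v] dis
  by (metis UnE disjoint_iff)

lemma s_surj: "v \<in> P \<Longrightarrow> \<exists>u\<in>P. s u = v"
  using single_cycle_surj[OF cyc(1)] single_cycle_surj[OF cyc(2)] by (metis UnCI UnE imageE)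

lemma s_ne: "u \<in> P \<Longrightarrow> s u \<noteq> u" "u \<in> P \<Longrightarrow> s (s u) \<noteq> s u"
  using ty_s[of u] ty_s[of "s u"] s_in(3)[of u] by force+

lemma two_cycle_P1: 
  assumes "t \<in> P1" "s (s t) = t" shows "P1 = {t, s t}"
  by (rule single_cycle_minimal[OF cyc(1), symmetric]) (use assms s_in(1)[of t] in simp_all)

text \<open>A leaf is visited once, so only the step into it and the step out of it touch
  it.\<close>

lemma leaf_edge:
  assumes "t \<in> P" "leaf s P x t" "u \<in> P" "x (s t) \<in> edge s x u"
  shows "u = t \<or> u = s t"
proof -
  consider "x u = x (s t)" | "x (s u) = x (s t)" using assms(4) by (auto simp: edge_def)
  then show ?thesis
  proof cases
    case 1 then show ?thesis using assms by (simp add: leaf_def)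
  next
    case 2 then have "s u = s t" using assms s_in(3) by (simp add: leaf_def)
    then show ?thesis using s_inj assms by blast
  qed
qed

text \<open>The edge into the leaf must be traversed again, and the only other step touching the
  leaf is the one leaving it; so the walk returns to where it came from.\<close>

lemma leaf_backtrack:
  assumes "\<mu> 1 = 0" "cov_weight \<mu> s P1 P2 x \<noteq> 0" "t \<in> P" "leaf s P x t"
  shows "x (s (s t)) = x t"
proof -
  obtain u where u: "u \<in> P" "u \<noteq> t" "edge s x u = edge s x t"
    using cov_weight_nonzeroD(2)[OF assms(1) fin assms(2,3)] by blast
  have "x (s t) \<in> edge s x t" by (simp add: edge_def)
  with leaf_edge[OF assms(3,4) u(1)] u have "u = s t" by auto
  then show ?thesis using u(3) by (auto simp: edge_def doubleton_eq_iff)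
qed

text \<open>The two-step walk consists of the edge to the leaf alone, which the other walk cannot
  use, so no edge is shared. The case is separate because nothing of the walk would remain after
  deletion.\<close>

lemma leaf_short_zero:
  assumes "\<mu> 1 = 0" "t \<in> P1" "leaf s P x t" "s (s t) = t"
  shows "cov_weight \<mu> s P1 P2 x = 0"
proof (rule ccontr)
  assume "\<not> ?thesis"
  then obtain t1 t2 where t: "t1 \<in> P1" "t2 \<in> P2" "edge s x t1 = edge s x t2"
    using cov_weight_nonzeroD(1)[of \<mu> P1 P2 s x] assms(1) fin by blast
  have "t1 = t \<or> t1 = s t" using two_cycle_P1[OF assms(2,4)] t by auto
  then have "x (s t) \<in> edge s x t2" using t by (auto simp: edge_def)
  then have "t2 = t \<or> t2 = s t" using leaf_edge[of t x t2] assms t by blast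
  then have "t2 \<in> P1" using assms(2) s_in(1) by blast
  with t dis show False by auto
qed

end

text \<open>At a backtracking step, \<open>t\<close> and \<open>s (s t)\<close> carry the same
  label; the position \<open>t\<close> is dropped together with the leaf, and \<open>s (s t)\<close>
  keeps the label.\<close>

definition skip :: "('a \<Rightarrow> 'a) \<Rightarrow> 'a \<Rightarrow> 'a \<Rightarrow> 'a" where
  "skip s t u = (if s u = t then s (s t) else s u)"

locale deletion = two_cycles_loc +
  fixes t
  assumes t: "t \<in> P1" and sst: "s (s t) \<noteq> t"
begin

abbreviation "s' \<equiv> skip s t"
abbreviation "P1' \<equiv> P1 - {t, s t}"
abbreviation "P' \<equiv> P1' \<union> P2"

lemma tP: "t \<in> P" "s t \<in> P" "s (s t) \<in> P" "s (s t) \<noteq> s t" "s t \<noteq> t" "t \<notin> P2" "s t \<notin> P2"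
  using t s_in(1)[of t] s_in(1)[of "s t"] s_ne[of t] dis by auto

lemma P'_eq: "P' = P - {t, s t}" using tP by auto

lemma skip_P2: "u \<in> P2 \<Longrightarrow> s' u = s u" using tP s_in by (auto simp: skip_def)

lemma two': "two_cycles s' P1' P2 ty"
proof -
  have "single_cycle s' P1'"
    unfolding skip_def[abs_def] using tP sst t by (intro single_cycle_delete cyc(1)) auto
  moreover have "single_cycle s' P2"
  proof -
    have "s' ` A = s ` A" if "A \<subseteq> P2" for A using skip_P2 that by (intro image_cong) auto
    then show ?thesis using cyc(2) unfolding single_cycle_def by simp
  qed
  moreover have "ty (s' u) = (\<not> ty u)" if "u \<in> P'" for u
    using that tP ty_s[of u] ty_s[of t] ty_s[of "s t"] by (auto simp: skip_def)
  ultimately show ?thesis using dis by (auto simp: two_cycles_def)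
qed

sublocale del: two_cycles_loc s' P1' P2 ty
  by unfold_locales (rule two')

lemma card_P1': "card P1 = card P1' + 2"
proof -
  have "card {t, s t} = 2" using tP by auto
  moreover have "{t, s t} \<subseteq> P1" using t s_in by auto
  ultimately show ?thesis using fin card_mono[of P1 "{t, s t}"] by (simp add: card_Diff_subset)
qed

lemma edge_delete:
  assumes "x (s (s t)) = x t" "\<And>u. u \<in> P' \<Longrightarrow> y u = x u" "u \<in> P'"
  shows "edge s' y u = edge s x u"
proof -
  have "s' u \<in> P'" using assms(3) del.s_in by blast
  then have "y (s' u) = x (s' u)" using assms(2) by blast
  also have "\<dots> = x (s u)" using assms(1) by (auto simp: skip_def)
  finally show ?thesis using assms by (simp add: edge_def)
qed

text \<open>Both traversals of the leaf edge lie in the same walk, so it contributes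
  \<open>\<mu> 2 = 1\<close> to both terms; the other edges survive because the dropped label at
  \<open>t\<close> reappears at \<open>s (s t)\<close>.\<close>

lemma cov_weight_delete:
  assumes "\<mu> 2 = 1" "leaf s P x t" "x (s (s t)) = x t" "\<And>u. u \<in> P' \<Longrightarrow> y u = x u"
  shows "cov_weight \<mu> s P1 P2 x = cov_weight \<mu> s' P1' P2 y"
proof -
  have ed: "edge s x u = edge s' y u" if "u \<in> P'" for u
    by (rule edge_delete[OF assms(3) _ that, symmetric]) (rule assms(4))
  have e: "edge s x t = edge s x (s t)" using assms(3) by (auto simp: edge_def)
  have only: "u = t \<or> u = s t" if "u \<in> P" "edge s x u = edge s x t" for u
    using leaf_edge[OF tP(1) assms(2) that(1)] that(2) by (auto simp: edge_def)
  have "multi_moment \<mu> P (edge s x) = multi_moment \<mu> (P - {t, s t}) (edge s x)"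
    by (rule multi_moment_delete_pair) (use assms(1) tP e only fin in simp_all)
  also have "\<dots> = multi_moment \<mu> P' (edge s' y)"
    unfolding P'_eq[symmetric] by (rule multi_moment_cong) (rule ed)
  finally have 1: "multi_moment \<mu> P (edge s x) = multi_moment \<mu> P' (edge s' y)" .
  have "multi_moment \<mu> P1 (edge s x) = multi_moment \<mu> P1' (edge s x)"
    by (rule multi_moment_delete_pair) (use assms(1) t tP e only fin s_in(1)[of t] in simp_all)
  also have "\<dots> = multi_moment \<mu> P1' (edge s' y)"
    by (rule multi_moment_cong, rule ed, rule UnI1)
  finally have 2: "multi_moment \<mu> P1 (edge s x) = multi_moment \<mu> P1' (edge s' y)" .
  have 3: "multi_moment \<mu> P2 (edge s x) = multi_moment \<mu> P2 (edge s' y)"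
    by (rule multi_moment_cong, rule ed, rule UnI2)
  show ?thesis using 1 2 3 by (simp add: cov_weight_def)
qed

text \<open>The case \<open>s u = t\<close> is excluded: before deletion the vertex at
  \<open>t\<close> is repeated at \<open>s (s t)\<close> and is no leaf, whereas afterwards it may
  become one.\<close>

lemma leaf_delete:
  assumes "leaf s P x t" "x (s (s t)) = x t" "\<And>u. u \<in> P' \<Longrightarrow> y u = x u"
    "u \<in> P'" "s u \<noteq> t"
  shows "leaf s' P' y u \<longleftrightarrow> leaf s P x u"
proof -
  have u: "s' u = s u" "s u \<in> P'" using assms(5) del.s_in(3)[OF assms(4)] by (auto simp: skip_def)
  have ust: "s u \<noteq> s (s t)" using s_inj[of u "s t"] assms(4) tP by auto
  have sst': "s (s t) \<in> P'" using sst tP t s_in by auto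
  have yu: "y (s u) = x (s u)" using assms(3) u by simp
  show ?thesis
  proof
    assume L: "leaf s' P' y u"
    show "leaf s P x u"
      unfolding leaf_def
    proof (intro ballI impI)
      fix w assume w: "w \<in> P" "x w = x (s u)"
      have "w \<noteq> s t"
      proof
        assume "w = s t"
        then have "x (s u) = x (s t)" using w(2) by simp
        moreover have "s u \<in> P" using u(2) by blast
        ultimately have "s u = s t" using assms(1) unfolding leaf_def by blast
        with u(2) tP(7) show False by simp
      qed
      have "w \<noteq> t"
      proof
        assume "w = t"
        then have "x (s (s t)) = x (s u)" using w(2) assms(2) by simp
        then have "y (s (s t)) = y (s' u)" using assms(3)[OF sst'] yu u(1) by simp
        then have "s (s t) = s' u" using L sst' unfolding leaf_def by blast
        with ust u(1) show False by simp
      qed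
      then have "w \<in> P'" using w \<open>w \<noteq> s t\<close> by auto
      moreover have "y w = y (s' u)" using assms(3)[OF calculation] w(2) yu u(1) by simp
      ultimately show "w = s u" using L u(1) unfolding leaf_def by metis
    qed
  next
    assume L: "leaf s P x u"
    show "leaf s' P' y u"
      unfolding leaf_def u
    proof (intro ballI impI)
      fix w assume w: "w \<in> P'" "y w = y (s u)"
      then have "w \<in> P" "x w = x (s u)" using assms(3)[OF w(1)] yu by auto
      then show "w = s u" using L unfolding leaf_def by blast
    qed
  qed
qed

end

section \<open>Leaf deletion\<close>

text \<open>\<open>U\<close> collects the places where leaves have already been split off:
  \<open>U = {}\<close> gives the sum that is wanted, \<open>U = P\<close> the leafless case where
  the recursion ends.\<close>

definition labellings ::
  "(bool \<Rightarrow> 'v set) \<Rightarrow> ('a \<Rightarrow> 'a) \<Rightarrow> 'a set \<Rightarrow> ('a \<Rightarrow> bool) \<Rightarrow> 'a set \<Rightarrow> (bool \<Rightarrow> nat) \<Rightarrow> ('a \<Rightarrow> 'v) set"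
  where "labellings Lab s P ty U bc = {x \<in> PiE P (\<lambda>t. Lab (ty t)).
     (\<forall>\<tau>. card (x ` P \<inter> Lab \<tau>) = bc \<tau>) \<and> (\<forall>t\<in>U. \<not> leaf s P x t)}"

definition cov_sum where
  "cov_sum \<mu> Lab s P1 P2 ty U bc = (\<Sum>x\<in>labellings Lab s (P1 \<union> P2) ty U bc. cov_weight \<mu> s P1 P2 x)"

text \<open>The candidates for the set of steps that retrace an edge for the second time within the same
  walk: reading the other steps as opening brackets and matching cyclically leaves \<open>2 * r\<close> unmatched
  steps in each walk. The pattern \<open>t \<notin> \<alpha>\<close>, \<open>s t \<in> \<alpha>\<close> corresponds to a leaf at \<open>s t\<close>, so \<open>U\<close> plays
  the same role as in \<open>labellings\<close>.\<close>

definition closing_sets where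
  "closing_sets s P1 P2 ty U bc r = {\<alpha>. \<alpha> \<subseteq> P1 \<union> P2 \<and> (\<forall>t\<in>U. t \<in> \<alpha> \<or> s t \<notin> \<alpha>) \<and>
     card P1 = 2 * r + 2 * card (\<alpha> \<inter> P1) \<and> card P2 = 2 * r + 2 * card (\<alpha> \<inter> P2) \<and>
     (\<forall>\<tau>. bc \<tau> = r + card {u \<in> \<alpha>. ty u = \<tau>})}"

lemma cov_sum_commute: "cov_sum \<mu> Lab s P1 P2 ty U bc = cov_sum \<mu> Lab s P2 P1 ty U bc"
  by (simp add: cov_sum_def Un_commute cov_weight_commute[of _ _ P1])

lemma closing_sets_commute: "closing_sets s P1 P2 ty U bc r = closing_sets s P2 P1 ty U bc r"
  by (auto simp: closing_sets_def)

lemma finite_labellings: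
  assumes "finite P" "\<And>\<tau>. finite (Lab \<tau>)"
  shows "finite (labellings Lab s P ty U bc)"
  unfolding labellings_def by (rule finite_subset[OF _ finite_PiE[of P "\<lambda>t. Lab (ty t)"]]) (use assms in auto)

lemma (in two_cycles_loc) finite_closing_sets: "finite (closing_sets s P1 P2 ty U bc r)"
  unfolding closing_sets_def by (rule finite_subset[of _ "Pow P"]) (use fin in auto)

text \<open>Counterpart of \<open>leaf_short_zero\<close>: with \<open>r \<ge> 1\<close>, a first
  walk of length two has no room for an element of \<open>\<alpha>\<close>.\<close>

lemma (in two_cycles_loc) closing_sets_short:
  assumes "t \<in> P1" "s (s t) = t" "t \<notin> U" "r \<ge> 1"
  shows "closing_sets s P1 P2 ty U bc r = closing_sets s P1 P2 ty (insert t U) bc r"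
proof -
  have P1: "P1 = {t, s t}" by (rule two_cycle_P1[OF assms(1,2)])
  have "card P1 = 2" using P1 s_ne[of t] assms by (metis UnI1 card_2_iff)
  have "t \<in> \<alpha> \<or> s t \<notin> \<alpha>" if "\<alpha> \<in> closing_sets s P1 P2 ty U bc r" for \<alpha>
  proof (rule ccontr)
    assume "\<not> ?thesis"
    then have "s t \<in> \<alpha> \<inter> P1" using assms(1) s_in(1) by simp
    then have "card (\<alpha> \<inter> P1) \<noteq> 0" using fin by auto
    then show False using that \<open>card P1 = 2\<close> assms(4) unfolding closing_sets_def by auto
  qed
  then show ?thesis unfolding closing_sets_def by auto
qed

text \<open>Deleting a vertex lowers one coordinate of \<open>bc\<close>; the condition
  \<open>f a \<noteq> 0\<close> guards the truncated subtraction.\<close>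

lemma eq_add_indicator_iff:
  fixes f k :: "'b \<Rightarrow> nat"
  shows "(\<forall>\<tau>. f \<tau> = k \<tau> + (if \<tau> = a then 1 else 0)) \<longleftrightarrow>
    f a \<noteq> 0 \<and> (\<forall>\<tau>. (f(a := f a - 1)) \<tau> = k \<tau>)" (is "?l \<longleftrightarrow> ?r")
proof
  assume l: ?l
  have "f a = k a + 1" using spec[OF l, of a] by simp
  then show ?r using l by simp
next
  assume r: ?r
  show ?l
  proof
    fix \<tau> show "f \<tau> = k \<tau> + (if \<tau> = a then 1 else 0)"
      using r spec[OF conjunct2[OF r], of \<tau>] by (cases "\<tau> = a") auto
  qed
qed

context deletion
begin

abbreviation "\<tau>t \<equiv> ty (s t)"

text \<open>In both uses \<open>t \<notin> U\<close>, and the conditions at \<open>s t\<close> and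
  at the predecessor of \<open>t\<close> hold automatically once \<open>s t\<close> carries a
  backtracking leaf (or \<open>t \<notin> \<alpha>\<close> and \<open>s t \<in> \<alpha>\<close>).
  After deletion the vertex at \<open>s (s t)\<close> is therefore unrestricted.\<close>

definition U' :: "'a set \<Rightarrow> 'a set" where
  "U' U = {u \<in> U. u \<noteq> t \<and> u \<noteq> s t \<and> s u \<noteq> t}"

text \<open>Either the condition at \<open>t\<close> holds, or \<open>t\<close> lies outside and
  \<open>s t\<close> inside the set. Removing \<open>s t\<close> then takes one element from
  \<open>\<alpha>\<close> and two positions from the walk, so \<open>r\<close> does not
  change.\<close>

lemma closing_sets_delete_card:
  assumes "t \<notin> U" "U \<subseteq> P"
  shows "card (closing_sets s P1 P2 ty U bc r) = card (closing_sets s P1 P2 ty (insert t U) bc r)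
    + (if bc \<tau>t = 0 then 0 else card (closing_sets s' P1' P2 ty (U' U) (bc(\<tau>t := bc \<tau>t - 1)) r))"
proof -
  let ?B = "closing_sets s P1 P2 ty U bc r" and ?C = "closing_sets s P1 P2 ty (insert t U) bc r"
  let ?D = "{\<alpha> \<in> ?B. t \<notin> \<alpha> \<and> s t \<in> \<alpha>}"
  have "?B = ?C \<union> ?D" "?C \<inter> ?D = {}" by (auto simp: closing_sets_def)
  then have 1: "card ?B = card ?C + card ?D"
    using finite_closing_sets by (metis card_Un_disjoint finite_Un)
  have rel: "insert (s t) \<beta> \<in> ?D \<longleftrightarrow> bc \<tau>t \<noteq> 0 \<and> \<beta> \<in> closing_sets s' P1' P2 ty (U' U) (bc(\<tau>t := bc \<tau>t - 1)) r"
    if \<beta>: "\<beta> \<subseteq> P'" for \<beta>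
  proof -
    have nb: "t \<notin> \<beta>" "s t \<notin> \<beta>" using \<beta> tP by auto
    have finb: "finite \<beta>" using \<beta> fin finite_subset by blast
    have a: "(\<forall>u\<in>U. u \<in> insert (s t) \<beta> \<or> s u \<notin> insert (s t) \<beta>) \<longleftrightarrow> (\<forall>u\<in>U' U. u \<in> \<beta> \<or> s' u \<notin> \<beta>)"
    proof -
      have "(u \<in> insert (s t) \<beta> \<or> s u \<notin> insert (s t) \<beta>) \<longleftrightarrow> (u \<in> U' U \<longrightarrow> u \<in> \<beta> \<or> s' u \<notin> \<beta>)"
        if u: "u \<in> U" for u
      proof (cases "u \<in> U' U")
        case True
        then have u': "u \<noteq> t" "u \<noteq> s t" "s u \<noteq> t" by (auto simp: U'_def)
        then have "s' u = s u" by (simp add: skip_def)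
        moreover have "s u \<noteq> s t" using s_inj[of u t] u assms(2) tP u' by blast
        ultimately show ?thesis using u' True by simp
      next
        case False
        then have "u = s t \<or> s u = t" using u assms(1) by (auto simp: U'_def)
        then show ?thesis using False nb tP by auto
      qed
      then show ?thesis by (auto simp: U'_def)
    qed
    have b: "insert (s t) \<beta> \<inter> P1 = insert (s t) (\<beta> \<inter> P1')" "insert (s t) \<beta> \<inter> P2 = \<beta> \<inter> P2"
      using \<beta> nb tP t s_in(1)[of t] by auto
    have c: "card (insert (s t) \<beta> \<inter> P1) = Suc (card (\<beta> \<inter> P1'))"
      unfolding b using finb nb by simp
    have d: "{u \<in> insert (s t) \<beta>. ty u = \<tau>} = (if \<tau> = \<tau>t then insert (s t) {u \<in> \<beta>. ty u = \<tau>} else {u \<in> \<beta>. ty u = \<tau>})" for \<tau>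
      by auto
    have e: "card {u \<in> insert (s t) \<beta>. ty u = \<tau>} = card {u \<in> \<beta>. ty u = \<tau>} + (if \<tau> = \<tau>t then 1 else 0)" for \<tau>
      unfolding d using finb nb by auto
    have f: "(\<forall>\<tau>. bc \<tau> = r + (card {u \<in> \<beta>. ty u = \<tau>} + (if \<tau> = \<tau>t then 1 else 0)))
       \<longleftrightarrow> bc \<tau>t \<noteq> 0 \<and> (\<forall>\<tau>. (bc(\<tau>t := bc \<tau>t - 1)) \<tau> = r + card {u \<in> \<beta>. ty u = \<tau>})"
      using eq_add_indicator_iff[of bc "\<lambda>\<tau>. r + card {u \<in> \<beta>. ty u = \<tau>}" \<tau>t] by (simp add: add.assoc)
    have g: "insert (s t) \<beta> \<subseteq> P" using \<beta> tP by auto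
    show ?thesis
      unfolding closing_sets_def mem_Collect_eq e f c a card_P1' b(2) using g \<beta> nb tP by auto
  qed
  have D: "?D = insert (s t) ` {\<beta>. \<beta> \<subseteq> P' \<and> insert (s t) \<beta> \<in> ?D}" (is "_ = _ ` ?E")
  proof (rule Set.set_eqI, rule iffI)
    fix \<alpha> assume \<alpha>: "\<alpha> \<in> ?D"
    then have "\<alpha> \<subseteq> P" by (simp add: closing_sets_def)
    then have "\<alpha> - {s t} \<subseteq> P'" using \<alpha> by auto
    moreover have "insert (s t) (\<alpha> - {s t}) = \<alpha>" using \<alpha> by auto
    ultimately show "\<alpha> \<in> insert (s t) ` ?E" using \<alpha>
      using tP(5) by (intro image_eqI[of _ _ "\<alpha> - {s t}"]) auto
  qed auto
  have "inj_on (insert (s t)) {\<beta>. \<beta> \<subseteq> P'}"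
    using tP by (auto simp: inj_on_def)
  then have "inj_on (insert (s t)) ?E" by (rule inj_on_subset) blast
  then have "card ?D = card ?E" by (subst D) (rule card_image)
  also have "?E = (if bc \<tau>t = 0 then {} else closing_sets s' P1' P2 ty (U' U) (bc(\<tau>t := bc \<tau>t - 1)) r)"
    (is "_ = ?F")
  proof (rule Set.set_eqI)
    fix \<beta>
    show "\<beta> \<in> ?E \<longleftrightarrow> \<beta> \<in> ?F"
    proof (cases "\<beta> \<subseteq> P'")
      case True
      then show ?thesis using rel[OF True] by simp
    next
      case False
      then show ?thesis unfolding closing_sets_def[of s'] by simp
    qed
  qed
  finally show ?thesis using 1 by (simp split: if_splits)
qed

text \<open>The splitting parallels \<open>closing_sets_delete_card\<close>. A reduced labelling
  extends by any label of the leaf's type not yet in use, and \<open>bc \<tau>t - 1\<close> of these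
  are already taken.\<close>

lemma cov_sum_delete:
  fixes Lab :: "bool \<Rightarrow> 'v set"
  assumes mu: "\<mu> 1 = 0" "\<mu> 2 = 1" and Lab: "\<And>\<tau>. finite (Lab \<tau>)" "Lab True \<inter> Lab False = {}"
    and U: "t \<notin> U" "U \<subseteq> P"
  shows "cov_sum \<mu> Lab s P1 P2 ty U bc = cov_sum \<mu> Lab s P1 P2 ty (insert t U) bc
    + (if bc \<tau>t = 0 then 0 else (real (card (Lab \<tau>t)) - real (bc \<tau>t - 1)) *
        cov_sum \<mu> Lab s' P1' P2 ty (U' U) (bc(\<tau>t := bc \<tau>t - 1)))"
proof -
  let ?w = "cov_weight \<mu> s P1 P2" and ?w' = "cov_weight \<mu> s' P1' P2"
  let ?A = "labellings Lab s P ty U bc" and ?B = "labellings Lab s P ty (insert t U) bc"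
  let ?A' = "labellings Lab s' P' ty (U' U) (bc(\<tau>t := bc \<tau>t - 1))"
  define D where "D = {x \<in> ?A. leaf s P x t \<and> x (s (s t)) = x t}"
  have finP: "finite P" "finite P'" using fin by auto
  note finA = finite_labellings[OF finP(1) Lab(1)]
  have un: "?A = ?B \<union> {x \<in> ?A. leaf s P x t}" "?B \<inter> {x \<in> ?A. leaf s P x t} = {}"
    by (auto simp: labellings_def)
  have "sum ?w ?A = sum ?w (?B \<union> {x \<in> ?A. leaf s P x t})"
    by (rule arg_cong[where f="sum ?w"]) (rule un(1))
  also have "\<dots> = sum ?w ?B + sum ?w {x \<in> ?A. leaf s P x t}"
    by (rule sum.union_disjoint[OF _ _ un(2)]) (use finA in simp_all)
  \<comment> \<open>Leaves that are not tips of backtracking steps have weight zero.\<close>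
  also have "sum ?w {x \<in> ?A. leaf s P x t} = sum ?w D"
    by (rule sum.mono_neutral_right)
      (use finA leaf_backtrack[of \<mu> _ t] mu(1) tP(1) in \<open>auto simp: D_def\<close>)
  finally have split: "sum ?w ?A = sum ?w ?B + sum ?w D" .
  have sstP: "s (s t) \<in> P'" using sst tP t s_in(1)[of "s t"] s_in(1)[of t] by auto
  have ty_eq: "ty (s (s t)) = ty t" using ty_s[OF tP(1)] ty_s[OF tP(2)] by simp
  have Labne: "Lab a \<inter> Lab b = {}" if "a \<noteq> b" for a b
    using that Lab(2) by (cases a; cases b) auto
  \<comment> \<open>The label at \<open>t\<close> occurs again at \<open>s (s t)\<close>, so
    deleting both positions loses the label at \<open>s t\<close> at most.\<close>
  have img: "x ` P = insert (x (s t)) (x ` P')" if "x (s (s t)) = x t" for x :: "'a \<Rightarrow> 'v"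
  proof -
    have "P = insert (s t) (insert t P')" using tP by auto
    then have "x ` P = insert (x (s t)) (insert (x t) (x ` P'))" by (metis image_insert)
    moreover have "x t \<in> x ` P'" using sstP that by (metis imageI)
    ultimately show ?thesis by (simp add: insert_absorb)
  qed
  have key: "x \<in> ?A \<longleftrightarrow> bc \<tau>t \<noteq> 0 \<and> restrict x P' \<in> ?A'"
    if x: "x \<in> PiE P (\<lambda>t. Lab (ty t))" "leaf s P x t" "x (s (s t)) = x t" for x
  proof -
    let ?y = "restrict x P'"
    have yP: "?y ` P' = x ` P'" by (rule image_cong) auto
    have new: "x (s t) \<notin> x ` P'" using x(2) P'_eq unfolding leaf_def by auto
    have "x (s t) \<in> Lab \<tau>t" using x(1) tP by blast
    then have "x ` P \<inter> Lab \<tau> = (if \<tau> = \<tau>t then insert (x (s t)) (x ` P' \<inter> Lab \<tau>) else x ` P' \<inter> Lab \<tau>)" for \<tau>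
      using Labne[of \<tau> \<tau>t] unfolding img[OF x(3)] by auto
    then have c: "card (x ` P \<inter> Lab \<tau>) = card (x ` P' \<inter> Lab \<tau>) + (if \<tau> = \<tau>t then 1 else 0)" for \<tau>
      using new finP by auto
    have f: "(\<forall>\<tau>. card (x ` P' \<inter> Lab \<tau>) + (if \<tau> = \<tau>t then 1 else 0) = bc \<tau>)
       \<longleftrightarrow> bc \<tau>t \<noteq> 0 \<and> (\<forall>\<tau>. card (x ` P' \<inter> Lab \<tau>) = (bc(\<tau>t := bc \<tau>t - 1)) \<tau>)"
      using eq_add_indicator_iff[of bc "\<lambda>\<tau>. card (x ` P' \<inter> Lab \<tau>)" \<tau>t]
      by (simp only: eq_commute[of "bc _"] eq_commute[of "(bc(_ := _)) _"])
    have l: "(\<forall>u\<in>U. \<not> leaf s P x u) \<longleftrightarrow> (\<forall>u\<in>U' U. \<not> leaf s' P' ?y u)"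
    proof -
      have "(\<not> leaf s P x u) \<longleftrightarrow> (u \<in> U' U \<longrightarrow> \<not> leaf s' P' ?y u)" if u: "u \<in> U" for u
      proof (cases "u \<in> U' U")
        case True
        then have "u \<in> P'" "s u \<noteq> t" using u U by (auto simp: U'_def)
        then have "leaf s' P' ?y u \<longleftrightarrow> leaf s P x u"
          by (intro leaf_delete[OF x(2,3)]) auto
        then show ?thesis using True by simp
      next
        case False
        then have "u = s t \<or> s u = t" using u U by (auto simp: U'_def)
        then have "\<not> leaf s P x u"
        proof
          assume "u = s t"
          then show ?thesis using x(3) tP sst unfolding leaf_def by metis
        next
          assume "s u = t"
          then show ?thesis using x(3) tP sst unfolding leaf_def by metis
        qed
        then show ?thesis using False by simp
      qed
      then show ?thesis by (auto simp: U'_def)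
    qed
    have y: "?y \<in> PiE P' (\<lambda>t. Lab (ty t))" using x(1) by auto
    show ?thesis
      unfolding labellings_def mem_Collect_eq c f l yP using x(1) y by auto
  qed
  show ?thesis
  proof (cases "bc \<tau>t = 0")
    case True
    then have "D = {}" using key by (auto simp: D_def labellings_def)
    then show ?thesis using split True by (simp add: cov_sum_def)
  next
    case False
    \<comment> \<open>Inverse of the deletion: a reduced labelling together with a fresh label for
      the leaf; the value at \<open>t\<close> is copied from \<open>s (s t)\<close>.\<close>
    let ?S = "SIGMA y:?A'. Lab \<tau>t - y ` P'"
    let ?ext = "\<lambda>(y, l). y(t := y (s (s t)), s t := l)"
    have ext: "?ext (y, l) \<in> PiE P (\<lambda>t. Lab (ty t)) \<and> leaf s P (?ext (y, l)) t \<and>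
        ?ext (y, l) (s (s t)) = ?ext (y, l) t \<and> restrict (?ext (y, l)) P' = y"
      if "y \<in> ?A'" "l \<in> Lab \<tau>t - y ` P'" for y l
    proof -
      have y: "y \<in> PiE P' (\<lambda>t. Lab (ty t))" using that by (simp add: labellings_def)
      let ?x = "?ext (y, l)"
      have xP': "?x u = y u" if "u \<in> P'" for u using that tP by auto
      have "?x \<in> PiE P (\<lambda>t. Lab (ty t))"
      proof (rule PiE_I)
        fix u assume "u \<in> P"
        then consider "u = s t" | "u = t" | "u \<in> P'" by auto
        then show "?x u \<in> Lab (ty u)"
        proof cases
          case 1 then show ?thesis using \<open>l \<in> Lab \<tau>t - y ` P'\<close> by simp
        next
          case 2
          have "y (s (s t)) \<in> Lab (ty (s (s t)))" using y sstP by blast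
          then show ?thesis using 2 tP ty_eq by simp
        next
          case 3 then show ?thesis using PiE_mem[OF y 3] xP'[OF 3] by simp
        qed
      next
        fix u assume "u \<notin> P"
        then have "u \<noteq> t" "u \<noteq> s t" "u \<notin> P'" using tP by auto
        then show "?x u = undefined" using PiE_arb[OF y \<open>u \<notin> P'\<close>] by simp
      qed
      moreover have "leaf s P ?x t"
        unfolding leaf_def
      proof (intro ballI impI)
        fix u assume u: "u \<in> P" "?x u = ?x (s t)"
        have l: "?x (s t) = l" by simp
        show "u = s t"
        proof (rule ccontr)
          assume "u \<noteq> s t"
          then have "u = t \<or> u \<in> P'" using u by auto
          then have "?x u \<in> y ` P'"
          proof
            assume "u = t" then show ?thesis using sstP tP by simp
          next
            assume "u \<in> P'" then show ?thesis using xP' by simp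
          qed
          then show False using u l that by simp
        qed
      qed
      moreover have "?x (s (s t)) = ?x t" using sst tP by simp
      moreover have "restrict ?x P' = y"
        using xP' PiE_arb[OF y] by (intro HOL.ext) (simp add: restrict_def)
      ultimately show ?thesis by blast
    qed
    have "sum ?w D = (\<Sum>(y, l)\<in>?S. ?w' y)"
    proof (rule sum.reindex_bij_witness[where j="\<lambda>x. (restrict x P', x (s t))" and i="?ext"])
      fix x assume "x \<in> D"
      then have x: "x \<in> ?A" "x \<in> PiE P (\<lambda>t. Lab (ty t))" "leaf s P x t" "x (s (s t)) = x t"
        by (auto simp: D_def labellings_def)
      have "x (s t) \<in> Lab \<tau>t" using x(2) tP by blast
      moreover have "x (s t) \<notin> restrict x P' ` P'"
        using x(3) P'_eq unfolding leaf_def by auto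
      ultimately show "(restrict x P', x (s t)) \<in> ?S" using key[OF x(2-4)] x(1) by simp
      show "?ext (restrict x P', x (s t)) = x"
      proof
        fix u
        consider "u = s t" | "u = t" | "u \<in> P'" | "u \<notin> P" by auto
        then show "?ext (restrict x P', x (s t)) u = x u"
        proof cases
          case 2 then show ?thesis using x(4) sstP tP by simp
        next
          case 3 then show ?thesis using tP by auto
        next
          case 4 
          then have "u \<noteq> t" "u \<noteq> s t" "u \<notin> P'" using tP by auto
          then show ?thesis using PiE_arb[OF x(2) 4] by simp
        qed simp
      qed
      show "(case (restrict x P', x (s t)) of (y, l) \<Rightarrow> ?w' y) = ?w x"
        using cov_weight_delete[of \<mu> x "restrict x P'"] mu(2) x(3,4) by simp
    next
      fix z assume "z \<in> ?S"
      then obtain y l where z: "z = (y, l)" "y \<in> ?A'" "l \<in> Lab \<tau>t - y ` P'" by auto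
      note e = ext[OF z(2,3)]
      have "?ext (y, l) \<in> ?A" using e key[of "?ext (y, l)"] False z(2) by metis
      then show "?ext z \<in> D" unfolding z(1) D_def using e by blast
      show "(restrict (?ext z) P', ?ext z (s t)) = z" unfolding z(1) using e by simp
    qed
    also have "\<dots> = (\<Sum>y\<in>?A'. \<Sum>l\<in>Lab \<tau>t - y ` P'. ?w' y)"
      by (subst sum.Sigma[symmetric]) (use finite_labellings[OF finP(2) Lab(1)] Lab(1) in auto)
    also have "\<dots> = (\<Sum>y\<in>?A'. (real (card (Lab \<tau>t)) - real (bc \<tau>t - 1)) * ?w' y)"
    proof (rule sum.cong[OF refl])
      fix y assume "y \<in> ?A'"
      then have "card (y ` P' \<inter> Lab \<tau>t) = bc \<tau>t - 1" by (simp add: labellings_def)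
      moreover have "card (Lab \<tau>t - y ` P') = card (Lab \<tau>t) - card (y ` P' \<inter> Lab \<tau>t)"
        using card_Diff_subset_Int[of "Lab \<tau>t" "y ` P'"] Lab(1) by (simp add: Int_commute)
      moreover have "card (y ` P' \<inter> Lab \<tau>t) \<le> card (Lab \<tau>t)"
        using Lab(1) by (intro card_mono) auto
      ultimately show "(\<Sum>l\<in>Lab \<tau>t - y ` P'. ?w' y) = (real (card (Lab \<tau>t)) - real (bc \<tau>t - 1)) * ?w' y"
        by (simp add: of_nat_diff)
    qed
    also have "\<dots> = (real (card (Lab \<tau>t)) - real (bc \<tau>t - 1)) * sum ?w' ?A'"
      by (simp add: sum_distrib_left)
    finally show ?thesis using split False by (simp add: cov_sum_def)
  qed
qed

end

section \<open>Leafless labellings\<close>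

text \<open>A common cycle of length \<open>2 * r\<close> can be traversed by the second walk in \<open>2 * r\<close> ways. For
  \<open>r = 1\<close> it degenerates to one edge of multiplicity four, of weight \<open>\<mu> 4 - 1 = 2 + (\<mu> 4 - 3)\<close>.\<close>

definition leading_count where
  "leading_count \<mu> Lab s P1 P2 ty U bc R = (\<Prod>\<tau>\<in>UNIV. \<Prod>i<bc \<tau>. real (card (Lab \<tau>)) - real i) *
     (\<Sum>r=1..R. (2 * real r + (if r = 1 then \<mu> 4 - 3 else 0)) *
        real (card (closing_sets s P1 P2 ty U bc r)))"

lemma leading_count_commute:
  "leading_count \<mu> Lab s P1 P2 ty U bc R = leading_count \<mu> Lab s P2 P1 ty U bc R"
  by (simp only: leading_count_def closing_sets_commute[of s P1])

text \<open>The last factor of the falling factorial for the leaf's type is the number of choices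
  for the leaf; the rest is \<open>closing_sets_delete_card\<close> for each
  \<open>r\<close>.\<close>

lemma (in deletion) leading_count_delete:
  assumes "t \<notin> U" "U \<subseteq> P"
  shows "leading_count \<mu> Lab s P1 P2 ty U bc R = leading_count \<mu> Lab s P1 P2 ty (insert t U) bc R
    + (if bc \<tau>t = 0 then 0 else (real (card (Lab \<tau>t)) - real (bc \<tau>t - 1)) *
        leading_count \<mu> Lab s' P1' P2 ty (U' U) (bc(\<tau>t := bc \<tau>t - 1)) R)"
proof -
  let ?c = "\<lambda>r. 2 * real r + (if r = 1 then \<mu> 4 - 3 else 0)"
  let ?bc = "bc(\<tau>t := bc \<tau>t - 1)"
  let ?f = "\<lambda>bc. \<Prod>\<tau>\<in>UNIV. \<Prod>i<bc \<tau>. real (card (Lab \<tau>)) - real i"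
  have f: "?f bc = (real (card (Lab \<tau>t)) - real (bc \<tau>t - 1)) * ?f ?bc" if nz: "bc \<tau>t \<noteq> 0"
  proof -
    have rem: "?f b = (\<Prod>i<b \<tau>t. real (card (Lab \<tau>t)) - real i) *
        (\<Prod>\<tau>\<in>UNIV - {\<tau>t}. \<Prod>i<b \<tau>. real (card (Lab \<tau>)) - real i)" for b
      by (rule prod.remove) auto
    have "(\<Prod>\<tau>\<in>UNIV - {\<tau>t}. \<Prod>i<bc \<tau>. real (card (Lab \<tau>)) - real i)
        = (\<Prod>\<tau>\<in>UNIV - {\<tau>t}. \<Prod>i<?bc \<tau>. real (card (Lab \<tau>)) - real i)"
      by (rule prod.cong) auto
    moreover obtain k where "bc \<tau>t = Suc k" using nz not0_implies_Suc by blast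
    ultimately show ?thesis unfolding rem[of bc] rem[of ?bc] by simp
  qed
  show ?thesis
    unfolding leading_count_def closing_sets_delete_card[OF assms]
    by (cases "bc \<tau>t = 0") (simp_all add: f distrib_left sum.distrib mult.assoc)
qed

text \<open>With conditions everywhere the complement of \<open>\<alpha>\<close> is closed under
  \<open>s\<close>, so \<open>\<alpha>\<close> contains all or nothing of each walk; the length
  equation with \<open>r \<ge> 1\<close> rules out all.\<close>

lemma (in two_cycles_loc) closing_sets_core:
  assumes "r \<ge> 1"
  shows "closing_sets s P1 P2 ty P bc r =
    (if card P1 = 2 * r \<and> card P2 = 2 * r \<and> (\<forall>\<tau>. bc \<tau> = r) then {{}} else {})"
proof -
  have "\<alpha> = {}" if \<alpha>: "\<alpha> \<in> closing_sets s P1 P2 ty P bc r" for \<alpha>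
  proof -
    have cl: "s u \<notin> \<alpha>" if "u \<in> P" "u \<notin> \<alpha>" for u using \<alpha> that by (auto simp: closing_sets_def)
    have "\<alpha> \<inter> Q = {}" if Q: "single_cycle s Q" "Q \<subseteq> P" "card Q = 2 * r + 2 * card (\<alpha> \<inter> Q)" for Q
    proof -
      have "\<not> Q \<subseteq> \<alpha>"
      proof
        assume "Q \<subseteq> \<alpha>"
        then have "\<alpha> \<inter> Q = Q" by blast
        with Q(3) assms show False by simp
      qed
      then have "Q - \<alpha> = Q"
        by (intro single_cycle_minimal[OF Q(1)]) (use cl Q(2) single_cycle_in[OF Q(1)] in auto)
      then show ?thesis by blast
    qed
    from this[of P1] this[of P2] have "\<alpha> \<inter> P1 = {}" "\<alpha> \<inter> P2 = {}"
      using \<alpha> cyc by (auto simp: closing_sets_def)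
    then show ?thesis using \<alpha> by (auto simp: closing_sets_def)
  qed
  then have "closing_sets s P1 P2 ty P bc r \<subseteq> {{}}" by blast
  moreover have "{} \<in> closing_sets s P1 P2 ty P bc r \<longleftrightarrow>
      card P1 = 2 * r \<and> card P2 = 2 * r \<and> (\<forall>\<tau>. bc \<tau> = r)"
    by (simp add: closing_sets_def)
  ultimately show ?thesis by (auto split: if_splits)
qed

text \<open>\<open>s\<close> maps each type injectively into the other.\<close>

lemma single_cycle_card_type:
  assumes c: "single_cycle s P" and ty: "\<And>u. u \<in> P \<Longrightarrow> ty (s u) = (\<not> ty u)"
  shows "card P = 2 * card {u \<in> P. ty u = \<tau>}"
proof -
  let ?A = "\<lambda>\<tau>. {u \<in> P. ty u = \<tau>}"
  have f: "finite P" using c by (rule single_cycle_finite)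
  have le: "card (?A \<tau>) \<le> card (?A (\<not> \<tau>))" for \<tau>
  proof (rule card_inj_on_le[of s])
    show "inj_on s (?A \<tau>)" using single_cycle_inj[OF c] by (rule inj_on_subset) blast
    show "s ` ?A \<tau> \<subseteq> ?A (\<not> \<tau>)" using ty single_cycle_in[OF c] by auto
  qed (use f in simp)
  have "card (?A \<tau>) = card (?A (\<not> \<tau>))" using le[of \<tau>] le[of "\<not> \<tau>"] by simp
  moreover have "card P = card (?A \<tau> \<union> ?A (\<not> \<tau>))" by (rule arg_cong[where f=card]) auto
  moreover have "card (?A \<tau> \<union> ?A (\<not> \<tau>)) = card (?A \<tau>) + card (?A (\<not> \<tau>))"
    using f by (intro card_Un_disjoint) auto
  ultimately show ?thesis by linarith
qed

text \<open>An equivariant map between cyclic permutations is determined by its value at one point,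
  and that value may be any point of the right type.\<close>

lemma card_equivariant:
  assumes c: "single_cycle s P" and c': "single_cycle s' P'" and card: "card P = card P'"
    and ty: "\<And>u. u \<in> P \<Longrightarrow> ty (s u) = (\<not> ty u)" "\<And>u. u \<in> P' \<Longrightarrow> ty (s' u) = (\<not> ty u)"
    and a: "a \<in> P"
  shows "card {h \<in> PiE P (\<lambda>v. {u \<in> P'. ty u = ty v}). \<forall>v\<in>P. h (s v) = s' (h v)}
     = card {u \<in> P'. ty u = ty a}" (is "card ?H = _")
proof (rule bij_betw_same_card[of "\<lambda>h. h a"], rule bij_betw_imageI)
  show "inj_on (\<lambda>h. h a) ?H"
  proof (rule inj_onI)
    fix g h assume g: "g \<in> ?H" and h: "h \<in> ?H" and eq: "g a = h a"
    have "g v = h v" if "v \<in> P" for v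
      by (rule single_cycle_induct[OF c a, of "\<lambda>v. g v = h v"]) (use g h eq that in auto)
    then show "g = h" using g h by (intro PiE_ext[of g P _ h]) auto
  qed
  show "(\<lambda>h. h a) ` ?H = {u \<in> P'. ty u = ty a}"
  proof (rule Set.set_eqI, rule iffI)
    fix u assume "u \<in> (\<lambda>h. h a) ` ?H"
    then show "u \<in> {u \<in> P'. ty u = ty a}" using a by blast
  next
    fix u assume u: "u \<in> {u \<in> P'. ty u = ty a}"
    then obtain h where h: "bij_betw h P P'" "h a = u" "\<forall>v\<in>P. h (s v) = s' (h v)"
      using single_cycle_intertwiner[OF c c' card a, of u] by auto
    have hP: "h v \<in> P'" if "v \<in> P" for v using h(1) that by (rule bij_betwE[THEN bspec])
    have "ty (h v) = ty v" if "v \<in> P" for v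
      by (rule single_cycle_induct[OF c a, of "\<lambda>v. ty (h v) = ty v"]) (use u h ty hP that in auto)
    then have "restrict h P \<in> ?H" using hP h(3) single_cycle_in[OF c] by auto
    moreover have "u = restrict h P a" using h(2) a by simp
    ultimately show "u \<in> (\<lambda>h. h a) ` ?H" by blast
  qed
qed

text \<open>Labels are chosen position by position. When a type has too few labels, one of the real
  factors is zero, so the formula remains correct.\<close>

lemma card_inj_labellings:
  fixes Lab :: "bool \<Rightarrow> 'v set"
  assumes "finite Q" and Lab: "\<And>\<tau>. finite (Lab \<tau>)" "Lab True \<inter> Lab False = {}"
  shows "real (card {y \<in> PiE Q (\<lambda>t. Lab (ty t)). inj_on y Q})
    = (\<Prod>\<tau>\<in>UNIV. \<Prod>i<card {u \<in> Q. ty u = \<tau>}. real (card (Lab \<tau>)) - real i)"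
  using assms(1)
proof (induction Q rule: finite_induct)
  case empty
  then show ?case by (simp add: PiE_empty_domain)
next
  case (insert a Q)
  let ?I = "\<lambda>Q. {y \<in> PiE Q (\<lambda>t. Lab (ty t)). inj_on y Q}"
  let ?n = "\<lambda>\<tau>. card {u \<in> Q. ty u = \<tau>}"
  let ?S = "SIGMA y:?I Q. Lab (ty a) - y ` Q"
  have Labne: "Lab \<sigma> \<inter> Lab \<tau> = {}" if "\<sigma> \<noteq> \<tau>" for \<sigma> \<tau>
    using that Lab(2) by (cases \<sigma>; cases \<tau>) auto
  have bij: "bij_betw (\<lambda>(y, l). y(a := l)) ?S (?I (insert a Q))"
  proof (rule bij_betw_byWitness[where f'="\<lambda>x. (restrict x Q, x a)"])
    show "\<forall>z\<in>?S. (\<lambda>x. (restrict x Q, x a)) ((\<lambda>(y, l). y(a := l)) z) = z"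
    proof
      fix z assume "z \<in> ?S"
      then obtain y l where z: "z = (y, l)" "y \<in> PiE Q (\<lambda>t. Lab (ty t))" by auto
      have "restrict (y(a := l)) Q = y"
        using insert(2) PiE_arb[OF z(2)] by (intro HOL.ext) (auto simp: restrict_def)
      then show "(\<lambda>x. (restrict x Q, x a)) ((\<lambda>(y, l). y(a := l)) z) = z" using z(1) by simp
    qed
    show "\<forall>x\<in>?I (insert a Q). (\<lambda>(y, l). y(a := l)) (restrict x Q, x a) = x"
    proof
      fix x assume "x \<in> ?I (insert a Q)"
      then have x: "x \<in> PiE (insert a Q) (\<lambda>t. Lab (ty t))" by simp
      then show "(\<lambda>(y, l). y(a := l)) (restrict x Q, x a) = x"
        using PiE_arb[OF x] by (intro HOL.ext) (auto simp: restrict_def)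
    qed
    show "(\<lambda>(y, l). y(a := l)) ` ?S \<subseteq> ?I (insert a Q)"
    proof (rule image_subsetI)
      fix z assume "z \<in> ?S"
      then obtain y l where z: "z = (y, l)" and y: "y \<in> PiE Q (\<lambda>t. Lab (ty t))" "inj_on y Q"
        and l: "l \<in> Lab (ty a)" "l \<notin> y ` Q" by auto
      have "y(a := l) \<in> PiE (insert a Q) (\<lambda>t. Lab (ty t))" using l(1) y(1) by (rule PiE_fun_upd)
      moreover have "inj_on (y(a := l)) (insert a Q)" using y(2) l(2) insert(2)
        by (auto simp: inj_on_def)
      ultimately show "(case z of (y, l) \<Rightarrow> y(a := l)) \<in> ?I (insert a Q)" using z by simp
    qed
    show "(\<lambda>x. (restrict x Q, x a)) ` ?I (insert a Q) \<subseteq> ?S"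
    proof (rule image_subsetI)
      fix x assume "x \<in> ?I (insert a Q)"
      then have x: "x \<in> PiE (insert a Q) (\<lambda>t. Lab (ty t))" "inj_on x (insert a Q)" by auto
      have "restrict x Q \<in> PiE Q (\<lambda>t. Lab (ty t))" using x(1) by auto
      moreover have "inj_on (restrict x Q) Q" using x(2) by (simp add: inj_on_def)
      moreover have "x a \<in> Lab (ty a)" using x(1) by blast
      moreover have "x a \<notin> restrict x Q ` Q" using x(2) insert(2) by (auto simp: inj_on_def)
      ultimately show "(restrict x Q, x a) \<in> ?S" by simp
    qed
  qed
  have finI: "finite (?I Q)"
    by (rule finite_subset[OF _ finite_PiE[of Q "\<lambda>t. Lab (ty t)"]]) (use insert Lab in auto)
  have cd: "real (card (Lab (ty a) - y ` Q)) = real (card (Lab (ty a))) - real (?n (ty a))" if y: "y \<in> ?I Q" for y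
  proof -
    have mem: "y u \<in> Lab (ty u)" if "u \<in> Q" for u using y that by auto
    have "y ` Q \<inter> Lab (ty a) = y ` {u \<in> Q. ty u = ty a}"
    proof (rule Set.set_eqI, rule iffI)
      fix l assume "l \<in> y ` Q \<inter> Lab (ty a)"
      then obtain u where u: "u \<in> Q" "l = y u" "y u \<in> Lab (ty a)" by auto
      then have "ty u = ty a" using Labne[of "ty u" "ty a"] mem[of u] by blast
      then show "l \<in> y ` {u \<in> Q. ty u = ty a}" using u by blast
    next
      fix l assume "l \<in> y ` {u \<in> Q. ty u = ty a}"
      then obtain u where "u \<in> Q" "ty u = ty a" "l = y u" by auto
      then show "l \<in> y ` Q \<inter> Lab (ty a)" using mem[of u] by auto
    qed
    moreover have "card (y ` {u \<in> Q. ty u = ty a}) = ?n (ty a)"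
      using y by (intro card_image) (auto intro: inj_on_subset)
    ultimately have c: "card (y ` Q \<inter> Lab (ty a)) = ?n (ty a)" by simp
    have "card (Lab (ty a) - y ` Q) = card (Lab (ty a)) - card (y ` Q \<inter> Lab (ty a))"
      using card_Diff_subset_Int[of "Lab (ty a)" "y ` Q"] Lab(1) by (simp add: Int_commute)
    moreover have "card (y ` Q \<inter> Lab (ty a)) \<le> card (Lab (ty a))"
      using Lab(1) by (intro card_mono) auto
    ultimately show ?thesis using c by (simp add: of_nat_diff)
  qed
  have "real (card (?I (insert a Q))) = real (card ?S)"
    using bij_betw_same_card[OF bij] by simp
  also have "\<dots> = (\<Sum>y\<in>?I Q. real (card (Lab (ty a) - y ` Q)))"
    using card_SigmaI[of "?I Q" "\<lambda>y. Lab (ty a) - y ` Q"] finI Lab(1) by simp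
  also have "\<dots> = real (card (?I Q)) * (real (card (Lab (ty a))) - real (?n (ty a)))"
    using cd by simp
  also have "\<dots> = (\<Prod>\<tau>\<in>UNIV. \<Prod>i<?n \<tau>. real (card (Lab \<tau>)) - real i) * (real (card (Lab (ty a))) - real (?n (ty a)))"
    using insert.IH by simp
  also have "\<dots> = (\<Prod>\<tau>\<in>UNIV. \<Prod>i<card {u \<in> insert a Q. ty u = \<tau>}. real (card (Lab \<tau>)) - real i)"
  proof -
    have n: "card {u \<in> insert a Q. ty u = \<tau>} = (if \<tau> = ty a then Suc (?n \<tau>) else ?n \<tau>)" for \<tau>
    proof -
      have "{u \<in> insert a Q. ty u = \<tau>} = (if \<tau> = ty a then insert a {u \<in> Q. ty u = \<tau>} else {u \<in> Q. ty u = \<tau>})"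
        by auto
      then show ?thesis using insert(1,2) by simp
    qed
    have rem: "(\<Prod>\<tau>\<in>UNIV. f \<tau>) = f (ty a) * (\<Prod>\<tau>\<in>UNIV - {ty a}. f \<tau>)" for f :: "bool \<Rightarrow> real"
      by (rule prod.remove) auto
    have "(\<Prod>\<tau>\<in>UNIV - {ty a}. \<Prod>i<?n \<tau>. real (card (Lab \<tau>)) - real i)
        = (\<Prod>\<tau>\<in>UNIV - {ty a}. \<Prod>i<card {u \<in> insert a Q. ty u = \<tau>}. real (card (Lab \<tau>)) - real i)"
    proof (rule prod.cong[OF refl])
      fix \<tau> assume "\<tau> \<in> UNIV - {ty a}"
      then have "card {u \<in> insert a Q. ty u = \<tau>} = ?n \<tau>" unfolding n by simp
      then show "(\<Prod>i<?n \<tau>. real (card (Lab \<tau>)) - real i)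
          = (\<Prod>i<card {u \<in> insert a Q. ty u = \<tau>}. real (card (Lab \<tau>)) - real i)"
        by (simp only:)
    qed
    then show ?thesis unfolding rem[of "\<lambda>\<tau>. \<Prod>i<?n \<tau>. real (card (Lab \<tau>)) - real i"]
        rem[of "\<lambda>\<tau>. \<Prod>i<card {u \<in> insert a Q. ty u = \<tau>}. real (card (Lab \<tau>)) - real i"]
      unfolding n[of "ty a"] by simp
  qed
  finally show ?case .
qed

section \<open>Pairs of walks around a common cycle\<close>

text \<open>The surviving leafless pairs: simple cycles with the same edges, possibly with different
  starting points or directions. A cycle of length two is one edge traversed back and forth.\<close>

definition core where
  "core s P1 P2 x \<longleftrightarrow> inj_on x P1 \<and> inj_on x P2 \<and> edge s x ` P1 = edge s x ` P2"

lemma Union_edges: "single_cycle s Q \<Longrightarrow> \<Union> (edge s x ` Q) = x ` Q"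
  using single_cycle_in[of s Q] by (auto simp: edge_def)

locale labelled_cycles = two_cycles_loc s P1 P2 ty
  for s :: "'a \<Rightarrow> 'a" and P1 P2 ty +
  fixes Lab :: "bool \<Rightarrow> 'v set" and \<mu> :: "nat \<Rightarrow> real"
  assumes fin_Lab: "\<And>\<tau>. finite (Lab \<tau>)" and dis_Lab: "Lab True \<inter> Lab False = {}"
    and mu1: "\<mu> 1 = 0" and mu2: "\<mu> 2 = 1"
begin

lemma swap: "labelled_cycles s P2 P1 ty Lab \<mu>"
  using two two_cycles_commute[of s P1 P2 ty] fin_Lab dis_Lab mu1 mu2 by unfold_locales auto

lemma Lab_eq: "l \<in> Lab \<sigma> \<Longrightarrow> l \<in> Lab \<tau> \<Longrightarrow> \<sigma> = \<tau>"
  using dis_Lab by (cases \<sigma>; cases \<tau>) auto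

text \<open>Without leaves every vertex is visited at least twice, so the assumed number of vertices
  forces exactly two visits.\<close>

lemma fibre_unique:
  assumes x: "x \<in> labellings Lab s P ty P bc" and le: "card P \<le> 2 * (bc True + bc False)"
    and uvw: "u \<in> P" "v \<in> P" "w \<in> P" "x v = x u" "x w = x u"
  shows "v = u \<or> w = u \<or> v = w"
proof -
  let ?F = "\<lambda>l. {u \<in> P. x u = l}"
  have finP: "finite P" using fin by simp
  have xP: "x ` P \<subseteq> Lab True \<union> Lab False"
  proof (rule image_subsetI)
    fix u assume "u \<in> P"
    then have "x u \<in> Lab (ty u)" using x by (auto simp: labellings_def)
    then show "x u \<in> Lab True \<union> Lab False" by (cases "ty u") auto
  qed
  have "card (x ` P) = card (x ` P \<inter> Lab True \<union> x ` P \<inter> Lab False)"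
    by (rule arg_cong[where f=card]) (use xP in blast)
  also have "\<dots> = bc True + bc False"
    using x finP dis_Lab by (subst card_Un_disjoint) (auto simp: labellings_def)
  finally have c: "card (x ` P) = bc True + bc False" .
  have ge2: "card (?F l) \<ge> 2" if l: "l \<in> x ` P" for l
  proof -
    obtain u where u: "u \<in> P" "x u = l" using l by auto
    obtain t where t: "t \<in> P" "s t = u" using s_surj[OF u(1)] by blast
    have "\<not> leaf s P x t" using x t(1) by (auto simp: labellings_def)
    then obtain v where v: "v \<in> P" "x v = l" "v \<noteq> u" using t u by (auto simp: leaf_def)
    have "card {u, v} \<le> card (?F l)" by (rule card_mono) (use finP u v in auto)
    then show ?thesis using v by auto
  qed
  have "card P = (\<Sum>l\<in>x ` P. card (?F l))"
    using sum.image_gen[OF finP, of "\<lambda>_. 1 :: nat" x] by simp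
  then have "(\<Sum>l\<in>x ` P. card (?F l)) \<le> (\<Sum>l\<in>x ` P. 2)" using le c by simp
  have two: "card (?F l) = 2" if "l \<in> x ` P" for l
  proof (rule ccontr)
    assume "card (?F l) \<noteq> 2"
    then have "2 < card (?F l)" using ge2[OF that] by simp
    then have "(\<Sum>l\<in>x ` P. 2) < (\<Sum>l\<in>x ` P. card (?F l))"
      by (intro sum_strict_mono_ex1) (use ge2 finP that in auto)
    with \<open>(\<Sum>l\<in>x ` P. card (?F l)) \<le> (\<Sum>l\<in>x ` P. 2)\<close> show False by simp
  qed
  show ?thesis
  proof (rule ccontr)
    assume "\<not> ?thesis"
    then have "card {u, v, w} = 3" by auto
    moreover have "card {u, v, w} \<le> card (?F (x u))" by (rule card_mono) (use finP uvw in auto)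
    ultimately show False using two[of "x u"] uvw by simp
  qed
qed

text \<open>A shared edge forces the next edge of the walk to be shared as well.\<close>

lemma shared_edges:
  assumes x: "x \<in> labellings Lab s P ty P bc" and le: "card P \<le> 2 * (bc True + bc False)"
    and nz: "cov_weight \<mu> s P1 P2 x \<noteq> 0" and u: "u \<in> P1"
  shows "\<exists>v\<in>P2. edge s x v = edge s x u"
proof -
  obtain t1 t2 where t: "t1 \<in> P1" "t2 \<in> P2" "edge s x t1 = edge s x t2"
    using cov_weight_nonzeroD(1)[of \<mu> P1 P2 s x] mu1 fin nz by blast
  show ?thesis
  proof (rule single_cycle_induct[OF cyc(1) t(1), of "\<lambda>u. \<exists>v\<in>P2. edge s x v = edge s x u", OF _ _ u])
    show "\<exists>v\<in>P2. edge s x v = edge s x t1" using t by auto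
  next
    fix u assume u: "u \<in> P1" and "\<exists>v\<in>P2. edge s x v = edge s x u"
    then obtain v where v: "v \<in> P2" "edge s x v = edge s x u" by blast
    have "x (s u) \<in> edge s x v" unfolding v(2) by (simp add: edge_def)
    then obtain v' where v': "v' \<in> P2" "x v' = x (s u)"
      using v(1) s_in(2)[of v] by (auto simp: edge_def)
    have suP: "s u \<in> P1" using u s_in(1) by blast
    obtain w where w: "w \<in> P" "w \<noteq> s u" "edge s x w = edge s x (s u)"
      using cov_weight_nonzeroD(2)[of \<mu> P1 P2 s x "s u"] mu1 fin nz suP by blast
    show "\<exists>v\<in>P2. edge s x v = edge s x (s u)"
    proof (cases "w \<in> P2")
      case True then show ?thesis using w by blast
    next
      \<comment> \<open>Each walk visits the vertex at \<open>s u\<close>, hence the first does so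
        only once. Another traversal of the next edge within the first walk can then only be the
        step from \<open>u\<close>, whose edge is already shared.\<close>
      case False
      then have wP: "w \<in> P1" using w by blast
      have uniq: "q = s u" if "q \<in> P1" "x q = x (s u)" for q
        using fibre_unique[OF x le, of "s u" q v'] that v' suP dis by auto
      have "x (s u) \<in> edge s x w" unfolding w(3) by (simp add: edge_def)
      then have "x (s w) = x (s u)" using uniq[OF wP] w(2) by (auto simp: edge_def)
      then have "s w = s u" using uniq[of "s w"] wP s_in(1) by blast
      then have "w = u" using s_inj[of w u] wP u by blast
      then show ?thesis using w(3) v by auto
    qed
  qed
qed

text \<open>Both walks visit the same vertices and no vertex has three visits, so each walk visits
  each of them once.\<close>

lemma core_if_nonzero:
  assumes x: "x \<in> labellings Lab s P ty P bc" and le: "card P \<le> 2 * (bc True + bc False)"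
    and nz: "cov_weight \<mu> s P1 P2 x \<noteq> 0"
  shows "core s P1 P2 x"
proof -
  interpret sw: labelled_cycles s P2 P1 ty Lab \<mu> by (rule swap)
  have sh: "\<exists>v\<in>P2. edge s x v = edge s x u" if "u \<in> P1" for u
    by (rule shared_edges[OF x le nz that])
  have sh': "\<exists>u\<in>P1. edge s x u = edge s x v" if "v \<in> P2" for v
    by (rule sw.shared_edges[OF _ _ _ that]) (use x le nz cov_weight_commute[of \<mu> s P1 P2 x] in \<open>simp_all add: Un_commute\<close>)
  have "edge s x ` P1 \<subseteq> edge s x ` P2" using sh by (metis image_eqI image_subsetI)
  moreover have "edge s x ` P2 \<subseteq> edge s x ` P1" using sh' by (metis image_eqI image_subsetI)
  ultimately have eq: "edge s x ` P1 = edge s x ` P2" by blast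
  then have img: "x ` P1 = x ` P2" using Union_edges cyc by metis
  have "inj_on x P1"
  proof (rule inj_onI)
    fix u w assume u: "u \<in> P1" "w \<in> P1" "x u = x w"
    then obtain v where v: "v \<in> P2" "x v = x u" using img by (metis imageE imageI)
    then show "u = w" using fibre_unique[OF x le, of u w v] u dis by auto
  qed
  moreover have "inj_on x P2"
  proof (rule inj_onI)
    fix u w assume u: "u \<in> P2" "w \<in> P2" "x u = x w"
    then obtain v where v: "v \<in> P1" "x v = x u" using img by (metis imageE imageI)
    then show "u = w" using fibre_unique[OF x le, of u w v] u dis by auto
  qed
  ultimately show ?thesis using eq by (simp add: core_def)
qed

lemma core_image: "core s P1 P2 x \<Longrightarrow> x ` P1 = x ` P2"
  using Union_edges cyc by (metis core_def)

lemma core_card: "core s P1 P2 x \<Longrightarrow> card P1 = card P2"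
  using core_image card_image by (metis core_def)

text \<open>No vertex is a leaf because the other walk visits it too, and the label counts can be
  read off from the first walk alone.\<close>

lemma core_labelling:
  assumes x: "x \<in> PiE P (\<lambda>t. Lab (ty t))" and core: "core s P1 P2 x"
  shows "x \<in> labellings Lab s P ty P (\<lambda>\<tau>. card {u \<in> P1. ty u = \<tau>})"
proof -
  note img = core_image[OF core]
  have "\<not> leaf s P x t" if t: "t \<in> P" for t
  proof
    assume l: "leaf s P x t"
    have "\<exists>v\<in>P. v \<noteq> s t \<and> x v = x (s t)"
    proof (cases "t \<in> P1")
      case True
      then have st: "s t \<in> P1" by (rule s_in(1))
      then obtain v where v: "v \<in> P2" "x v = x (s t)" using img by (metis imageE imageI)
      have "v \<noteq> s t" using st v(1) dis by auto
      then show ?thesis using v by (intro bexI[of _ v]) simp_all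
    next
      case False
      then have st: "s t \<in> P2" using t by (intro s_in(2)) simp
      then obtain v where v: "v \<in> P1" "x v = x (s t)" using img by (metis imageE imageI)
      have "v \<noteq> s t" using st v(1) dis by auto
      then show ?thesis using v by (intro bexI[of _ v]) simp_all
    qed
    then show False using l by (auto simp: leaf_def)
  qed
  moreover have "card (x ` P \<inter> Lab \<tau>) = card {u \<in> P1. ty u = \<tau>}" for \<tau>
  proof -
    have xP: "x ` P = x ` P1" using img by (simp add: image_Un)
    have mem: "x u \<in> Lab (ty u)" if "u \<in> P1" for u using x that by auto
    have "x ` P \<inter> Lab \<tau> = x ` {u \<in> P1. ty u = \<tau>}"
    proof (rule Set.set_eqI, rule iffI)
      fix l assume "l \<in> x ` P \<inter> Lab \<tau>"
      then obtain u where u: "u \<in> P1" "l = x u" "x u \<in> Lab \<tau>" unfolding xP by auto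
      then have "ty u = \<tau>" using Lab_eq mem by blast
      then show "l \<in> x ` {u \<in> P1. ty u = \<tau>}" using u by blast
    next
      fix l assume "l \<in> x ` {u \<in> P1. ty u = \<tau>}"
      then obtain u where "u \<in> P1" "ty u = \<tau>" "l = x u" by auto
      then show "l \<in> x ` P \<inter> Lab \<tau>" using mem[of u] by auto
    qed
    moreover have "inj_on x {u \<in> P1. ty u = \<tau>}"
      using core by (auto simp: core_def intro: inj_on_subset)
    ultimately show ?thesis by (simp add: card_image)
  qed
  ultimately show ?thesis using x by (simp add: labellings_def)
qed

text \<open>Along a simple closed walk an edge can recur only in the opposite direction, and this
  closes up a walk of length two.\<close>

lemma inj_edge:
  assumes "single_cycle s Q" "Q \<subseteq> P" "inj_on x Q" "card Q \<noteq> 2"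
  shows "inj_on (edge s x) Q"
proof (rule inj_onI)
  fix u v assume uv: "u \<in> Q" "v \<in> Q" "edge s x u = edge s x v"
  have sQ: "s u \<in> Q" "s v \<in> Q" using uv single_cycle_in[OF assms(1)] by auto
  consider "x u = x v" | "x u = x (s v)" "x (s u) = x v"
    using uv(3) by (auto simp: edge_def doubleton_eq_iff)
  then show "u = v"
  proof cases
    case 1 then show ?thesis using uv assms(3) by (auto dest: inj_onD)
  next
    case 2
    then have e: "u = s v" "s u = v" using uv sQ assms(3) by (auto dest: inj_onD)
    have "{u, v} = Q"
      by (rule single_cycle_minimal[OF assms(1)]) (use uv e in auto)
    moreover have "u \<noteq> v" using e s_ne(1)[of v] uv(2) assms(2) by auto
    ultimately show ?thesis using assms(4) by (metis card_2_iff)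
  qed
qed

text \<open>In length greater than two each edge is traversed once by each walk: the joint moment is
  one and the separate moments vanish. In length two there is a single edge of multiplicity four,
  and \<open>\<mu> 4 - \<mu> 2 ^ 2\<close> remains.\<close>

lemma core_weight:
  assumes core: "core s P1 P2 x"
  shows "cov_weight \<mu> s P1 P2 x = (if card P1 = 2 then \<mu> 4 - 1 else 1)"
proof -
  let ?E = "edge s x"
  have eq: "?E ` P1 = ?E ` P2" and inj: "inj_on x P1" "inj_on x P2" using core by (auto simp: core_def)
  have cP: "card P2 = card P1" using core_card[OF core] by simp
  show ?thesis
  proof (cases "card P1 = 2")
    case True
    have one: "\<exists>e. \<forall>u\<in>Q. ?E u = e" if Q: "single_cycle s Q" "Q \<subseteq> P" "card Q = 2" for Q
    proof -
      obtain u where u: "u \<in> Q" using single_cycle_ne[OF Q(1)] by blast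
      have "s u \<in> Q" "s (s u) \<in> Q" using u single_cycle_in[OF Q(1)] by auto
      moreover have "s u \<noteq> u" "s (s u) \<noteq> s u" using s_ne u Q(2) by blast+
      moreover obtain a b where "Q = {a, b}" using Q(3) by (meson card_2_iff)
      ultimately have "Q = {u, s u}" "s (s u) = u" using u by auto
      then have "\<forall>v\<in>Q. ?E v = ?E u" by (auto simp: edge_def)
      then show ?thesis by blast
    qed
    obtain e where e: "\<forall>u\<in>P1. ?E u = e" using one[OF cyc(1)] True by auto
    obtain e' where e': "\<forall>u\<in>P2. ?E u = e'" using one[OF cyc(2)] True cP by auto
    have ne: "P1 \<noteq> {}" "P2 \<noteq> {}" using single_cycle_ne cyc by auto
    then have "?E ` P1 = {e}" "?E ` P2 = {e'}" using e e' by auto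
    then have e2: "\<forall>u\<in>P. ?E u = e" using eq e e' by auto
    have mm: "multi_moment \<mu> Q ?E = \<mu> (card Q)" if "Q \<subseteq> P" "Q \<noteq> {}" for Q
    proof -
      have "?E ` Q = {e}" using that e2 by auto
      moreover have "{t \<in> Q. ?E t = e} = Q" using that e2 by auto
      ultimately show ?thesis by (simp add: multi_moment_def)
    qed
    have "card P = 4" using card_Un_disjoint[OF fin dis] True cP by simp
    then show ?thesis using mm[of P] mm[of P1] mm[of P2] ne True cP mu2 by (simp add: cov_weight_def)
  next
    case False
    have injE: "inj_on ?E P1" "inj_on ?E P2"
      using inj_edge[OF cyc(1) _ inj(1)] inj_edge[OF cyc(2) _ inj(2)] False cP by auto
    have "card {t \<in> P. ?E t = e} = 2" if "e \<in> ?E ` P" for e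
    proof -
      have "e \<in> ?E ` P1" "e \<in> ?E ` P2" using that eq by auto
      then obtain u v where uv: "u \<in> P1" "?E u = e" "v \<in> P2" "?E v = e" by auto
      have "{t \<in> P. ?E t = e} = {u, v}"
      proof (rule Set.set_eqI, rule iffI)
        fix t assume "t \<in> {t \<in> P. ?E t = e}"
        then have t: "t \<in> P1 \<or> t \<in> P2" "?E t = e" by auto
        from t(1) show "t \<in> {u, v}"
        proof
          assume "t \<in> P1"
          then have "t = u" using inj_onD[OF injE(1), of t u] uv t(2) by simp
          then show ?thesis by simp
        next
          assume "t \<in> P2"
          then have "t = v" using inj_onD[OF injE(2), of t v] uv t(2) by simp
          then show ?thesis by simp
        qed
      qed (use uv in auto)
      moreover have "u \<noteq> v" using uv dis by auto
      ultimately show ?thesis by simp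
    qed
    then have "multi_moment \<mu> P ?E = 1" by (simp add: multi_moment_def mu2)
    moreover have "multi_moment \<mu> P1 ?E = 0"
    proof -
      obtain u where "u \<in> P1" using single_cycle_ne[OF cyc(1)] by blast
      then show ?thesis
        using mu1 fin inj_onD[OF injE(1), of _ u] by (intro multi_moment_single_zero[of _ _ u]) simp_all
    qed
    ultimately show ?thesis using False by (simp add: cov_weight_def)
  qed
qed

section \<open>Identifications of the two cycles\<close>

text \<open>How the second walk runs along the first: position \<open>v\<close> repeats the label of
  position \<open>h v\<close>. The alternatives are the same and the opposite direction, the latter
  written without the inverse of \<open>s\<close>.\<close>

definition dihedral_maps :: "('a \<Rightarrow> 'a) set" where
  "dihedral_maps = {h \<in> PiE P2 (\<lambda>v. {u \<in> P1. ty u = ty v}).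
     (\<forall>v\<in>P2. h (s v) = s (h v)) \<or> (\<forall>v\<in>P2. s (h (s v)) = h v)}"

lemma short_iff:
  assumes "Q = P1 \<or> Q = P2" "u \<in> Q"
  shows "s (s u) = u \<longleftrightarrow> card Q = 2"
proof
  have Q: "single_cycle s Q" "Q \<subseteq> P" using assms cyc by auto
  have in2: "s u \<in> Q" "s (s u) \<in> Q" using assms single_cycle_in[OF Q(1)] by auto
  have ne: "s u \<noteq> u" "s (s u) \<noteq> s u" using s_ne assms Q(2) by blast+
  {
    assume "s (s u) = u"
    then have "{u, s u} = Q"
      by (intro single_cycle_minimal[OF Q(1)]) (use assms in2 in auto)
    then show "card Q = 2" using ne by (metis card_2_iff)
  next
    assume "card Q = 2"
    then obtain a b where "Q = {a, b}" by (meson card_2_iff)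
    then show "s (s u) = u" using assms(2) in2 ne by auto
  }
qed

text \<open>Each direction admits one map for every position of the type of a base point, that is,
  half of \<open>card P1\<close>. In length two the directions coincide.\<close>

lemma card_dihedral_maps:
  assumes card: "card P1 = card P2"
  shows "card dihedral_maps = (if card P1 = 2 then 1 else card P1)"
proof -
  let ?H = "\<lambda>f. {h \<in> PiE P2 (\<lambda>v. {u \<in> P1. ty u = ty v}). \<forall>v\<in>P2. h (s v) = f (h v)}"
  let ?i = "inv_into P1 s"
  obtain a where a: "a \<in> P2" using single_cycle_ne[OF cyc(2)] by blast
  have R: "card P1 = 2 * card {u \<in> P1. ty u = \<tau>}" for \<tau>
    by (rule single_cycle_card_type[OF cyc(1)]) (simp add: ty_s)
  have i: "s (?i u) = u" "?i u \<in> P1" if "u \<in> P1" for u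
    using that single_cycle_surj[OF cyc(1)] by (metis f_inv_into_f, metis inv_into_into)
  have i': "?i (s u) = u" if "u \<in> P1" for u
    using single_cycle_inj[OF cyc(1)] that by (rule inv_into_f_f)
  have tyi: "ty (?i u) = (\<not> ty u)" if "u \<in> P1" for u
    using i[OF that] ty_s[of "?i u"] by auto
  have c1: "card (?H s) = card {u \<in> P1. ty u = ty a}"
    by (rule card_equivariant[OF cyc(2) cyc(1) card[symmetric] _ _ a]) (simp_all add: ty_s)
  have c2: "card (?H ?i) = card {u \<in> P1. ty u = ty a}"
    by (rule card_equivariant[OF cyc(2) single_cycle_inv[OF cyc(1)] card[symmetric] _ _ a])
      (simp_all add: ty_s tyi)
  have mem: "h v \<in> P1" if "h \<in> PiE P2 (\<lambda>v. {u \<in> P1. ty u = ty v})" "v \<in> P2" for h v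
    using PiE_mem[OF that] by simp
  have anti: "(\<forall>v\<in>P2. s (h (s v)) = h v) \<longleftrightarrow> (\<forall>v\<in>P2. h (s v) = ?i (h v))"
    if "h \<in> PiE P2 (\<lambda>v. {u \<in> P1. ty u = ty v})" for h
  proof (rule ball_cong[OF refl])
    fix v assume v: "v \<in> P2"
    have "h v \<in> P1" "h (s v) \<in> P1" using mem[OF that] v s_in(2) by auto
    then show "s (h (s v)) = h v \<longleftrightarrow> h (s v) = ?i (h v)" using i i' by metis
  qed
  have un: "dihedral_maps = ?H s \<union> ?H ?i"
    unfolding dihedral_maps_def using anti by blast
  have finH: "finite (?H f)" for f
    by (rule finite_subset[OF _ finite_PiE[of P2 "\<lambda>v. {u \<in> P1. ty u = ty v}"]]) (use fin in auto)
  show ?thesis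
  proof (cases "card P1 = 2")
    case True
    have "?i u = s u" if "u \<in> P1" for u
      using short_iff[of P1 u] True that i'[of "s u"] s_in(1) by metis
    then have "?H ?i = ?H s" using mem by (metis (no_types, lifting))
    then show ?thesis using un c1 R[of "ty a"] True by simp
  next
    case False
    have "?H s \<inter> ?H ?i = {}"
    proof (rule ccontr)
      assume "\<not> ?thesis"
      then obtain h where h: "h \<in> PiE P2 (\<lambda>v. {u \<in> P1. ty u = ty v})"
        "h (s a) = s (h a)" "h (s a) = ?i (h a)" using a by blast
      have "h a \<in> P1" by (rule mem[OF h(1) a])
      then have "s (s (h a)) = h a" using h i by metis
      then show False using short_iff[of P1 "h a"] \<open>h a \<in> P1\<close> False by simp
    qed
    then have "card dihedral_maps = card (?H s) + card (?H ?i)"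
      unfolding un by (intro card_Un_disjoint finH)
    then show ?thesis using c1 c2 R[of "ty a"] False by simp
  qed
qed

text \<open>In either direction the image is closed under \<open>s\<close>. With equal cardinalities
  this makes \<open>h\<close> a bijection.\<close>

lemma dihedral_onto:
  assumes h: "h \<in> dihedral_maps"
  shows "h ` P2 = P1"
proof (rule single_cycle_minimal[OF cyc(1)])
  have hm: "h v \<in> P1" if "v \<in> P2" for v
    using h that unfolding dihedral_maps_def by auto
  show "h ` P2 \<subseteq> P1" using hm by blast
  show "h ` P2 \<noteq> {}" using single_cycle_ne[OF cyc(2)] by blast
  show "s ` h ` P2 \<subseteq> h ` P2"
  proof (clarify)
    fix v assume v: "v \<in> P2"
    consider "\<forall>v\<in>P2. h (s v) = s (h v)" | "\<forall>v\<in>P2. s (h (s v)) = h v"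
      using h unfolding dihedral_maps_def by blast
    then show "s (h v) \<in> h ` P2"
    proof cases
      case 1 then show ?thesis using v s_in(2) by (metis imageI)
    next
      case 2
      obtain w where "w \<in> P2" "s w = v" using single_cycle_surj[OF cyc(2)] v by (metis imageE)
      then show ?thesis using 2 by (metis imageI)
    qed
  qed
qed

lemma core_extend:
  assumes y: "inj_on x P1" and h: "h \<in> dihedral_maps" and x: "\<And>v. v \<in> P2 \<Longrightarrow> x v = x (h v)"
    and card: "card P1 = card P2"
  shows "core s P1 P2 x"
proof -
  note onto = dihedral_onto[OF h]
  have hm: "h v \<in> P1" if "v \<in> P2" for v using onto that by blast
  have "inj_on h P2" using onto card fin by (simp add: eq_card_imp_inj_on)
  then have "inj_on x P2" using y hm x by (metis (no_types, lifting) inj_on_def)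
  moreover have "edge s x ` P2 = edge s x ` P1"
  proof -
    consider "\<forall>v\<in>P2. h (s v) = s (h v)" | "\<forall>v\<in>P2. s (h (s v)) = h v"
      using h unfolding dihedral_maps_def by blast
    then show ?thesis
    proof cases
      case 1
      have "edge s x v = edge s x (h v)" if "v \<in> P2" for v
        using that 1 x s_in(2) by (simp add: edge_def)
      then have "edge s x ` P2 = edge s x ` h ` P2" by (simp add: image_image)
      then show ?thesis using onto by simp
    next
      case 2
      have "edge s x v = edge s x (h (s v))" if "v \<in> P2" for v
        using that 2 x[of v] x[of "s v"] s_in(2)[of v] by (auto simp: edge_def)
      then have "edge s x ` P2 = edge s x ` h ` s ` P2" by (simp add: image_image)
      then show ?thesis using onto single_cycle_surj[OF cyc(2)] by simp
    qed
  qed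
  ultimately show ?thesis using y by (simp add: core_def)
qed

text \<open>Each step of the second walk matches a step of the first, forwards or backwards. The
  direction cannot change on the way, except in length two, where both directions agree.\<close>

lemma core_dihedral:
  assumes x: "x \<in> PiE P (\<lambda>t. Lab (ty t))" and core: "core s P1 P2 x"
  shows "restrict (\<lambda>v. inv_into P1 x (x v)) P2 \<in> dihedral_maps" (is "?h \<in> _")
proof -
  note img = core_image[OF core] and card = core_card[OF core]
  have inj: "inj_on x P1" "inj_on x P2" using core by (auto simp: core_def)
  define h where "h = restrict (\<lambda>v. inv_into P1 x (x v)) P2"
  have hP: "h v \<in> P1" "x (h v) = x v" if "v \<in> P2" for v
  proof -
    have "x v \<in> x ` P1" using img that by auto
    then show "h v \<in> P1" "x (h v) = x v" using that by (simp_all add: h_def inv_into_into f_inv_into_f)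
  qed
  have hu: "h v = u" if "v \<in> P2" "u \<in> P1" "x v = x u" for u v
    using inj_onD[OF inj(1), of "h v" u] hP[of v] that by simp
  have hinj: "v = w" if "v \<in> P2" "w \<in> P2" "h v = h w" for v w
    using hP[of v] hP[of w] that inj_onD[OF inj(2), of v w] by simp
  have hty: "ty (h v) = ty v" if "v \<in> P2" for v
  proof -
    have "x (h v) \<in> Lab (ty (h v))" by (rule PiE_mem[OF x]) (use hP(1)[OF that] in simp)
    moreover have "x v \<in> Lab (ty v)" by (rule PiE_mem[OF x]) (use that in simp)
    ultimately show ?thesis using hP(2)[OF that] Lab_eq by metis
  qed
  have alt: "h (s v) = s (h v) \<or> s (h (s v)) = h v" if v: "v \<in> P2" for v
  proof -
    obtain u where u: "u \<in> P1" "edge s x v = edge s x u"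
      using core v unfolding core_def by (metis imageE imageI)
    have sv: "s v \<in> P2" "s u \<in> P1" using v u s_in(1,2) by auto
    consider "x v = x u" "x (s v) = x (s u)" | "x v = x (s u)" "x (s v) = x u"
      using u(2) by (auto simp: edge_def doubleton_eq_iff)
    then show ?thesis
    proof cases
      case 1 then show ?thesis using hu[OF v u(1)] hu[OF sv] by simp
    next
      case 2 then show ?thesis using hu[OF v sv(2)] hu[OF sv(1) u(1)] by simp
    qed
  qed
  have "(\<forall>v\<in>P2. h (s v) = s (h v)) \<or> (\<forall>v\<in>P2. s (h (s v)) = h v)"
  proof (cases "\<exists>v\<in>P2. h (s v) = s (h v)")
    case False
    then show ?thesis using alt by blast
  next
    case True
    then obtain a where a: "a \<in> P2" "h (s a) = s (h a)" by blast
    \<comment> \<open>A change of direction makes \<open>h\<close> repeat a value after two steps;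
      injectivity then forces length two.\<close>
    have "h (s v) = s (h v)" if "v \<in> P2" for v
    proof (rule single_cycle_induct[OF cyc(2) a(1), of "\<lambda>v. h (s v) = s (h v)", OF a(2) _ that])
      fix v assume v: "v \<in> P2" and e: "h (s v) = s (h v)"
      have sv: "s v \<in> P2" "s (s v) \<in> P2" using v s_in(2) by auto
      show "h (s (s v)) = s (h (s v))"
      proof (rule ccontr)
        assume ne: "\<not> ?thesis"
        then have "s (h (s (s v))) = s (h v)" using alt[OF sv(1)] e by simp
        then have "h (s (s v)) = h v" using s_inj hP(1) v sv by blast
        then have "s (s v) = v" using hinj v sv by blast
        moreover have "s (s (h v)) = h v"
          using calculation short_iff[of P2 v] short_iff[of P1 "h v"] v hP(1)[OF v] card by simp
        ultimately show False using ne e by simp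
      qed
    qed
    then show ?thesis by blast
  qed
  moreover have "h \<in> PiE P2 (\<lambda>v. {u \<in> P1. ty u = ty v})"
    using hP(1) hty by (intro PiE_I) (auto simp: h_def)
  ultimately have "h \<in> dihedral_maps" unfolding dihedral_maps_def by blast
  then show ?thesis unfolding h_def .
qed

text \<open>A core is an injective labelling of the first walk together with the identification
  along which the second follows it; the latter is recovered as
  \<open>inv_into P1 x (x v)\<close>.\<close>

lemma card_cores:
  assumes card: "card P1 = card P2"
  shows "card {x \<in> PiE P (\<lambda>t. Lab (ty t)). core s P1 P2 x}
    = card {y \<in> PiE P1 (\<lambda>t. Lab (ty t)). inj_on y P1} * card dihedral_maps"
    (is "card ?C = card ?I * _")
proof -
  let ?f = "\<lambda>(y, h). (\<lambda>u. if u \<in> P2 then y (h u) else y u)"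
  let ?g = "\<lambda>x. (restrict x P1, restrict (\<lambda>v. inv_into P1 x (x v)) P2)"
  have hm: "h v \<in> P1" "ty (h v) = ty v" if "h \<in> dihedral_maps" "v \<in> P2" for h v
    using that unfolding dihedral_maps_def by auto
  have "bij_betw ?f (?I \<times> dihedral_maps) ?C"
  proof (rule bij_betw_byWitness[where f'="?g"])
    show "\<forall>z\<in>?I \<times> dihedral_maps. ?g (?f z) = z"
    proof
      fix z assume "z \<in> ?I \<times> dihedral_maps"
      then obtain y h where z: "z = (y, h)" and y: "y \<in> PiE P1 (\<lambda>t. Lab (ty t))" "inj_on y P1"
        and h: "h \<in> dihedral_maps" by auto
      define x where "x = (\<lambda>u. if u \<in> P2 then y (h u) else y u)"
      have fx: "?f (y, h) = x" by (simp add: x_def)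
      have x1: "x u = y u" if "u \<in> P1" for u using that dis by (auto simp: x_def)
      have x2: "x v = x (h v)" if "v \<in> P2" for v
        using x1[OF hm(1)[OF h that]] that by (simp add: x_def)
      have inj: "inj_on x P1" using y(2) x1 by (simp cong: inj_on_cong)
      have "restrict x P1 = y"
        using x1 PiE_arb[OF y(1)] by (intro HOL.ext) (simp add: restrict_def)
      moreover have "restrict (\<lambda>v. inv_into P1 x (x v)) P2 = h"
      proof
        fix v
        show "restrict (\<lambda>v. inv_into P1 x (x v)) P2 v = h v"
        proof (cases "v \<in> P2")
          case True
          then show ?thesis using inv_into_f_f[OF inj hm(1)[OF h True]] x2[OF True] by simp
        next
          case False
          have "h v = undefined"
            by (rule PiE_arb[of h P2 "\<lambda>v. {u \<in> P1. ty u = ty v}", OF _ False])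
              (use h in \<open>simp add: dihedral_maps_def\<close>)
          then show ?thesis using False by simp
        qed
      qed
      ultimately show "?g (?f z) = z" unfolding z fx by simp
    qed
    show "\<forall>x\<in>?C. ?f (?g x) = x"
    proof
      fix x assume "x \<in> ?C"
      then have x: "x \<in> PiE P (\<lambda>t. Lab (ty t))" "core s P1 P2 x" by auto
      have h: "inv_into P1 x (x v) \<in> P1" "x (inv_into P1 x (x v)) = x v" if "v \<in> P2" for v
      proof -
        have "x v \<in> x ` P1" using core_image[OF x(2)] that by auto
        then show "inv_into P1 x (x v) \<in> P1" "x (inv_into P1 x (x v)) = x v"
          by (simp_all add: inv_into_into f_inv_into_f)
      qed
      show "?f (?g x) = x"
      proof
        fix u
        show "?f (?g x) u = x u"
          using h[of u] PiE_arb[OF x(1), of u] by (cases "u \<in> P2"; cases "u \<in> P1") auto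
      qed
    qed
    show "?f ` (?I \<times> dihedral_maps) \<subseteq> ?C"
    proof (rule image_subsetI)
      fix z assume "z \<in> ?I \<times> dihedral_maps"
      then obtain y h where z: "z = (y, h)" and y: "y \<in> PiE P1 (\<lambda>t. Lab (ty t))" "inj_on y P1"
        and h: "h \<in> dihedral_maps" by auto
      let ?x = "\<lambda>u. if u \<in> P2 then y (h u) else y u"
      have x1: "?x u = y u" if "u \<in> P1" for u using that dis by auto
      have "?x \<in> PiE P (\<lambda>t. Lab (ty t))"
      proof (rule PiE_I)
        fix u assume "u \<in> P"
        then show "?x u \<in> Lab (ty u)"
          using PiE_mem[OF y(1), of "h u"] PiE_mem[OF y(1), of u] hm[OF h, of u] by auto
      next
        fix u assume "u \<notin> P" then show "?x u = undefined" using PiE_arb[OF y(1)] by simp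
      qed
      moreover have "core s P1 P2 ?x"
      proof (rule core_extend[OF _ h _ card])
        show "inj_on ?x P1" using y(2) x1 by (simp cong: inj_on_cong)
        show "?x v = ?x (h v)" if "v \<in> P2" for v
          using x1[OF hm(1)[OF h that]] that by simp
      qed
      ultimately show "?f z \<in> ?C" using z by simp
    qed
    show "?g ` ?C \<subseteq> ?I \<times> dihedral_maps"
    proof (rule image_subsetI)
      fix x assume "x \<in> ?C"
      then have x: "x \<in> PiE P (\<lambda>t. Lab (ty t))" "core s P1 P2 x" by auto
      have "restrict x P1 \<in> PiE P1 (\<lambda>t. Lab (ty t))" using x(1) by auto
      moreover have "inj_on (restrict x P1) P1" using x(2) by (simp add: core_def inj_on_def)
      ultimately show "?g x \<in> ?I \<times> dihedral_maps" using core_dihedral[OF x] by simp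
    qed
  qed
  from bij_betw_same_card[OF this] show ?thesis by (simp only: card_cartesian_product)
qed

end

text \<open>The end of the recursion. \<open>R\<close> must be large enough for the sum in
  \<open>leading_count\<close> to reach the half length \<open>r\<close>.\<close>

lemma (in labelled_cycles) cov_sum_core:
  assumes le: "card P \<le> 2 * (bc True + bc False)" and R: "card P \<le> 2 * R"
  shows "cov_sum \<mu> Lab s P1 P2 ty P bc = leading_count \<mu> Lab s P1 P2 ty P bc R"
proof -
  let ?C = "{x \<in> PiE P (\<lambda>t. Lab (ty t)). core s P1 P2 x}"
  let ?c = "\<lambda>r. 2 * real r + (if r = 1 then \<mu> 4 - 3 else 0)"
  let ?X = "labellings Lab s P ty P bc"
  define n where "n \<tau> = card {u \<in> P1. ty u = \<tau>}" for \<tau>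
  have n: "card P1 = 2 * n \<tau>" for \<tau>
    unfolding n_def by (rule single_cycle_card_type[OF cyc(1)]) (simp add: ty_s)
  define r where "r = n True"
  have nr: "n \<tau> = r" for \<tau> using n[of \<tau>] n[of True] by (simp add: r_def)
  have r: "card P1 = 2 * r" using n r_def by simp
  have r1: "r \<ge> 1"
  proof -
    have "card P1 \<noteq> 0" using single_cycle_ne[OF cyc(1)] fin by simp
    then show ?thesis using r by simp
  qed
  have rR: "r \<le> R" using r R card_Un_disjoint[OF fin dis] by simp
  have finP: "finite P" using fin by simp
  note finX = finite_labellings[OF finP fin_Lab]
  have lead: "leading_count \<mu> Lab s P1 P2 ty P bc R =
     (if card P2 = 2 * r \<and> (\<forall>\<tau>. bc \<tau> = r)
      then (\<Prod>\<tau>\<in>UNIV. \<Prod>i<r. real (card (Lab \<tau>)) - real i) * ?c r else 0)"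
  proof -
    have "(\<Sum>r'=1..R. ?c r' * real (card (closing_sets s P1 P2 ty P bc r')))
       = (\<Sum>r'=1..R. if r' = r then (if card P2 = 2 * r \<and> (\<forall>\<tau>. bc \<tau> = r) then ?c r else 0) else 0)"
    proof (rule sum.cong[OF refl])
      fix r' assume "r' \<in> {1..R}"
      then have "r' \<ge> 1" by simp
      show "?c r' * real (card (closing_sets s P1 P2 ty P bc r'))
        = (if r' = r then (if card P2 = 2 * r \<and> (\<forall>\<tau>. bc \<tau> = r) then ?c r else 0) else 0)"
        unfolding closing_sets_core[OF \<open>r' \<ge> 1\<close>] using r by simp
    qed
    also have "\<dots> = (if card P2 = 2 * r \<and> (\<forall>\<tau>. bc \<tau> = r) then ?c r else 0)"
      using r1 rR by (subst sum.delta) simp_all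
    finally show ?thesis by (simp add: leading_count_def)
  qed
  show ?thesis
  proof (cases "card P2 = 2 * r \<and> (\<forall>\<tau>. bc \<tau> = r)")
    case True
    then have bc: "bc = (\<lambda>\<tau>. card {u \<in> P1. ty u = \<tau>})" using nr by (auto simp: n_def)
    have card: "card P1 = card P2" using True r by simp
    have "?C \<subseteq> ?X" using core_labelling unfolding bc by blast
    moreover have "\<forall>x\<in>?X - ?C. cov_weight \<mu> s P1 P2 x = 0"
      using core_if_nonzero[OF _ le] by (auto simp: labellings_def)
    ultimately have "cov_sum \<mu> Lab s P1 P2 ty P bc = (\<Sum>x\<in>?C. cov_weight \<mu> s P1 P2 x)"
      unfolding cov_sum_def by (intro sum.mono_neutral_right finX)
    also have "\<dots> = (\<Sum>x\<in>?C. if card P1 = 2 then \<mu> 4 - 1 else 1)"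
      by (rule sum.cong) (auto simp: core_weight)
    also have "\<dots> = real (card ?C) * (if card P1 = 2 then \<mu> 4 - 1 else 1)" by simp
    also have "real (card ?C) = (\<Prod>\<tau>\<in>UNIV. \<Prod>i<r. real (card (Lab \<tau>)) - real i) * real (card dihedral_maps)"
      using card_cores[OF card] card_inj_labellings[OF fin(1) fin_Lab dis_Lab, of ty] nr
      by (simp add: n_def)
    \<comment> \<open>Identifications times weight: \<open>2 * r\<close> for \<open>r > 1\<close>,
      and \<open>\<mu> 4 - 1 = 2 + (\<mu> 4 - 3)\<close> for \<open>r = 1\<close>.\<close>
    also have "\<dots> * (if card P1 = 2 then \<mu> 4 - 1 else 1) =
       (\<Prod>\<tau>\<in>UNIV. \<Prod>i<r. real (card (Lab \<tau>)) - real i) * ?c r"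
      unfolding card_dihedral_maps[OF card] r by simp
    finally show ?thesis unfolding lead if_P[OF True] .
  next
    case False
    have "cov_weight \<mu> s P1 P2 x = 0" if x: "x \<in> ?X" for x
    proof (rule ccontr)
      assume "cov_weight \<mu> s P1 P2 x \<noteq> 0"
      then have core: "core s P1 P2 x" by (rule core_if_nonzero[OF x le])
      have "x \<in> labellings Lab s P ty P (\<lambda>\<tau>. card {u \<in> P1. ty u = \<tau>})"
        by (rule core_labelling[OF _ core]) (use x in \<open>simp add: labellings_def\<close>)
      then have "bc \<tau> = n \<tau>" for \<tau> using x by (simp add: labellings_def n_def)
      then show False using False core_card[OF core] r nr by simp
    qed
    then have "cov_sum \<mu> Lab s P1 P2 ty P bc = 0" unfolding cov_sum_def by (intro sum.neutral) blast
    then show ?thesis using lead False by simp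
  qed
qed

section \<open>Induction over leaves\<close>

text \<open>Leaves of the first walk; those of the second follow by symmetry. The inequality between
  positions and vertices passes to the reduced pair because deletion removes two positions and one
  vertex.\<close>

lemma (in labelled_cycles) cov_sum_step:
  assumes t: "t \<in> P1" "t \<notin> U" and U: "U \<subseteq> P" and le: "card P \<le> 2 * (bc True + bc False)"
    and IH1: "cov_sum \<mu> Lab s P1 P2 ty (insert t U) bc = leading_count \<mu> Lab s P1 P2 ty (insert t U) bc R"
    and IH2: "\<And>s' Q U' bc'. labelled_cycles s' Q P2 ty Lab \<mu> \<Longrightarrow> U' \<subseteq> Q \<union> P2 \<Longrightarrow> Q \<union> P2 \<subset> P \<Longrightarrow>
       card (Q \<union> P2) \<le> 2 * (bc' True + bc' False) \<Longrightarrow>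
       cov_sum \<mu> Lab s' Q P2 ty U' bc' = leading_count \<mu> Lab s' Q P2 ty U' bc' R"
  shows "cov_sum \<mu> Lab s P1 P2 ty U bc = leading_count \<mu> Lab s P1 P2 ty U bc R"
proof (cases "s (s t) = t")
  case True
  have "labellings Lab s P ty (insert t U) bc \<subseteq> labellings Lab s P ty U bc"
    by (auto simp: labellings_def)
  moreover have "\<forall>x\<in>labellings Lab s P ty U bc - labellings Lab s P ty (insert t U) bc.
      cov_weight \<mu> s P1 P2 x = 0"
    using leaf_short_zero[of \<mu> t] mu1 t(1) True by (auto simp: labellings_def)
  ultimately have "cov_sum \<mu> Lab s P1 P2 ty U bc = cov_sum \<mu> Lab s P1 P2 ty (insert t U) bc"
    unfolding cov_sum_def by (intro sum.mono_neutral_right finite_labellings fin_Lab) (use fin in simp)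
  moreover have "leading_count \<mu> Lab s P1 P2 ty U bc R = leading_count \<mu> Lab s P1 P2 ty (insert t U) bc R"
    unfolding leading_count_def
    by (intro arg_cong2[where f="(*)"] refl sum.cong) (simp_all add: closing_sets_short[OF t(1) True t(2)])
  ultimately show ?thesis using IH1 by simp
next
  case False
  interpret del: deletion s P1 P2 ty t by unfold_locales (use t False in auto)
  let ?s = "skip s t" and ?Q = "P1 - {t, s t}" and ?\<tau> = "ty (s t)"
  let ?bc = "bc(?\<tau> := bc ?\<tau> - 1)"
  have "cov_sum \<mu> Lab ?s ?Q P2 ty (del.U' U) ?bc = leading_count \<mu> Lab ?s ?Q P2 ty (del.U' U) ?bc R"
    if nz: "bc ?\<tau> \<noteq> 0"
  proof (rule IH2)
    show "labelled_cycles ?s ?Q P2 ty Lab \<mu>"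
      using fin_Lab dis_Lab mu1 mu2 del.two' by unfold_locales auto
    show "del.U' U \<subseteq> ?Q \<union> P2" using U by (auto simp: del.U'_def)
    have "t \<notin> P2" using t dis by auto
    then show "?Q \<union> P2 \<subset> P" using t by auto
    have "card P1 = card ?Q + 2" by (rule del.card_P1')
    moreover have "card P = card P1 + card P2" by (rule card_Un_disjoint[OF fin dis])
    moreover have "card (?Q \<union> P2) \<le> card ?Q + card P2" by (rule card_Un_le)
    ultimately have c: "card (?Q \<union> P2) + 2 \<le> 2 * (bc True + bc False)" using le by linarith
    have "?bc True + ?bc False + 1 = bc True + bc False"
      using nz by (cases ?\<tau>) simp_all
    then have "2 * (bc True + bc False) = 2 * (?bc True + ?bc False) + 2" by (metis distrib_left mult.right_neutral)
    with c show "card (?Q \<union> P2) \<le> 2 * (?bc True + ?bc False)" by (metis add_le_cancel_right)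
  qed
  then show ?thesis
    using del.cov_sum_delete[where \<mu>=\<mu> and Lab=Lab and bc=bc, OF mu1 mu2 fin_Lab dis_Lab t(2) U]
      del.leading_count_delete[where \<mu>=\<mu> and Lab=Lab and bc=bc and R=R, OF t(2) U] IH1
    by (cases "bc ?\<tau> = 0") simp_all
qed

text \<open>Nested induction: on the number of positions, for deleted leaves, and inside it on the
  number of places outside \<open>U\<close>, for excluded ones. Where the assumed inequality is
  strict, the right-hand side is zero by \<open>closing_sets_empty_count\<close>.\<close>

theorem cov_sum_eq_leading_count:
  assumes "labelled_cycles s P1 P2 ty Lab \<mu>" "U \<subseteq> P1 \<union> P2"
    "card (P1 \<union> P2) \<le> 2 * (bc True + bc False)" "card (P1 \<union> P2) \<le> 2 * R"
  shows "cov_sum \<mu> Lab s P1 P2 ty U bc = leading_count \<mu> Lab s P1 P2 ty U bc R"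
  using assms
proof (induction "card (P1 \<union> P2)" arbitrary: s P1 P2 U bc rule: less_induct)
  case less
  note outer = less.hyps
  show ?case using less.prems
  proof (induction "card (P1 \<union> P2 - U)" arbitrary: U rule: less_induct)
    case less
    interpret labelled_cycles s P1 P2 ty Lab \<mu> by (rule less.prems(1))
    interpret sw: labelled_cycles s P2 P1 ty Lab \<mu> by (rule swap)
    have finP: "finite (P1 \<union> P2)" using fin by simp
    have IH2: "cov_sum \<mu> Lab s' Q Q' ty U' bc' = leading_count \<mu> Lab s' Q Q' ty U' bc' R"
      if "labelled_cycles s' Q Q' ty Lab \<mu>" "U' \<subseteq> Q \<union> Q'" "Q \<union> Q' \<subset> P1 \<union> P2"
        "card (Q \<union> Q') \<le> 2 * (bc' True + bc' False)" for s' Q Q' U' bc'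
    proof -
      have "card (Q \<union> Q') < card (P1 \<union> P2)" by (rule psubset_card_mono[OF finP that(3)])
      then show ?thesis using outer[OF _ that(1,2,4)] less.prems(4) by simp
    qed
    show ?case
    proof (cases "U = P1 \<union> P2")
      case True
      then show ?thesis using cov_sum_core less.prems by simp
    next
      case False
      then obtain t where t: "t \<in> P1 \<union> P2" "t \<notin> U" using less.prems(2) by blast
      have "card (P1 \<union> P2 - insert t U) < card (P1 \<union> P2 - U)"
        by (rule psubset_card_mono) (use finP t in auto)
      then have IH1: "cov_sum \<mu> Lab s P1 P2 ty (insert t U) bc = leading_count \<mu> Lab s P1 P2 ty (insert t U) bc R"
        using less.hyps less.prems t by simp
      from t(1) show ?thesis
      proof
        assume "t \<in> P1"
        then show ?thesis
          by (rule cov_sum_step[OF _ t(2) less.prems(2,3) IH1]) (rule IH2)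
      next
        assume "t \<in> P2"
        then have "cov_sum \<mu> Lab s P2 P1 ty U bc = leading_count \<mu> Lab s P2 P1 ty U bc R"
        proof (rule sw.cov_sum_step[OF _ t(2)])
          show "U \<subseteq> P2 \<union> P1" "card (P2 \<union> P1) \<le> 2 * (bc True + bc False)"
            using less.prems(2,3) by (auto simp: Un_commute)
          show "cov_sum \<mu> Lab s P2 P1 ty (insert t U) bc = leading_count \<mu> Lab s P2 P1 ty (insert t U) bc R"
            using IH1 cov_sum_commute leading_count_commute by metis
        qed (rule IH2, auto simp: Un_commute)
        then show ?thesis using cov_sum_commute leading_count_commute by metis
      qed
    qed
  qed
qed

section \<open>Counting closing sets\<close>

text \<open>Position \<open>(c, True, k)\<close> carries the \<open>k\<close>-th row index of the first (\<open>c\<close>) or second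
  (\<open>\<not> c\<close>) walk, and \<open>(c, False, k)\<close> its \<open>k\<close>-th column index.\<close>

definition positions :: "bool \<Rightarrow> nat \<Rightarrow> (bool \<times> bool \<times> nat) set" where
  "positions c l = {c} \<times> UNIV \<times> {..<l}"

text \<open>From row index \<open>k\<close> to column index \<open>k\<close> and on to row index
  \<open>k + 1\<close>, cyclically: the order in which the trace of a power of
  \<open>X * X^T\<close> visits them.\<close>

fun walk_next :: "nat \<Rightarrow> nat \<Rightarrow> bool \<times> bool \<times> nat \<Rightarrow> bool \<times> bool \<times> nat" where
  "walk_next l1 l2 (c, \<tau>, k) = (c, \<not> \<tau>, if \<tau> then k else Suc k mod (if c then l1 else l2))"

definition row_pos :: "bool \<times> bool \<times> nat \<Rightarrow> bool" where
  "row_pos u = fst (snd u)"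

lemma row_pos_simp [simp]: "row_pos (c, \<tau>, k) = \<tau>" by (simp add: row_pos_def)

lemma single_cycle_walk:
  assumes l: "l = (if c then l1 else l2)" "l \<ge> 1"
  shows "single_cycle (walk_next l1 l2) (positions c l)"
  unfolding single_cycle_def
proof (intro conjI allI impI)
  let ?s = "walk_next l1 l2"
  have nx: "?s (c, \<tau>, k) = (c, \<not> \<tau>, if \<tau> then k else Suc k mod l)" for \<tau> k by (simp add: l(1))
  show "finite (positions c l)" by (simp add: positions_def)
  have "(c, True, 0) \<in> positions c l" using l(2) by (simp add: positions_def)
  then show "positions c l \<noteq> {}" by blast
  show "?s ` positions c l \<subseteq> positions c l"
  proof (rule image_subsetI)
    fix u assume "u \<in> positions c l"
    then obtain \<tau> k where "u = (c, \<tau>, k)" "k < l" by (auto simp: positions_def)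
    then show "?s u \<in> positions c l" using l(2) by (simp add: positions_def nx del: walk_next.simps)
  qed
  fix A assume A: "A \<subseteq> positions c l" "A \<noteq> {}" "?s ` A \<subseteq> A"
  have cl: "?s u \<in> A" if "u \<in> A" for u by (rule subsetD[OF A(3) imageI[OF that]])
  obtain u where u: "u \<in> A" using A(2) by blast
  then obtain \<tau> k where "u = (c, \<tau>, k)" "k < l" using A(1) by (auto simp: positions_def)
  then have "(c, \<tau>, k) \<in> A" "k < l" using u by simp_all
  then obtain k where k: "(c, True, k) \<in> A" "k < l"
    using cl[of "(c, \<tau>, k)"] l(2) unfolding nx by (cases \<tau>) auto
  have all: "(c, True, (k + m) mod l) \<in> A" for m
  proof (induction m)
    case 0 then show ?case using k by simp
  next
    case (Suc m)
    have "(c, False, (k + m) mod l) \<in> A" using cl[OF Suc] unfolding nx by simp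
    from cl[OF this] show ?case unfolding nx by (simp add: mod_Suc_eq)
  qed
  have T: "(c, True, j) \<in> A" if "j < l" for j
  proof -
    \<comment> \<open>The offset wraps around once, so that \<open>j < k\<close> causes no truncated
      subtraction.\<close>
    have "(k + (l - k + j)) mod l = j" using that k(2) by simp
    then show ?thesis using all[of "l - k + j"] by simp
  qed
  have "(c, False, j) \<in> A" if "j < l" for j
    using cl[OF T[OF that]] unfolding nx by simp
  with T have "(c, \<tau>, j) \<in> A" if "j < l" for \<tau> j using that by (cases \<tau>) auto
  then have "positions c l \<subseteq> A" by (auto simp: positions_def)
  with A(1) show "A = positions c l" by (rule subset_antisym)
qed

lemma two_cycles_walk:
  assumes "l1 \<ge> 1" "l2 \<ge> 1"
  shows "two_cycles (walk_next l1 l2) (positions True l1) (positions False l2) row_pos"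
proof -
  have "single_cycle (walk_next l1 l2) (positions True l1)"
    by (rule single_cycle_walk) (use assms in auto)
  moreover have "single_cycle (walk_next l1 l2) (positions False l2)"
    by (rule single_cycle_walk) (use assms in auto)
  ultimately show ?thesis by (auto simp: two_cycles_def positions_def)
qed

lemma card_positions: "card (positions c l) = 2 * l"
  by (simp add: positions_def card_cartesian_product)

text \<open>A subset of a disjoint union is a family of subsets of the blocks, chosen
  independently.\<close>

lemma card_multi_subsets:
  assumes I: "finite I" and Q: "\<And>i. i \<in> I \<Longrightarrow> finite (Q i)"
    and dis: "\<And>i j. i \<in> I \<Longrightarrow> j \<in> I \<Longrightarrow> i \<noteq> j \<Longrightarrow> Q i \<inter> Q j = {}"
  shows "card {\<alpha>. \<alpha> \<subseteq> (\<Union>i\<in>I. Q i) \<and> (\<forall>i\<in>I. card (\<alpha> \<inter> Q i) = k i)} = (\<Prod>i\<in>I. card (Q i) choose k i)"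
proof -
  let ?S = "\<lambda>i. {B. B \<subseteq> Q i \<and> card B = k i}"
  let ?A = "{\<alpha>. \<alpha> \<subseteq> (\<Union>i\<in>I. Q i) \<and> (\<forall>i\<in>I. card (\<alpha> \<inter> Q i) = k i)}"
  have int: "(\<Union>j\<in>I. f j) \<inter> Q i = f i" if f: "f \<in> PiE I ?S" and i: "i \<in> I" for f i
  proof -
    have sub: "f j \<subseteq> Q j" if "j \<in> I" for j using PiE_mem[OF f that] by simp
    show ?thesis
    proof (rule Set.set_eqI, rule iffI)
      fix z assume "z \<in> (\<Union>j\<in>I. f j) \<inter> Q i"
      then obtain j where j: "j \<in> I" "z \<in> f j" "z \<in> Q i" by blast
      have "z \<in> Q j" using sub[OF j(1)] j(2) by blast
      then have "j = i" using dis[of j i] j i by blast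
      then show "z \<in> f i" using j by simp
    next
      fix z assume "z \<in> f i" then show "z \<in> (\<Union>j\<in>I. f j) \<inter> Q i" using sub i by blast
    qed
  qed
  have "bij_betw (\<lambda>f. \<Union>i\<in>I. f i) (PiE I ?S) ?A"
  proof (rule bij_betw_byWitness[where f'="\<lambda>\<alpha>. restrict (\<lambda>i. \<alpha> \<inter> Q i) I"])
    show "\<forall>f\<in>PiE I ?S. restrict (\<lambda>i. (\<Union>i\<in>I. f i) \<inter> Q i) I = f"
    proof
      fix f assume f: "f \<in> PiE I ?S"
      show "restrict (\<lambda>i. (\<Union>i\<in>I. f i) \<inter> Q i) I = f"
      proof
        fix i show "restrict (\<lambda>i. (\<Union>i\<in>I. f i) \<inter> Q i) I i = f i"
          using int[OF f, of i] PiE_arb[OF f, of i] by (cases "i \<in> I") simp_all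
      qed
    qed
    show "\<forall>\<alpha>\<in>?A. (\<Union>i\<in>I. restrict (\<lambda>i. \<alpha> \<inter> Q i) I i) = \<alpha>"
      by auto
    show "(\<lambda>f. \<Union>i\<in>I. f i) ` PiE I ?S \<subseteq> ?A"
    proof (rule image_subsetI)
      fix f assume f: "f \<in> PiE I ?S"
      have "card ((\<Union>i\<in>I. f i) \<inter> Q i) = k i" if "i \<in> I" for i
        using int[OF f that] PiE_mem[OF f that] by simp
      moreover have "(\<Union>i\<in>I. f i) \<subseteq> (\<Union>i\<in>I. Q i)" using PiE_mem[OF f] by blast
      ultimately show "(\<Union>i\<in>I. f i) \<in> ?A" by simp
    qed
    show "(\<lambda>\<alpha>. restrict (\<lambda>i. \<alpha> \<inter> Q i) I) ` ?A \<subseteq> PiE I ?S"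
      by auto
  qed
  from bij_betw_same_card[OF this] have "card ?A = card (PiE I ?S)" by (rule sym)
  also have "\<dots> = (\<Prod>i\<in>I. card (?S i))" by (rule card_PiE[OF I])
  also have "\<dots> = (\<Prod>i\<in>I. card (Q i) choose k i)"
    by (rule prod.cong[OF refl]) (simp add: n_subsets Q)
  finally show ?thesis .
qed

text \<open>With \<open>U = {}\<close> a closing set is constrained only through its sizes in four
  blocks, given by walk and type. The length and type equations leave one free size
  \<open>k\<close>, that in the row block of the first walk.\<close>

lemma card_closing_sets:
  fixes l1 l2 :: nat
  assumes bc: "bc True = b" "bc False = l1 + l2 - b" "b \<le> l1 + l2"
  shows "card (closing_sets (walk_next l1 l2) (positions True l1) (positions False l2) row_pos {} bc r)
    = (if r \<le> b then \<Sum>k=0..b-r. (l1 choose k) * (l1 choose (k + r)) * (l2 choose (b - r - k)) * (l2 choose (b - k)) else 0)"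
proof -
  let ?P1 = "positions True l1" and ?P2 = "positions False l2"
  let ?C = "closing_sets (walk_next l1 l2) ?P1 ?P2 row_pos {} bc r"
  define Q where "Q = (\<lambda>(c, \<tau>). {c :: bool} \<times> {\<tau> :: bool} \<times> {..<(if c then l1 else l2)})"
  have P1: "?P1 = Q (True, True) \<union> Q (True, False)" and P2: "?P2 = Q (False, True) \<union> Q (False, False)"
    by (auto simp: positions_def Q_def)
  have UQ: "(\<Union>i\<in>UNIV. Q i) = ?P1 \<union> ?P2"
  proof -
    have U: "(UNIV :: (bool \<times> bool) set) = {(True, True), (True, False), (False, True), (False, False)}"
      by auto
    show ?thesis unfolding P1 P2 U by auto
  qed
  have finQ: "finite (Q i)" for i by (cases i) (simp add: Q_def)
  have disQ: "Q i \<inter> Q j = {}" if "i \<noteq> j" for i j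
    using that by (cases i; cases j) (auto simp: Q_def)
  have cardQ: "card (Q (c, \<tau>)) = (if c then l1 else l2)" for c \<tau>
    by (simp add: Q_def card_cartesian_product)
  let ?q = "\<lambda>\<alpha> c \<tau>. card (\<alpha> \<inter> Q (c, \<tau>))"
  have a1: "card (\<alpha> \<inter> ?P1) = ?q \<alpha> True True + ?q \<alpha> True False" for \<alpha>
  proof -
    have "\<alpha> \<inter> ?P1 = (\<alpha> \<inter> Q (True, True)) \<union> (\<alpha> \<inter> Q (True, False))" unfolding P1 by blast
    then show ?thesis using finQ disQ[of "(True, True)" "(True, False)"]
      by (simp add: card_Un_disjoint disjoint_iff)
  qed
  have a2: "card (\<alpha> \<inter> ?P2) = ?q \<alpha> False True + ?q \<alpha> False False" for \<alpha>
  proof -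
    have "\<alpha> \<inter> ?P2 = (\<alpha> \<inter> Q (False, True)) \<union> (\<alpha> \<inter> Q (False, False))" unfolding P2 by blast
    then show ?thesis using finQ disQ[of "(False, True)" "(False, False)"]
      by (simp add: card_Un_disjoint disjoint_iff)
  qed
  have a3: "card {u \<in> \<alpha>. row_pos u = \<tau>} = ?q \<alpha> True \<tau> + ?q \<alpha> False \<tau>" if "\<alpha> \<subseteq> ?P1 \<union> ?P2" for \<alpha> \<tau>
  proof -
    have "{u \<in> \<alpha>. row_pos u = \<tau>} = (\<alpha> \<inter> Q (True, \<tau>)) \<union> (\<alpha> \<inter> Q (False, \<tau>))"
      using that by (auto simp: Q_def positions_def)
    then show ?thesis using finQ disQ[of "(True, \<tau>)" "(False, \<tau>)"]
      by (simp add: card_Un_disjoint disjoint_iff)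
  qed
  have mem: "\<alpha> \<in> ?C \<longleftrightarrow> \<alpha> \<subseteq> ?P1 \<union> ?P2 \<and> l1 = r + ?q \<alpha> True True + ?q \<alpha> True False \<and>
      l2 = r + ?q \<alpha> False True + ?q \<alpha> False False \<and>
      b = r + ?q \<alpha> True True + ?q \<alpha> False True \<and> l1 + l2 - b = r + ?q \<alpha> True False + ?q \<alpha> False False" for \<alpha>
  proof (cases "\<alpha> \<subseteq> ?P1 \<union> ?P2")
    case True
    show ?thesis
      unfolding closing_sets_def mem_Collect_eq card_positions a1 a2 a3[OF True] all_bool_eq bc
      using True by auto
  next
    case False
    then show ?thesis by (simp add: closing_sets_def)
  qed
  show ?thesis
  proof (cases "r \<le> b")
    case False
    then have "?C = {}" using mem by auto
    then show ?thesis using False by simp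
  next
    case True
    let ?S = "\<lambda>k. {\<alpha> \<in> ?C. ?q \<alpha> True True = k}"
    have fC: "finite ?C"
      by (rule finite_subset[of _ "Pow (?P1 \<union> ?P2)"]) (auto simp: closing_sets_def positions_def)
    have CU: "?C = (\<Union>k\<in>{0..b-r}. ?S k)" using mem by auto
    have "card ?C = card (\<Union>k\<in>{0..b-r}. ?S k)" by (rule arg_cong[where f=card]) (rule CU)
    also have "\<dots> = (\<Sum>k=0..b-r. card (?S k))"
      by (rule card_UN_disjoint) (use fC in auto)
    also have "\<dots> = (\<Sum>k=0..b-r. (l1 choose k) * (l1 choose (k + r)) * (l2 choose (b - r - k)) * (l2 choose (b - k)))"
    proof (rule sum.cong[OF refl])
      fix k assume k: "k \<in> {0..b-r}"
      show "card (?S k) = (l1 choose k) * (l1 choose (k + r)) * (l2 choose (b - r - k)) * (l2 choose (b - k))"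
      proof (cases "k + r \<le> l1 \<and> b - k \<le> l2")
        \<comment> \<open>The equations have no solution here, and a binomial coefficient on the
          right vanishes.\<close>
        case F: False
        then have "?S k = {}" using mem k True by auto
        then have "card (?S k) = 0" by (simp only: card.empty)
        moreover have "(l1 choose (k + r)) = 0 \<or> (l2 choose (b - k)) = 0" using F by auto
        ultimately show ?thesis by (metis mult_is_0)
      next
        case T: True
        \<comment> \<open>The solution of the length and type equations for given
          \<open>k\<close>.\<close>
        define kk where "kk = (\<lambda>(c, \<tau>). if c then (if \<tau> then k else l1 - r - k) else (if \<tau> then b - r - k else l2 - (b - k)))"
        have "?S k = {\<alpha>. \<alpha> \<subseteq> (\<Union>i\<in>UNIV. Q i) \<and> (\<forall>i\<in>UNIV. card (\<alpha> \<inter> Q i) = kk i)}"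
        proof (rule Set.set_eqI)
          fix \<alpha>
          have "\<alpha> \<in> ?S k \<longleftrightarrow> \<alpha> \<subseteq> ?P1 \<union> ?P2 \<and> ?q \<alpha> True True = k \<and> ?q \<alpha> True False = l1 - r - k \<and>
             ?q \<alpha> False True = b - r - k \<and> ?q \<alpha> False False = l2 - (b - k)"
            unfolding mem_Collect_eq mem using T k True by auto
          also have "\<dots> \<longleftrightarrow> \<alpha> \<in> {\<alpha>. \<alpha> \<subseteq> (\<Union>i\<in>UNIV. Q i) \<and> (\<forall>i\<in>UNIV. card (\<alpha> \<inter> Q i) = kk i)}"
            unfolding UQ by (auto simp: kk_def split_paired_all all_bool_eq)
          finally show "\<alpha> \<in> ?S k \<longleftrightarrow> \<alpha> \<in> {\<alpha>. \<alpha> \<subseteq> (\<Union>i\<in>UNIV. Q i) \<and> (\<forall>i\<in>UNIV. card (\<alpha> \<inter> Q i) = kk i)}" .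
        qed
        then have "card (?S k) = (\<Prod>i\<in>UNIV. card (Q i) choose kk i)"
          using card_multi_subsets[of UNIV Q kk] finQ disQ by simp
        also have "\<dots> = (\<Prod>c\<in>UNIV. \<Prod>\<tau>\<in>UNIV. card (Q (c, \<tau>)) choose kk (c, \<tau>))"
          unfolding UNIV_Times_UNIV[symmetric] by (simp add: prod.cartesian_product case_prod_beta)
        also have "\<dots> = (l1 choose k) * (l1 choose (l1 - r - k)) * ((l2 choose (b - r - k)) * (l2 choose (l2 - (b - k))))"
          by (simp add: UNIV_bool kk_def cardQ mult_ac)
        also have "l1 choose (l1 - r - k) = l1 choose (k + r)"
          using T binomial_symmetric[of "k + r" l1] by (simp add: add.commute)
        also have "l2 choose (l2 - (b - k)) = l2 choose (b - k)"
          using T binomial_symmetric[of "b - k" l2] by simp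
        finally show ?thesis by (simp add: mult_ac)
      qed
    qed
    finally show ?thesis using True by simp
  qed
qed

text \<open>Exchanging the summations over the triangle \<open>r + k \<le> b\<close> turns
  \<open>r\<close> into the index \<open>m\<close> of \<open>Ccoef\<close>; the extra term at
  \<open>r = 1\<close> is the sum in \<open>Dcoef\<close>.\<close>

lemma leading_sum_eq:
  fixes l1 l2 b :: nat
  assumes bc: "bc True = b" "bc False = l1 + l2 - b" "b \<le> l1 + l2"
  shows "(\<Sum>r=1..l1 + l2. (2 * real r + (if r = 1 then d else 0)) *
        real (card (closing_sets (walk_next l1 l2) (positions True l1) (positions False l2) row_pos {} bc r)))
   = 2 * (\<Sum>k=0..b. real (l1 choose k) * real (l2 choose (b - k)) *
        (\<Sum>m=0..b-k. real m * real (l1 choose (k + m)) * real (l2 choose (b - m - k))))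
     + d * (\<Sum>k\<in>{0..<b}. real (l1 choose k) * real (l1 choose (k + 1))
        * real (l2 choose (b - 1 - k)) * real (l2 choose (b - k)))"
proof -
  define w where "w r k = real (l1 choose k) * real (l1 choose (k + r)) * real (l2 choose (b - r - k)) * real (l2 choose (b - k))" for r k
  let ?n = "\<lambda>r. real (card (closing_sets (walk_next l1 l2) (positions True l1) (positions False l2) row_pos {} bc r))"
  have n: "?n r = (if r \<le> b then \<Sum>k=0..b-r. w r k else 0)" for r
    unfolding card_closing_sets[OF bc] by (simp add: w_def)
  have "(\<Sum>r=1..l1 + l2. (2 * real r + (if r = 1 then d else 0)) * ?n r)
    = (\<Sum>r=1..l1 + l2. 2 * (real r * ?n r) + (if r = 1 then d * ?n 1 else 0))"
    by (rule sum.cong) (auto simp: algebra_simps)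
  also have "\<dots> = 2 * (\<Sum>r=1..l1 + l2. real r * ?n r) + (if 1 \<le> l1 + l2 then d * ?n 1 else 0)"
    by (simp add: sum.distrib sum_distrib_left sum.delta)
  also have "(if 1 \<le> l1 + l2 then d * ?n 1 else 0) = d * (\<Sum>k\<in>{0..<b}. w 1 k)"
  proof -
    have "{0..b-1} = {0..<b}" if "1 \<le> b" using that by auto
    then show ?thesis unfolding n using bc(3) by (cases "1 \<le> b") auto
  qed
  also have "(\<Sum>r=1..l1 + l2. real r * ?n r) = (\<Sum>r=0..b. real r * (\<Sum>k=0..b-r. w r k))"
  proof -
    have "(\<Sum>r=1..l1 + l2. real r * ?n r) = (\<Sum>r=1..b. real r * ?n r)"
      by (rule sum.mono_neutral_right) (use bc(3) in \<open>auto simp: n\<close>)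
    also have "\<dots> = (\<Sum>r=0..b. real r * ?n r)"
      by (rule sum.mono_neutral_left) auto
    also have "\<dots> = (\<Sum>r=0..b. real r * (\<Sum>k=0..b-r. w r k))"
      by (rule sum.cong) (auto simp: n)
    finally show ?thesis .
  qed
  also have "\<dots> = (\<Sum>r=0..b. \<Sum>k=0..b-r. real r * w r k)" by (simp add: sum_distrib_left)
  also have "\<dots> = (\<Sum>(r,k)\<in>(SIGMA r:{0..b}. {0..b-r}). real r * w r k)"
    by (subst sum.Sigma) auto
  also have "\<dots> = (\<Sum>(k,r)\<in>(SIGMA k:{0..b}. {0..b-k}). real r * w r k)"
    by (rule sum.reindex_bij_witness[where i="\<lambda>(k,r). (r,k)" and j="\<lambda>(r,k). (k,r)"]) auto
  also have "\<dots> = (\<Sum>k=0..b. \<Sum>r=0..b-k. real r * w r k)"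
    by (subst sum.Sigma[symmetric]) auto
  also have "\<dots> = (\<Sum>k=0..b. real (l1 choose k) * real (l2 choose (b - k)) *
        (\<Sum>m=0..b-k. real m * real (l1 choose (k + m)) * real (l2 choose (b - m - k))))"
    by (rule sum.cong[OF refl]) (simp add: sum_distrib_left w_def mult_ac)
  also have "(\<Sum>k\<in>{0..<b}. w 1 k) = (\<Sum>k\<in>{0..<b}. real (l1 choose k) * real (l1 choose (k + 1))
        * real (l2 choose (b - 1 - k)) * real (l2 choose (b - k)))"
    by (simp add: w_def)
  finally show ?thesis .
qed

text \<open>Counting \<open>\<alpha>\<close> by walks and by types gives \<open>card P1 + card P2 =
  4 * r + 2 * card \<alpha> = 2 * (bc True + bc False)\<close>.\<close>

lemma closing_sets_empty_count:
  assumes "card P1 + card P2 \<noteq> 2 * (bc True + bc False)" "finite P1" "finite P2" "P1 \<inter> P2 = {}"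
  shows "closing_sets s P1 P2 ty U bc r = {}"
proof (rule ccontr)
  assume "\<not> ?thesis"
  then obtain \<alpha> where \<alpha>: "\<alpha> \<subseteq> P1 \<union> P2" "card P1 = 2 * r + 2 * card (\<alpha> \<inter> P1)"
     "card P2 = 2 * r + 2 * card (\<alpha> \<inter> P2)" "\<And>\<tau>. bc \<tau> = r + card {u \<in> \<alpha>. ty u = \<tau>}"
    by (auto simp: closing_sets_def)
  have fa: "finite \<alpha>" using \<alpha>(1) assms(2,3) finite_subset by blast
  have "card \<alpha> = card ((\<alpha> \<inter> P1) \<union> (\<alpha> \<inter> P2))"
    by (rule arg_cong[where f=card]) (use \<alpha>(1) in blast)
  also have "\<dots> = card (\<alpha> \<inter> P1) + card (\<alpha> \<inter> P2)"
    using fa assms(4) by (intro card_Un_disjoint) auto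
  finally have 1: "card \<alpha> = card (\<alpha> \<inter> P1) + card (\<alpha> \<inter> P2)" .
  have "card \<alpha> = card ({u \<in> \<alpha>. ty u = True} \<union> {u \<in> \<alpha>. ty u = False})"
    by (rule arg_cong[where f=card]) blast
  also have "\<dots> = card {u \<in> \<alpha>. ty u = True} + card {u \<in> \<alpha>. ty u = False}"
    using fa by (intro card_Un_disjoint) auto
  finally show False using 1 \<alpha>(2-4) assms(1) by simp
qed

section \<open>Traces as sums over closed walks\<close>

text \<open>A moment depends only on which positions share an index, which permits the passage from
  matrix indices to edges.\<close>

lemma multi_moment_kernel:
  assumes "\<And>t u. t \<in> Q \<Longrightarrow> u \<in> Q \<Longrightarrow> E t = E u \<longleftrightarrow> E' t = E' u"
  shows "multi_moment \<mu> Q E = multi_moment \<mu> Q E'"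
proof -
  define f where "f e = E' (SOME t. t \<in> Q \<and> E t = e)" for e
  have f: "f (E t) = E' t" if "t \<in> Q" for t
  proof -
    have "(SOME u. u \<in> Q \<and> E u = E t) \<in> Q \<and> E (SOME u. u \<in> Q \<and> E u = E t) = E t"
      by (rule someI[of _ t]) (use that in simp)
    then show ?thesis unfolding f_def using assms that by blast
  qed
  have "E' ` Q = f ` E ` Q" using f by (force simp: image_image)
  moreover have "inj_on f (E ` Q)" using f assms by (auto simp: inj_on_def)
  ultimately have "multi_moment \<mu> Q E' = (\<Prod>e\<in>E ` Q. \<mu> (card {t \<in> Q. E' t = f e}))"
    unfolding multi_moment_def by (simp add: prod.reindex)
  also have "\<dots> = multi_moment \<mu> Q E"
    unfolding multi_moment_def
  proof (rule prod.cong[OF refl])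
    fix e assume "e \<in> E ` Q"
    then obtain u where u: "u \<in> Q" "e = E u" by auto
    have "{t \<in> Q. E' t = f e} = {t \<in> Q. E t = e}" using assms u f by auto
    then show "\<mu> (card {t \<in> Q. E' t = f e}) = \<mu> (card {t \<in> Q. E t = e})" by simp
  qed
  finally show ?thesis by simp
qed

lemma sum_PiE_Suc:
  fixes f :: "(nat \<Rightarrow> 'b) \<Rightarrow> real"
  shows "(\<Sum>i\<in>PiE {..<Suc l} (\<lambda>_. B). f i) = (\<Sum>w\<in>B. \<Sum>i\<in>PiE {..<l} (\<lambda>_. B). f (i(l := w)))"
proof -
  have "(\<Sum>i\<in>PiE {..<Suc l} (\<lambda>_. B). f i)
      = (\<Sum>i\<in>(\<lambda>(y, g). g(l := y)) ` (B \<times> PiE {..<l} (\<lambda>_. B)). f i)"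
    by (simp add: lessThan_Suc PiE_insert_eq)
  also have "\<dots> = (\<Sum>(w, i)\<in>B \<times> PiE {..<l} (\<lambda>_. B). f (i(l := w)))"
    by (subst sum.reindex[OF inj_combinator]) (auto simp: case_prod_beta)
  also have "\<dots> = (\<Sum>w\<in>B. \<Sum>i\<in>PiE {..<l} (\<lambda>_. B). f (i(l := w)))"
    by (rule sum.cartesian_product[symmetric])
  finally show ?thesis .
qed

text \<open>The indicator of \<open>i 0 = u\<close> keeps the summation set a plain
  \<open>PiE\<close>, and the end point \<open>v\<close> stays free for the induction.\<close>

lemma pow_mat_entry:
  fixes A :: "real mat"
  assumes A: "A \<in> carrier_mat p p" and u: "u < p" and v: "v < p"
  shows "(A ^\<^sub>m Suc l) $$ (u, v) = (\<Sum>i\<in>PiE {..<Suc l} (\<lambda>_. {..<p}).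
     if i 0 = u then (\<Prod>k<l. A $$ (i k, i (Suc k))) * A $$ (i l, v) else 0)"
  using v
proof (induction l arbitrary: v)
  case 0
  have "A ^\<^sub>m Suc 0 = A" using A by simp
  moreover have "(\<Sum>i\<in>PiE {..<Suc 0} (\<lambda>_. {..<p}).
      if i 0 = u then (\<Prod>k<0. A $$ (i k, i (Suc k))) * A $$ (i 0, v) else 0)
      = (\<Sum>w<p. if w = u then A $$ (w, v) else 0)"
    unfolding sum_PiE_Suc lessThan_0 PiE_empty_domain by (rule sum.cong[OF refl]) simp
  moreover have "(\<Sum>w<p. if w = u then A $$ (w, v) else 0) = A $$ (u, v)"
    using u by (subst sum.delta) simp_all
  ultimately show ?case by (simp only:)
next
  case (Suc l)
  have dimA: "A ^\<^sub>m Suc l \<in> carrier_mat p p" using A by (rule pow_carrier_mat)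
  have "(A ^\<^sub>m Suc (Suc l)) $$ (u, v) = (\<Sum>w<p. (A ^\<^sub>m Suc l) $$ (u, w) * A $$ (w, v))"
  proof -
    have "(A ^\<^sub>m Suc (Suc l)) $$ (u, v) = row (A ^\<^sub>m Suc l) u \<bullet> col A v"
      using A dimA u Suc.prems by (subst pow_mat.simps(2)) (rule index_mult_mat(1), auto)
    also have "\<dots> = (\<Sum>w<p. (A ^\<^sub>m Suc l) $$ (u, w) * A $$ (w, v))"
      using A dimA u Suc.prems unfolding scalar_prod_def
      by (intro sum.cong) (auto simp: atLeast0LessThan simp del: pow_mat.simps)
    finally show ?thesis .
  qed
  also have "\<dots> = (\<Sum>w<p. \<Sum>i\<in>PiE {..<Suc l} (\<lambda>_. {..<p}).
     (if i 0 = u then (\<Prod>k<l. A $$ (i k, i (Suc k))) * A $$ (i l, w) else 0) * A $$ (w, v))"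
    by (rule sum.cong[OF refl]) (simp only: Suc.IH lessThan_iff sum_distrib_right)
  also have "\<dots> = (\<Sum>w<p. \<Sum>i\<in>PiE {..<Suc l} (\<lambda>_. {..<p}).
     if (i(Suc l := w)) 0 = u then (\<Prod>k<Suc l. A $$ ((i(Suc l := w)) k, (i(Suc l := w)) (Suc k))) *
        A $$ ((i(Suc l := w)) (Suc l), v) else 0)"
  proof (intro sum.cong refl)
    fix w i
    have "(\<Prod>k<Suc l. A $$ ((i(Suc l := w)) k, (i(Suc l := w)) (Suc k)))
       = (\<Prod>k<l. A $$ ((i(Suc l := w)) k, (i(Suc l := w)) (Suc k))) * A $$ (i l, w)" by simp
    also have "(\<Prod>k<l. A $$ ((i(Suc l := w)) k, (i(Suc l := w)) (Suc k))) = (\<Prod>k<l. A $$ (i k, i (Suc k)))"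
      by (rule prod.cong) auto
    finally show "(if i 0 = u then (\<Prod>k<l. A $$ (i k, i (Suc k))) * A $$ (i l, w) else 0) * A $$ (w, v)
      = (if (i(Suc l := w)) 0 = u then (\<Prod>k<Suc l. A $$ ((i(Suc l := w)) k, (i(Suc l := w)) (Suc k))) *
        A $$ ((i(Suc l := w)) (Suc l), v) else 0)" by simp
  qed
  also have "\<dots> = (\<Sum>i\<in>PiE {..<Suc (Suc l)} (\<lambda>_. {..<p}).
     if i 0 = u then (\<Prod>k<Suc l. A $$ (i k, i (Suc k))) * A $$ (i (Suc l), v) else 0)"
    by (rule sum_PiE_Suc[symmetric])
  finally show ?case .
qed

lemma mtrace_pow_mat:
  fixes A :: "real mat"
  assumes A: "A \<in> carrier_mat p p" and l: "l \<ge> 1"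
  shows "mtrace (A ^\<^sub>m l) = (\<Sum>i\<in>PiE {..<l} (\<lambda>_. {..<p}). \<Prod>k<l. A $$ (i k, i (Suc k mod l)))"
proof -
  obtain m where m: "l = Suc m" using l by (cases l) auto
  have "A ^\<^sub>m l \<in> carrier_mat p p" using A by (rule pow_carrier_mat)
  then have "mtrace (A ^\<^sub>m l) = (\<Sum>u<p. (A ^\<^sub>m l) $$ (u, u))" by (auto simp: mtrace_def)
  also have "\<dots> = (\<Sum>u<p. \<Sum>i\<in>PiE {..<l} (\<lambda>_. {..<p}).
     if i 0 = u then (\<Prod>k<m. A $$ (i k, i (Suc k))) * A $$ (i m, u) else 0)"
    unfolding m by (rule sum.cong[OF refl]) (simp only: pow_mat_entry[OF A] lessThan_iff)
  also have "\<dots> = (\<Sum>i\<in>PiE {..<l} (\<lambda>_. {..<p}). \<Sum>u<p.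
     if i 0 = u then (\<Prod>k<m. A $$ (i k, i (Suc k))) * A $$ (i m, u) else 0)"
    by (rule sum.swap)
  also have "\<dots> = (\<Sum>i\<in>PiE {..<l} (\<lambda>_. {..<p}). \<Prod>k<l. A $$ (i k, i (Suc k mod l)))"
  proof (rule sum.cong[OF refl])
    fix i assume "i \<in> PiE {..<l} (\<lambda>_. {..<p})"
    then have i0: "i 0 < p" using l by (auto simp: PiE_iff)
    have "(\<Prod>k<l. A $$ (i k, i (Suc k mod l))) = (\<Prod>k<m. A $$ (i k, i (Suc k mod l))) * A $$ (i m, i 0)"
      by (simp add: m)
    also have "(\<Prod>k<m. A $$ (i k, i (Suc k mod l))) = (\<Prod>k<m. A $$ (i k, i (Suc k)))"
      by (rule prod.cong) (auto simp: m)
    finally show "(\<Sum>u<p. if i 0 = u then (\<Prod>k<m. A $$ (i k, i (Suc k))) * A $$ (i m, u) else 0)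
      = (\<Prod>k<l. A $$ (i k, i (Suc k mod l)))" using i0 by simp
  qed
  finally show ?thesis .
qed

lemma Smat_carrier: "Smat Y p n w \<in> carrier_mat p p"
  unfolding Smat_def Xmat_def by (intro smult_carrier_mat mult_carrier_mat[of _ p n]) auto

lemma Smat_entry:
  assumes "a < p" "b < p"
  shows "Smat Y p n w $$ (a, b) = (1 / real n) * (\<Sum>j<n. Y a j w * Y b j w)"
  using assms by (simp add: Smat_def Xmat_def scalar_prod_def atLeast0LessThan)

lemma mtrace_Smat_pow:
  assumes "l \<ge> 1"
  shows "mtrace (Smat Y p n w ^\<^sub>m l) = (1 / real n) ^ l *
    (\<Sum>i\<in>PiE {..<l} (\<lambda>_. {..<p}). \<Sum>j\<in>PiE {..<l} (\<lambda>_. {..<n}).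
       \<Prod>k<l. Y (i k) (j k) w * Y (i (Suc k mod l)) (j k) w)"
proof -
  have "(\<Prod>k<l. Smat Y p n w $$ (i k, i (Suc k mod l))) = (1 / real n) ^ l *
      (\<Sum>j\<in>PiE {..<l} (\<lambda>_. {..<n}). \<Prod>k<l. Y (i k) (j k) w * Y (i (Suc k mod l)) (j k) w)"
    if i: "i \<in> PiE {..<l} (\<lambda>_. {..<p})" for i
  proof -
    have ik: "i k < p" if "k < l" for k using PiE_mem[OF i, of k] that by simp
    have "(\<Prod>k<l. Smat Y p n w $$ (i k, i (Suc k mod l)))
        = (\<Prod>k<l. (1 / real n) * (\<Sum>j<n. Y (i k) j w * Y (i (Suc k mod l)) j w))"
      by (rule prod.cong[OF refl], rule Smat_entry) (use ik assms in auto)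
    also have "\<dots> = (1 / real n) ^ l * (\<Prod>k<l. \<Sum>j<n. Y (i k) j w * Y (i (Suc k mod l)) j w)"
      by (simp only: prod.distrib prod_constant card_lessThan)
    also have "(\<Prod>k<l. \<Sum>j<n. Y (i k) j w * Y (i (Suc k mod l)) j w)
      = (\<Sum>j\<in>PiE {..<l} (\<lambda>_. {..<n}). \<Prod>k<l. Y (i k) (j k) w * Y (i (Suc k mod l)) (j k) w)"
      by (rule prod_sum_PiE) auto
    finally show ?thesis .
  qed
  then show ?thesis unfolding mtrace_pow_mat[OF Smat_carrier assms] by (simp add: sum_distrib_left)
qed

text \<open>The tag keeps row and column labels disjoint although their numbers overlap.\<close>

definition matrix_labels :: "nat \<Rightarrow> nat \<Rightarrow> bool \<Rightarrow> (bool \<times> nat) set" where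
  "matrix_labels p n \<tau> = {\<tau>} \<times> {..<(if \<tau> then p else n)}"

text \<open>The row comes first whatever the direction of traversal; each step of the walk is one
  factor in the expanded trace.\<close>

definition matrix_index :: "(bool \<times> bool \<times> nat \<Rightarrow> bool \<times> bool \<times> nat) \<Rightarrow>
    (bool \<times> bool \<times> nat \<Rightarrow> bool \<times> nat) \<Rightarrow> bool \<times> bool \<times> nat \<Rightarrow> nat \<times> nat" where
  "matrix_index s x t = (if row_pos t then (snd (x t), snd (x (s t))) else (snd (x (s t)), snd (x t)))"

text \<open>Row and column indices are interleaved into one labelling; the two factors for
  \<open>k\<close> are the steps into and out of the column index \<open>j k\<close>.\<close>

lemma sum_walks:
  fixes F :: "nat \<Rightarrow> nat \<Rightarrow> real"
  assumes l: "l = (if c then l1 else l2)" "l \<ge> 1"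
  shows "(\<Sum>i\<in>PiE {..<l} (\<lambda>_. {..<p}). \<Sum>j\<in>PiE {..<l} (\<lambda>_. {..<n}).
       \<Prod>k<l. F (i k) (j k) * F (i (Suc k mod l)) (j k))
    = (\<Sum>x\<in>PiE (positions c l) (\<lambda>t. matrix_labels p n (row_pos t)).
       \<Prod>t\<in>positions c l. case_prod F (matrix_index (walk_next l1 l2) x t))" (is "?L = ?R")
proof -
  let ?s = "walk_next l1 l2" and ?P = "positions c l"
  let ?X = "PiE ?P (\<lambda>t. matrix_labels p n (row_pos t))"
  let ?IJ = "PiE {..<l} (\<lambda>_. {..<p}) \<times> PiE {..<l} (\<lambda>_. {..<n})"
  let ?G = "\<lambda>(i, j). \<Prod>k<l. F (i k) (j k) * F (i (Suc k mod l)) (j k)"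
  let ?i = "\<lambda>x k. snd (x (c, True, k))" and ?j = "\<lambda>x k. snd (x (c, False, k))"
  have pr: "(\<Prod>t\<in>?P. case_prod F (matrix_index ?s x t))
      = (\<Prod>k<l. F (?i x k) (?j x k) * F (?i x (Suc k mod l)) (?j x k))" for x :: "bool \<times> bool \<times> nat \<Rightarrow> bool \<times> nat"
  proof -
    have "(\<Prod>t\<in>?P. case_prod F (matrix_index ?s x t))
       = (\<Prod>\<tau>\<in>UNIV. \<Prod>k<l. case_prod F (matrix_index ?s x (c, \<tau>, k)))"
      unfolding positions_def by (simp add: prod.cartesian_product[symmetric] prod.cartesian_product')
    also have "\<dots> = (\<Prod>k<l. case_prod F (matrix_index ?s x (c, True, k))) * (\<Prod>k<l. case_prod F (matrix_index ?s x (c, False, k)))"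
      by (simp add: UNIV_bool mult.commute)
    also have "\<dots> = (\<Prod>k<l. F (?i x k) (?j x k) * F (?i x (Suc k mod l)) (?j x k))"
      unfolding prod.distrib[symmetric] using l(1) by (intro prod.cong) (auto simp: matrix_index_def)
    finally show ?thesis .
  qed
  have "?L = (\<Sum>z\<in>?IJ. ?G z)"
    by (simp add: sum.cartesian_product)
  also have "\<dots> = ?R"
  proof (rule sum.reindex_bij_witness[where
        j="\<lambda>(i, j). restrict (\<lambda>t. (row_pos t, if row_pos t then i (snd (snd t)) else j (snd (snd t)))) ?P" and
        i="\<lambda>x. (restrict (?i x) {..<l}, restrict (?j x) {..<l})"])
    fix z assume "z \<in> ?IJ"
    then obtain i j where z: "z = (i, j)" and i: "i \<in> PiE {..<l} (\<lambda>_. {..<p})" and j: "j \<in> PiE {..<l} (\<lambda>_. {..<n})"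
      by auto
    define x where "x = restrict (\<lambda>t. (row_pos t, if row_pos t then i (snd (snd t)) else j (snd (snd t)))) ?P"
    have x: "(case z of (i, j) \<Rightarrow> restrict (\<lambda>t. (row_pos t, if row_pos t then i (snd (snd t)) else j (snd (snd t)))) ?P) = x"
      by (simp add: z x_def)
    have xi: "?i x k = i k" "?j x k = j k" if "k < l" for k
      using that by (simp_all add: x_def positions_def)
    have "restrict (?i x) {..<l} = i"
      using xi(1) PiE_arb[OF i] by (intro HOL.ext) (simp add: restrict_def)
    moreover have "restrict (?j x) {..<l} = j"
      using xi(2) PiE_arb[OF j] by (intro HOL.ext) (simp add: restrict_def)
    ultimately show "(restrict (?i (case z of (i, j) \<Rightarrow> restrict (\<lambda>t. (row_pos t, if row_pos t then i (snd (snd t)) else j (snd (snd t)))) ?P)) {..<l},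
       restrict (?j (case z of (i, j) \<Rightarrow> restrict (\<lambda>t. (row_pos t, if row_pos t then i (snd (snd t)) else j (snd (snd t)))) ?P)) {..<l}) = z"
      unfolding x by (simp add: z)
    have "x \<in> ?X"
    proof (rule PiE_I)
      fix t assume t: "t \<in> ?P"
      then obtain \<tau> k where tk: "t = (c, \<tau>, k)" "k < l" by (auto simp: positions_def)
      have "i k < p" "j k < n" using PiE_mem[OF i, of k] PiE_mem[OF j, of k] tk by auto
      then show "x t \<in> matrix_labels p n (row_pos t)" using t tk by (simp add: x_def matrix_labels_def)
    qed (simp add: x_def)
    then show "(case z of (i, j) \<Rightarrow> restrict (\<lambda>t. (row_pos t, if row_pos t then i (snd (snd t)) else j (snd (snd t)))) ?P) \<in> ?X"
      unfolding x .
    have "(\<Prod>k<l. F (?i x k) (?j x k) * F (?i x (Suc k mod l)) (?j x k)) = ?G z"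
      unfolding z prod.case using xi l(2) by (intro prod.cong) auto
    then show "(\<Prod>t\<in>?P. case_prod F (matrix_index ?s (case z of (i, j) \<Rightarrow> restrict (\<lambda>t. (row_pos t, if row_pos t then i (snd (snd t)) else j (snd (snd t)))) ?P) t)) = ?G z"
      unfolding x pr .
  next
    fix x assume x: "x \<in> ?X"
    have mem: "fst (x (c, \<tau>, k)) = \<tau>" "snd (x (c, \<tau>, k)) < (if \<tau> then p else n)" if "k < l" for \<tau> k
    proof -
      have "x (c, \<tau>, k) \<in> matrix_labels p n (row_pos (c, \<tau>, k))"
        by (rule PiE_mem[OF x]) (use that in \<open>simp add: positions_def\<close>)
      then show "fst (x (c, \<tau>, k)) = \<tau>" "snd (x (c, \<tau>, k)) < (if \<tau> then p else n)"
        by (auto simp: matrix_labels_def)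
    qed
    show "(restrict (?i x) {..<l}, restrict (?j x) {..<l}) \<in> ?IJ"
      using mem(2)[of _ True] mem(2)[of _ False] by auto
    show "(case (restrict (?i x) {..<l}, restrict (?j x) {..<l}) of (i, j) \<Rightarrow> restrict (\<lambda>t. (row_pos t, if row_pos t then i (snd (snd t)) else j (snd (snd t)))) ?P) = x"
      unfolding prod.case
    proof
      fix t
      show "restrict (\<lambda>t. (row_pos t, if row_pos t then restrict (?i x) {..<l} (snd (snd t)) else restrict (?j x) {..<l} (snd (snd t)))) ?P t = x t"
      proof (cases "t \<in> ?P")
        case True
        then obtain \<tau> k where tk: "t = (c, \<tau>, k)" "k < l" by (auto simp: positions_def)
        then show ?thesis using True mem(1)[OF tk(2), of \<tau>] unfolding tk(1)
          by (cases \<tau>) (simp_all add: prod_eq_iff)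
      next
        case False
        then show ?thesis using PiE_arb[OF x False] by simp
      qed
    qed
  qed
  finally show ?thesis .
qed

text \<open>Each function depends only on its own coordinates and can therefore be evaluated at the
  joint labelling.\<close>

lemma sum_PiE_Un:
  fixes f g :: "('a \<Rightarrow> 'b) \<Rightarrow> real"
  assumes dis: "A \<inter> B = {}"
    and f: "\<And>x y. (\<And>t. t \<in> A \<Longrightarrow> x t = y t) \<Longrightarrow> f x = f y"
    and g: "\<And>x y. (\<And>t. t \<in> B \<Longrightarrow> x t = y t) \<Longrightarrow> g x = g y"
  shows "(\<Sum>x\<in>PiE A F. f x) * (\<Sum>y\<in>PiE B F. g y) = (\<Sum>z\<in>PiE (A \<union> B) F. f z * g z)"
proof -
  have "(\<Sum>x\<in>PiE A F. f x) * (\<Sum>y\<in>PiE B F. g y) = (\<Sum>(x, y)\<in>PiE A F \<times> PiE B F. f x * g y)"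
    by (simp add: sum_product sum.cartesian_product)
  also have "\<dots> = (\<Sum>z\<in>PiE (A \<union> B) F. f z * g z)"
  proof (rule sum.reindex_bij_witness[where i="\<lambda>z. (restrict z A, restrict z B)"
        and j="\<lambda>(x, y). (\<lambda>t. if t \<in> A then x t else y t)"])
    fix q assume "q \<in> PiE A F \<times> PiE B F"
    then obtain x y where q: "q = (x, y)" and x: "x \<in> PiE A F" and y: "y \<in> PiE B F" by auto
    define z where "z = (\<lambda>t. if t \<in> A then x t else y t)"
    have z: "(case q of (x, y) \<Rightarrow> \<lambda>t. if t \<in> A then x t else y t) = z" by (simp add: q z_def)
    have zA: "z t = x t" if "t \<in> A" for t using that by (simp add: z_def)
    have zB: "z t = y t" if "t \<in> B" for t using that dis by (auto simp: z_def)
    have "restrict z A = x" using zA PiE_arb[OF x] by (intro HOL.ext) (simp add: restrict_def)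
    moreover have "restrict z B = y" using zB PiE_arb[OF y] by (intro HOL.ext) (simp add: restrict_def)
    ultimately show "(restrict (case q of (x, y) \<Rightarrow> \<lambda>t. if t \<in> A then x t else y t) A,
        restrict (case q of (x, y) \<Rightarrow> \<lambda>t. if t \<in> A then x t else y t) B) = q" unfolding z by (simp add: q)
    show "(case q of (x, y) \<Rightarrow> \<lambda>t. if t \<in> A then x t else y t) \<in> PiE (A \<union> B) F" unfolding z
      using zA zB PiE_mem[OF x] PiE_mem[OF y] PiE_arb[OF x] PiE_arb[OF y]
      by (intro PiE_I) (auto simp: z_def)
    show "f (case q of (x, y) \<Rightarrow> \<lambda>t. if t \<in> A then x t else y t) * g (case q of (x, y) \<Rightarrow> \<lambda>t. if t \<in> A then x t else y t)
       = (case q of (x, y) \<Rightarrow> f x * g y)"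
      unfolding z unfolding q prod.case using f[of z x, OF zA] g[of z y, OF zB] by simp
  next
    fix z assume z: "z \<in> PiE (A \<union> B) F"
    show "(restrict z A, restrict z B) \<in> PiE A F \<times> PiE B F" using z by auto
    show "(case (restrict z A, restrict z B) of (x, y) \<Rightarrow> \<lambda>t. if t \<in> A then x t else y t) = z"
      unfolding prod.case using PiE_arb[OF z] by (intro HOL.ext) auto
  qed
  finally show ?thesis .
qed

text \<open>The ends of an edge have different tags, so the unordered pair determines which of them
  is the row.\<close>

lemma matrix_index_eq_iff:
  assumes x: "x \<in> PiE P (\<lambda>t. matrix_labels p n (row_pos t))"
    and "t \<in> P" "u \<in> P" "walk_next l1 l2 t \<in> P" "walk_next l1 l2 u \<in> P"
  shows "matrix_index (walk_next l1 l2) x t = matrix_index (walk_next l1 l2) x u \<longleftrightarrow>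
    edge (walk_next l1 l2) x t = edge (walk_next l1 l2) x u"
proof -
  have lab: "fst (x v) = row_pos v" if "v \<in> P" for v
    using PiE_mem[OF x that] by (auto simp: matrix_labels_def)
  have row: "row_pos (walk_next l1 l2 v) = (\<not> row_pos v)" for v by (cases v) simp
  have eta: "\<exists>a. x v = (row_pos v, a)" if "v \<in> P" for v using lab[OF that] by (cases "x v") simp
  obtain a b c d where "x t = (row_pos t, a)" "x u = (row_pos u, b)"
    "x (walk_next l1 l2 t) = (\<not> row_pos t, c)" "x (walk_next l1 l2 u) = (\<not> row_pos u, d)"
    using eta[OF assms(2)] eta[OF assms(3)] eta[OF assms(4)] eta[OF assms(5)] unfolding row by blast
  then show ?thesis
    unfolding matrix_index_def edge_def
    by (cases "row_pos t"; cases "row_pos u") (auto simp: doubleton_eq_iff)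
qed

section \<open>Moments of monomials in the entries\<close>

text \<open>Domination by the highest assumed moment makes all lower ones finite.\<close>

lemma abs_power_le_one_plus:
  fixes y :: real
  assumes "k \<le> 2 * L"
  shows "\<bar>y ^ k\<bar> \<le> 1 + y ^ (2 * L)"
proof (cases "\<bar>y\<bar> \<le> 1")
  case True
  then have "\<bar>y ^ k\<bar> \<le> 1" by (simp add: power_abs power_le_one)
  then show ?thesis using zero_le_even_power'[of y L] by linarith
next
  case False
  then have "\<bar>y\<bar> ^ k \<le> \<bar>y\<bar> ^ (2 * L)" using assms by (intro power_increasing) auto
  then show ?thesis by (simp add: power_abs[symmetric] zero_le_even_power)
qed

lemma (in prob_space) iid_moments:
  fixes Y :: "nat \<Rightarrow> nat \<Rightarrow> 'a \<Rightarrow> real"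
  assumes meas: "\<And>i j. Y i j \<in> borel_measurable M"
    and dist: "\<And>i j. distr M borel (Y i j) = distr M borel (Y 0 0)"
    and int: "integrable M (\<lambda>x. Y 0 0 x ^ (2 * L))" and k: "k \<le> 2 * L"
  shows "integrable M (\<lambda>x. Y i j x ^ k)"
    and "(\<integral>x. Y i j x ^ k \<partial>M) = (\<integral>x. Y 0 0 x ^ k \<partial>M)"
proof -
  have i0: "integrable M (\<lambda>x. Y 0 0 x ^ k)"
  proof (rule Bochner_Integration.integrable_bound)
    show "integrable M (\<lambda>x. 1 + Y 0 0 x ^ (2 * L))" using int by simp
    show "(\<lambda>x. Y 0 0 x ^ k) \<in> borel_measurable M" using meas by measurable
    show "AE x in M. norm (Y 0 0 x ^ k) \<le> norm (1 + Y 0 0 x ^ (2 * L))"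
      using abs_power_le_one_plus[OF k] by (intro AE_I2) (simp add: order_trans[OF _ abs_ge_self])
  qed
  have pw: "(\<lambda>y :: real. y ^ k) \<in> borel_measurable borel" by measurable
  have e: "integrable (distr M borel (Y i j)) (\<lambda>y. y ^ k) \<longleftrightarrow> integrable M (\<lambda>x. Y i j x ^ k)" for i j
    by (rule integrable_distr_eq[OF meas pw])
  show "integrable M (\<lambda>x. Y i j x ^ k)" using e[of i j] e[of 0 0] i0 dist by metis
  have f: "integral\<^sup>L (distr M borel (Y i j)) (\<lambda>y. y ^ k) = (\<integral>x. Y i j x ^ k \<partial>M)" for i j
    by (rule integral_distr[OF meas pw])
  show "(\<integral>x. Y i j x ^ k \<partial>M) = (\<integral>x. Y 0 0 x ^ k \<partial>M)" using f[of i j] f[of 0 0] dist by metis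
qed

text \<open>Equal indices are collected into powers, and powers of distinct entries are
  independent.\<close>

lemma (in prob_space) expectation_monomial:
  fixes Y :: "nat \<Rightarrow> nat \<Rightarrow> 'a \<Rightarrow> real"
  assumes meas: "\<And>i j. Y i j \<in> borel_measurable M"
    and ind: "indep_vars (\<lambda>_. borel) (\<lambda>(i, j). Y i j) UNIV"
    and dist: "\<And>i j. distr M borel (Y i j) = distr M borel (Y 0 0)"
    and int: "integrable M (\<lambda>x. Y 0 0 x ^ (2 * L))"
    and Q: "finite Q" "card Q \<le> 2 * L"
  shows "integrable M (\<lambda>w. \<Prod>t\<in>Q. case_prod (\<lambda>i j. Y i j w) (e t))"
    and "(\<integral>w. (\<Prod>t\<in>Q. case_prod (\<lambda>i j. Y i j w) (e t)) \<partial>M) = multi_moment (\<lambda>k. \<integral>x. Y 0 0 x ^ k \<partial>M) Q e"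
proof -
  let ?m = "\<lambda>z. card {t \<in> Q. e t = z}"
  let ?Z = "\<lambda>z x. (case z of (i, j) \<Rightarrow> Y i j) x ^ ?m z"
  have reg: "(\<Prod>t\<in>Q. case_prod (\<lambda>i j. Y i j w) (e t)) = (\<Prod>z\<in>e ` Q. ?Z z w)" for w
  proof -
    have "(\<Prod>t\<in>Q. case_prod (\<lambda>i j. Y i j w) (e t))
        = (\<Prod>z\<in>e ` Q. \<Prod>t\<in>{t \<in> Q. e t = z}. case_prod (\<lambda>i j. Y i j w) (e t))"
      by (rule prod.image_gen[OF Q(1)])
    also have "\<dots> = (\<Prod>z\<in>e ` Q. ?Z z w)"
    proof (rule prod.cong[OF refl])
      fix z
      have "(\<Prod>t\<in>{t \<in> Q. e t = z}. case_prod (\<lambda>i j. Y i j w) (e t))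
          = (\<Prod>t\<in>{t \<in> Q. e t = z}. case_prod (\<lambda>i j. Y i j w) z)"
        by (rule prod.cong) auto
      then show "(\<Prod>t\<in>{t \<in> Q. e t = z}. case_prod (\<lambda>i j. Y i j w) (e t)) = ?Z z w"
        by (simp add: case_prod_beta)
    qed
    finally show ?thesis .
  qed
  have mle: "?m z \<le> 2 * L" for z
  proof -
    have "?m z \<le> card Q" by (rule card_mono) (use Q in auto)
    then show ?thesis using Q(2) by simp
  qed
  have "indep_vars (\<lambda>_. borel) (\<lambda>z x. (\<lambda>y. y ^ ?m z) ((case z of (i, j) \<Rightarrow> Y i j) x)) UNIV"
    by (rule indep_vars_compose2[OF ind]) measurable
  then have iv: "indep_vars (\<lambda>_. borel) ?Z (e ` Q)" by (rule indep_vars_subset) simp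
  have fin: "finite (e ` Q)" using Q by simp
  have integ: "integrable M (?Z z)" for z
    using iid_moments(1)[where Y=Y, OF meas dist int mle[of z], of "fst z" "snd z"] by (simp add: case_prod_beta)
  show "integrable M (\<lambda>w. \<Prod>t\<in>Q. case_prod (\<lambda>i j. Y i j w) (e t))"
    unfolding reg by (rule indep_vars_integrable[OF fin iv integ])
  have "(\<integral>w. (\<Prod>t\<in>Q. case_prod (\<lambda>i j. Y i j w) (e t)) \<partial>M) = (\<Prod>z\<in>e ` Q. \<integral>w. ?Z z w \<partial>M)"
    unfolding reg by (rule indep_vars_lebesgue_integral[OF fin iv integ])
  also have "\<dots> = (\<Prod>z\<in>e ` Q. \<integral>x. Y 0 0 x ^ ?m z \<partial>M)"
    using iid_moments(2)[where Y=Y, OF meas dist int mle] by (intro prod.cong refl) (simp add: case_prod_beta)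
  finally show "(\<integral>w. (\<Prod>t\<in>Q. case_prod (\<lambda>i j. Y i j w) (e t)) \<partial>M) = multi_moment (\<lambda>k. \<integral>x. Y 0 0 x ^ k \<partial>M) Q e"
    by (simp add: multi_moment_def)
qed

text \<open>The product of the two expectations is also written as a sum over joint labellings, so
  that the two terms of the covariance can be subtracted labelling by labelling.\<close>

lemma (in prob_space) covar_trace_eq_sum:
  fixes Y :: "nat \<Rightarrow> nat \<Rightarrow> 'a \<Rightarrow> real"
  assumes meas: "\<And>i j. Y i j \<in> borel_measurable M"
    and ind: "indep_vars (\<lambda>_. borel) (\<lambda>(i, j). Y i j) UNIV"
    and dist: "\<And>i j. distr M borel (Y i j) = distr M borel (Y 0 0)"
    and int: "integrable M (\<lambda>x. Y 0 0 x ^ (2 * (l1 + l2)))"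
    and l: "l1 \<ge> 1" "l2 \<ge> 1"
  shows "covar M (\<lambda>w. mtrace (Smat Y p n w ^\<^sub>m l1)) (\<lambda>w. mtrace (Smat Y p n w ^\<^sub>m l2))
    = (1 / real n) ^ (l1 + l2) *
      (\<Sum>x\<in>PiE (positions True l1 \<union> positions False l2) (\<lambda>t. matrix_labels p n (row_pos t)).
        cov_weight (\<lambda>k. \<integral>x. Y 0 0 x ^ k \<partial>M) (walk_next l1 l2) (positions True l1) (positions False l2) x)"
proof -
  let ?s = "walk_next l1 l2" and ?P1 = "positions True l1" and ?P2 = "positions False l2"
  let ?\<mu> = "\<lambda>k. \<integral>x. Y 0 0 x ^ k \<partial>M"
  interpret two_cycles_loc ?s ?P1 ?P2 row_pos by unfold_locales (rule two_cycles_walk[OF l])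
  let ?F = "\<lambda>t. matrix_labels p n (row_pos t)"
  let ?X = "\<lambda>Q. PiE Q ?F"
  let ?G = "\<lambda>Q x w. \<Prod>t\<in>Q. case_prod (\<lambda>i j. Y i j w) (matrix_index ?s x t)"
  let ?E = "\<lambda>Q x. multi_moment ?\<mu> Q (matrix_index ?s x)"
  have finP: "finite P" using fin by simp
  have U: "mtrace (Smat Y p n w ^\<^sub>m l1) = (1 / real n) ^ l1 * (\<Sum>x\<in>?X ?P1. ?G ?P1 x w)" for w
    unfolding mtrace_Smat_pow[OF l(1)]
    using sum_walks[of l1 True l1 l2 "\<lambda>i j. Y i j w" n p] l by simp
  have V: "mtrace (Smat Y p n w ^\<^sub>m l2) = (1 / real n) ^ l2 * (\<Sum>x\<in>?X ?P2. ?G ?P2 x w)" for w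
    unfolding mtrace_Smat_pow[OF l(2)]
    using sum_walks[of l2 False l1 l2 "\<lambda>i j. Y i j w" n p] l by simp
  have mi: "matrix_index ?s x t = matrix_index ?s y t"
    if "\<And>t. t \<in> Q \<Longrightarrow> x t = y t" "t \<in> Q" "?s t \<in> Q" for Q x y t
    using that by (simp add: matrix_index_def)
  have Gdep: "?G ?P1 x w = ?G ?P1 y w" if "\<And>t. t \<in> ?P1 \<Longrightarrow> x t = y t" for x y w
    by (rule prod.cong[OF refl]) (simp add: mi[OF that] s_in(1))
  have Gdep2: "?G ?P2 x w = ?G ?P2 y w" if "\<And>t. t \<in> ?P2 \<Longrightarrow> x t = y t" for x y w
    by (rule prod.cong[OF refl]) (simp add: mi[OF that] s_in(2))
  have Edep: "?E ?P1 x = ?E ?P1 y" if "\<And>t. t \<in> ?P1 \<Longrightarrow> x t = y t" for x y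
    by (rule multi_moment_cong) (simp add: mi[OF that] s_in(1))
  have Edep2: "?E ?P2 x = ?E ?P2 y" if "\<And>t. t \<in> ?P2 \<Longrightarrow> x t = y t" for x y
    by (rule multi_moment_cong) (simp add: mi[OF that] s_in(2))
  have cards: "card ?P1 \<le> 2 * (l1 + l2)" "card ?P2 \<le> 2 * (l1 + l2)" "card P \<le> 2 * (l1 + l2)"
    using card_Un_le[of ?P1 ?P2] by (simp_all add: card_positions)
  note ex = expectation_monomial[where Y=Y, OF meas ind dist int]
  have prodG: "(\<Sum>x\<in>?X ?P1. ?G ?P1 x w) * (\<Sum>x\<in>?X ?P2. ?G ?P2 x w) = (\<Sum>z\<in>?X P. ?G P z w)" for w
  proof -
    have "(\<Sum>x\<in>?X ?P1. ?G ?P1 x w) * (\<Sum>x\<in>?X ?P2. ?G ?P2 x w) = (\<Sum>z\<in>?X P. ?G ?P1 z w * ?G ?P2 z w)"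
      by (rule sum_PiE_Un[OF dis Gdep Gdep2])
    also have "\<dots> = (\<Sum>z\<in>?X P. ?G P z w)"
      by (rule sum.cong[OF refl]) (rule prod.union_disjoint[OF fin dis, symmetric])
    finally show ?thesis .
  qed
  have EU: "(\<integral>w. mtrace (Smat Y p n w ^\<^sub>m l1) \<partial>M) = (1 / real n) ^ l1 * (\<Sum>x\<in>?X ?P1. ?E ?P1 x)"
    unfolding U by (simp add: Bochner_Integration.integral_sum ex[OF fin(1) cards(1)])
  have EV: "(\<integral>w. mtrace (Smat Y p n w ^\<^sub>m l2) \<partial>M) = (1 / real n) ^ l2 * (\<Sum>x\<in>?X ?P2. ?E ?P2 x)"
    unfolding V by (simp add: Bochner_Integration.integral_sum ex[OF fin(2) cards(2)])
  have "mtrace (Smat Y p n w ^\<^sub>m l1) * mtrace (Smat Y p n w ^\<^sub>m l2)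
      = (1 / real n) ^ (l1 + l2) * (\<Sum>z\<in>?X P. ?G P z w)" for w
    unfolding U V prodG[symmetric] by (simp add: power_add mult_ac)
  then have EUV: "(\<integral>w. mtrace (Smat Y p n w ^\<^sub>m l1) * mtrace (Smat Y p n w ^\<^sub>m l2) \<partial>M)
      = (1 / real n) ^ (l1 + l2) * (\<Sum>z\<in>?X P. ?E P z)"
    by (simp add: Bochner_Integration.integral_sum ex[OF finP cards(3)])
  have "(\<Sum>x\<in>?X ?P1. ?E ?P1 x) * (\<Sum>x\<in>?X ?P2. ?E ?P2 x) = (\<Sum>z\<in>?X P. ?E ?P1 z * ?E ?P2 z)"
    by (rule sum_PiE_Un[OF dis Edep Edep2])
  then have "covar M (\<lambda>w. mtrace (Smat Y p n w ^\<^sub>m l1)) (\<lambda>w. mtrace (Smat Y p n w ^\<^sub>m l2))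
    = (1 / real n) ^ (l1 + l2) * (\<Sum>z\<in>?X P. ?E P z - ?E ?P1 z * ?E ?P2 z)"
    unfolding covar_def EUV EU EV by (simp add: sum_subtractf power_add right_diff_distrib mult_ac)
  also have "(\<Sum>z\<in>?X P. ?E P z - ?E ?P1 z * ?E ?P2 z) = (\<Sum>z\<in>?X P. cov_weight ?\<mu> ?s ?P1 ?P2 z)"
  proof (rule sum.cong[OF refl])
    fix z assume z: "z \<in> ?X P"
    have "?E Q z = multi_moment ?\<mu> Q (edge ?s z)" if "Q \<subseteq> P" for Q
      by (rule multi_moment_kernel, rule matrix_index_eq_iff[OF z]) (use that s_in(3) in blast)+
    then show "?E P z - ?E ?P1 z * ?E ?P2 z = cov_weight ?\<mu> ?s ?P1 ?P2 z"
      unfolding cov_weight_def by simp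
  qed
  finally show ?thesis .
qed

section \<open>Bounds for the error term\<close>

text \<open>Because \<open>A \<ge> 1\<close>, the number of distinct edges in the exponent may be
  replaced by \<open>card Q\<close>.\<close>

lemma abs_multi_moment_le:
  assumes "finite Q" "\<And>k. k \<le> card Q \<Longrightarrow> \<bar>\<mu> k\<bar> \<le> A" "A \<ge> 1"
  shows "\<bar>multi_moment \<mu> Q E\<bar> \<le> A ^ card Q"
proof -
  have "\<bar>multi_moment \<mu> Q E\<bar> = (\<Prod>e\<in>E ` Q. \<bar>\<mu> (card {t \<in> Q. E t = e})\<bar>)"
    by (simp add: multi_moment_def abs_prod)
  also have "\<dots> \<le> (\<Prod>e\<in>E ` Q. A)"
    using assms by (intro prod_mono) (auto intro!: assms(2) card_mono)
  also have "\<dots> = A ^ card (E ` Q)" by simp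
  also have "\<dots> \<le> A ^ card Q" using assms by (intro power_increasing card_image_le)
  finally show ?thesis .
qed

text \<open>Choose the sets of labels in use, then at each position one of at most \<open>D\<close>
  labels. The sizes of the label sets thus enter only with the powers \<open>bc\<close>, which fixes
  the order of the error.\<close>

lemma card_labellings_le:
  assumes "finite P" "\<And>\<tau>. finite (Lab \<tau>)" "bc True \<le> D" "bc False \<le> D"
  shows "card (labellings Lab s P ty U bc) \<le> card (Lab True) ^ bc True * card (Lab False) ^ bc False * D ^ card P"
proof -
  let ?S = "\<lambda>\<tau>. {S. S \<subseteq> Lab \<tau> \<and> card S = bc \<tau>}"
  let ?V = "\<lambda>(S, S'). PiE P (\<lambda>t. if ty t then S else S')"
  have finS: "finite (?S \<tau>)" for \<tau> using assms(2) by simp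
  have cS: "card (?S \<tau>) \<le> card (Lab \<tau>) ^ bc \<tau>" for \<tau>
    unfolding n_subsets[OF assms(2)]
    by (cases "bc \<tau> \<le> card (Lab \<tau>)") (simp_all add: binomial_le_pow binomial_eq_0)
  have "labellings Lab s P ty U bc \<subseteq> (\<Union>z\<in>?S True \<times> ?S False. ?V z)"
  proof
    fix x assume x: "x \<in> labellings Lab s P ty U bc"
    then have xP: "x \<in> PiE P (\<lambda>t. Lab (ty t))" and c: "\<And>\<tau>. card (x ` P \<inter> Lab \<tau>) = bc \<tau>"
      by (auto simp: labellings_def)
    have "x \<in> ?V (x ` P \<inter> Lab True, x ` P \<inter> Lab False)"
      unfolding prod.case
    proof (rule PiE_I)
      fix t assume t: "t \<in> P"
      have "x t \<in> Lab (ty t)" by (rule PiE_mem[OF xP t])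
      then show "x t \<in> (if ty t then x ` P \<inter> Lab True else x ` P \<inter> Lab False)"
        using t by (cases "ty t") auto
    qed (rule PiE_arb[OF xP])
    then show "x \<in> (\<Union>z\<in>?S True \<times> ?S False. ?V z)" using c by blast
  qed
  moreover have fV: "finite (?V z)" if zS: "z \<in> ?S True \<times> ?S False" for z
  proof -
    obtain S S' where z: "z = (S, S')" "S \<subseteq> Lab True" "S' \<subseteq> Lab False" using zS by auto
    have "finite S" "finite S'" using z assms(2) finite_subset by blast+
    then show ?thesis unfolding z(1) prod.case using assms(1) by (intro finite_PiE) auto
  qed
  ultimately have "card (labellings Lab s P ty U bc) \<le> card (\<Union>z\<in>?S True \<times> ?S False. ?V z)"
    using finS by (intro card_mono finite_UN_I finite_cartesian_product) auto
  also have "\<dots> \<le> (\<Sum>z\<in>?S True \<times> ?S False. card (?V z))"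
    by (rule card_UN_le) (use finS in auto)
  also have "\<dots> \<le> (\<Sum>z\<in>?S True \<times> ?S False. D ^ card P)"
  proof (rule sum_mono)
    fix z assume "z \<in> ?S True \<times> ?S False"
    then obtain S S' where z: "z = (S, S')" "card S = bc True" "card S' = bc False" by auto
    have "card (?V z) = (\<Prod>t\<in>P. card (if ty t then S else S'))"
      unfolding z(1) prod.case by (rule card_PiE[OF assms(1)])
    also have "\<dots> \<le> (\<Prod>t\<in>P. D)" by (rule prod_mono) (use z assms in auto)
    finally show "card (?V z) \<le> D ^ card P" by simp
  qed
  also have "\<dots> = card (?S True) * card (?S False) * D ^ card P" by (simp add: card_cartesian_product)
  also have "\<dots> \<le> card (Lab True) ^ bc True * card (Lab False) ^ bc False * D ^ card P"
    by (intro mult_mono cS) auto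
  finally show ?thesis .
qed

text \<open>After division by \<open>B\<close> all factors have modulus at most one, and the
  difference of the products is at most the sum of the differences of the factors, each
  \<open>b / B\<close>.\<close>

lemma falling_factorial_shift_bound:
  fixes n b m L :: nat
  assumes "1 \<le> n" "b \<le> n" "b + m \<le> L"
  shows "\<bar>(\<Prod>i<m. real n - real i) - (\<Prod>i<m. real (n - b) - real i)\<bar> * real n
    \<le> real L * real L * (real L + 1) ^ L * real n ^ m"
proof -
  \<comment> \<open>For small \<open>n\<close> a factor may be negative; \<open>B\<close> is at
    least \<open>n + L\<close> and so still bounds its absolute value.\<close>
  define B where "B = (real L + 1) * real n"
  have n1: "real n \<ge> 1" using assms by simp
  have B: "B > 0" "B \<ge> real n" "B \<ge> real n + real L"
  proof -
    have "real L * 1 \<le> real L * real n" using n1 by (intro mult_left_mono) auto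
    then show "B \<ge> real n + real L" by (simp add: B_def algebra_simps)
    then show "B > 0" "B \<ge> real n" using n1 by auto
  qed
  let ?z = "\<lambda>i. (real n - real i) / B" and ?w = "\<lambda>i. (real (n - b) - real i) / B"
  have nb: "real (n - b) = real n - real b" using assms by (simp add: of_nat_diff)
  have "norm ((\<Prod>i<m. ?z i) - (\<Prod>i<m. ?w i)) \<le> (\<Sum>i<m. norm (?z i - ?w i))"
  proof (rule norm_prod_diff)
    fix i assume "i \<in> {..<m}"
    then have i: "real i \<le> real L" "real i + real b \<le> real L" using assms by auto
    have "\<bar>real n - real i\<bar> \<le> B" using i B n1 by linarith
    then show "norm (?z i) \<le> 1" using B(1) by (simp add: field_simps)
    have "\<bar>real (n - b) - real i\<bar> \<le> B" using i B n1 nb by linarith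
    then show "norm (?w i) \<le> 1" using B(1) by (simp add: field_simps)
  qed
  also have "\<dots> = (\<Sum>i<m. real b / B)"
    using B(1) by (intro sum.cong refl) (simp add: diff_divide_distrib[symmetric] nb)
  also have "\<dots> = real m * (real b / B)" by simp
  finally have 1: "\<bar>(\<Prod>i<m. ?z i) - (\<Prod>i<m. ?w i)\<bar> \<le> real m * (real b / B)" by simp
  have "(\<Prod>i<m. ?z i) - (\<Prod>i<m. ?w i)
      = ((\<Prod>i<m. real n - real i) - (\<Prod>i<m. real (n - b) - real i)) / B ^ m"
    by (simp only: prod_dividef prod_constant card_lessThan diff_divide_distrib[symmetric])
  with 1 have 2: "\<bar>(\<Prod>i<m. real n - real i) - (\<Prod>i<m. real (n - b) - real i)\<bar> \<le> real m * (real b / B) * B ^ m"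
    using B(1) by (simp add: field_simps)
  have "\<bar>(\<Prod>i<m. real n - real i) - (\<Prod>i<m. real (n - b) - real i)\<bar> * real n
      \<le> real m * (real b / B) * B ^ m * real n"
    by (rule mult_right_mono[OF 2]) simp
  also have "\<dots> = real m * real b * B ^ m * (real n / B)" by simp
  also have "\<dots> \<le> real m * real b * B ^ m * 1"
    using B by (intro mult_left_mono) (auto simp: field_simps)
  also have "\<dots> = real m * real b * (real L + 1) ^ m * real n ^ m"
    by (simp add: B_def power_mult_distrib)
  also have "\<dots> \<le> real L * real L * (real L + 1) ^ L * real n ^ m"
    using assms by (intro mult_mono power_increasing) auto
  finally show ?thesis .
qed

lemma falling_factorial_binomial:
  "(\<Prod>i<k. real n - real i) = fact k * real (n choose k)"
  by (simp add: binomial_gbinomial gbinomial_mult_fact atLeast0LessThan)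

section \<open>The covariance expansion\<close>

lemma card_row_positions:
  "card {t \<in> positions True l1 \<union> positions False l2. row_pos t = \<tau>} = l1 + l2"
proof -
  have "{t \<in> positions True l1 \<union> positions False l2. row_pos t = \<tau>}
      = {True} \<times> {\<tau>} \<times> {..<l1} \<union> {False} \<times> {\<tau>} \<times> {..<l2}"
    by (auto simp: positions_def)
  also have "card \<dots> = l1 + l2"
    by (subst card_Un_disjoint) (auto simp: card_cartesian_product)
  finally show ?thesis .
qed

text \<open>Since \<open>l1 \<ge> 1\<close> some row is visited, so \<open>b\<close> starts at 1;
  the upper limits are the number of positions of a type and, for rows, also
  \<open>p\<close>.\<close>

lemma sum_labellings_by_counts:
  fixes w :: "(bool \<times> bool \<times> nat \<Rightarrow> bool \<times> nat) \<Rightarrow> real" and l1 l2 p n :: nat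
  assumes l: "l1 \<ge> 1"
  defines "P \<equiv> positions True l1 \<union> positions False l2"
  shows "(\<Sum>x\<in>PiE P (\<lambda>t. matrix_labels p n (row_pos t)). w x) =
    (\<Sum>b=1..min (l1 + l2) p. \<Sum>c=0..l1 + l2.
       \<Sum>x\<in>labellings (matrix_labels p n) s P row_pos {} (\<lambda>\<tau>. if \<tau> then b else c). w x)"
proof -
  let ?X = "PiE P (\<lambda>t. matrix_labels p n (row_pos t))"
  let ?n = "\<lambda>x \<tau>. card (x ` P \<inter> matrix_labels p n \<tau>)"
  let ?T = "{1..min (l1 + l2) p} \<times> {0..l1 + l2}"
  have finP: "finite P" by (simp add: P_def positions_def)
  have finL: "finite (matrix_labels p n \<tau>)" for \<tau> by (simp add: matrix_labels_def)
  have finX: "finite ?X" using finP finL by (intro finite_PiE) auto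
  have le: "?n x \<tau> \<le> l1 + l2" if x: "x \<in> ?X" for x \<tau>
  proof -
    have "x ` P \<inter> matrix_labels p n \<tau> \<subseteq> x ` {t \<in> P. row_pos t = \<tau>}"
    proof
      fix v assume "v \<in> x ` P \<inter> matrix_labels p n \<tau>"
      then obtain t where t: "t \<in> P" "v = x t" "x t \<in> matrix_labels p n \<tau>" by auto
      have "x t \<in> matrix_labels p n (row_pos t)" by (rule PiE_mem[OF x t(1)])
      then have "row_pos t = \<tau>" using t(3) by (auto simp: matrix_labels_def)
      then show "v \<in> x ` {t \<in> P. row_pos t = \<tau>}" using t by blast
    qed
    then have "?n x \<tau> \<le> card (x ` {t \<in> P. row_pos t = \<tau>})" using finP by (intro card_mono) auto
    also have "\<dots> \<le> card {t \<in> P. row_pos t = \<tau>}" using finP by (intro card_image_le) auto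
    also have "\<dots> = l1 + l2" unfolding P_def by (rule card_row_positions)
    finally show ?thesis .
  qed
  have leL: "?n x True \<le> p" for x
  proof -
    have "?n x True \<le> card (matrix_labels p n True)" by (rule card_mono[OF finL]) auto
    then show ?thesis by (simp add: matrix_labels_def card_cartesian_product)
  qed
  have ge1: "?n x True \<ge> 1" if x: "x \<in> ?X" for x
  proof -
    have t: "(True, True, 0) \<in> P" using l by (simp add: P_def positions_def)
    have "x (True, True, 0) \<in> matrix_labels p n True" using PiE_mem[OF x t] by simp
    then have "x ` P \<inter> matrix_labels p n True \<noteq> {}" using t by blast
    then have "?n x True \<noteq> 0" using finP by simp
    then show ?thesis by simp
  qed
  have "(\<Sum>x\<in>?X. w x) = (\<Sum>q\<in>?T. \<Sum>x\<in>{x \<in> ?X. (?n x True, ?n x False) = q}. w x)"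
    by (rule sum.group[symmetric]) (use finX le leL ge1 in auto)
  also have "\<dots> = (\<Sum>(b, c)\<in>?T. \<Sum>x\<in>labellings (matrix_labels p n) s P row_pos {} (\<lambda>\<tau>. if \<tau> then b else c). w x)"
  proof (rule sum.cong[OF refl])
    fix q assume "q \<in> ?T"
    obtain b c where q: "q = (b, c)" by (cases q)
    have "{x \<in> ?X. (?n x True, ?n x False) = q}
        = labellings (matrix_labels p n) s P row_pos {} (\<lambda>\<tau>. if \<tau> then b else c)"
      unfolding labellings_def q by (auto simp: all_bool_eq)
    then show "(\<Sum>x\<in>{x \<in> ?X. (?n x True, ?n x False) = q}. w x)
       = (case q of (b, c) \<Rightarrow> \<Sum>x\<in>labellings (matrix_labels p n) s P row_pos {} (\<lambda>\<tau>. if \<tau> then b else c). w x)"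
      unfolding q by simp
  qed
  also have "\<dots> = (\<Sum>b=1..min (l1 + l2) p. \<Sum>c=0..l1 + l2.
       \<Sum>x\<in>labellings (matrix_labels p n) s P row_pos {} (\<lambda>\<tau>. if \<tau> then b else c). w x)"
    by (rule sum.cartesian_product[symmetric])
  finally show ?thesis .
qed

theorem theorem2:
  fixes M :: "'w measure" and Y :: "nat \<Rightarrow> nat \<Rightarrow> 'w \<Rightarrow> real" and l1 l2 :: nat
  assumes "prob_space M"
    and "\<And>i j. Y i j \<in> borel_measurable M"
    and "prob_space.indep_vars M (\<lambda>_. borel) (\<lambda>(i, j). Y i j) UNIV"
    and "\<And>i j. distr M borel (Y i j) = distr M borel (Y 0 0)"
    and "(\<integral>x. Y 0 0 x \<partial>M) = 0"
    and "(\<integral>x. (Y 0 0 x)^2 \<partial>M) = 1"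
    and "l1 \<ge> 1" and "l2 \<ge> 1"
    and "integrable M (\<lambda>x. (Y 0 0 x) ^ (2 * l1 + 2 * l2))"
  shows "\<exists>K. \<forall>p n. 1 \<le> p \<and> p \<le> n \<longrightarrow>
     (\<exists>e :: nat \<Rightarrow> real.
        (\<forall>b. \<bar>e b\<bar> \<le> K * real p ^ b / real n ^ (b + 1)) \<and>
        covar M (\<lambda>w. mtrace (Smat Y p n w ^\<^sub>m l1)) (\<lambda>w. mtrace (Smat Y p n w ^\<^sub>m l2))
        = (\<Sum>b = 1..min (l1 + l2) p.
             real (p choose b) * real ((n - b) choose (l1 + l2 - b)) / real n ^ (l1 + l2)
               * (Ccoef l1 l2 b + ((\<integral>x. (Y 0 0 x)^4 \<partial>M) - 3) * Dcoef l1 l2 b)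
             + e b))"
proof -
  interpret prob_space M by fact
  define L where "L = l1 + l2"
  define \<mu> where "\<mu> = (\<lambda>k. \<integral>x. Y 0 0 x ^ k \<partial>M)"
  let ?s = "walk_next l1 l2" and ?P1 = "positions True l1" and ?P2 = "positions False l2"
  let ?P = "?P1 \<union> ?P2"
  let ?bc = "\<lambda>(b :: nat) (c :: nat) \<tau>. if \<tau> then b else c"
  let ?ff = "\<lambda>n k. \<Prod>i<k. real n - real i"
  have int: "integrable M (\<lambda>x. Y 0 0 x ^ (2 * (l1 + l2)))" using assms(9) by (simp add: distrib_left)
  have finP: "finite ?P1" "finite ?P2" "?P1 \<inter> ?P2 = {}" by (auto simp: positions_def)
  have cardP: "card ?P = 2 * L" using card_Un_disjoint[OF finP] by (simp add: card_positions L_def)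
  have lc: "labelled_cycles ?s ?P1 ?P2 row_pos (matrix_labels p n) \<mu>" for p n
    using two_cycles_walk[OF assms(7,8)] assms(5,6)
    by unfold_locales (auto simp: matrix_labels_def \<mu>_def)
  have cardLab: "card (matrix_labels p n \<tau>) = (if \<tau> then p else n)" for p n \<tau>
    by (simp add: matrix_labels_def card_cartesian_product)
  have finLab: "finite (matrix_labels p n \<tau>)" for p n \<tau> by (simp add: matrix_labels_def)

  \<comment> \<open>The part of the exact count that does not depend on \<open>p\<close> and
    \<open>n\<close>.\<close>
  define T where "T b = (\<Sum>r=1..l1 + l2. (2 * real r + (if r = 1 then \<mu> 4 - 3 else 0)) *
        real (card (closing_sets ?s ?P1 ?P2 row_pos {} (?bc b (L - b)) r)))" for b
  \<comment> \<open>The factorials in \<open>Ccoef\<close> and \<open>Dcoef\<close> are those that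
    turn the binomial coefficients of the statement into falling factorials.\<close>
  have T: "fact b * fact (L - b) * T b = Ccoef l1 l2 b + (\<mu> 4 - 3) * Dcoef l1 l2 b" if "b \<le> L" for b
  proof -
    have Tb: "T b = 2 * (\<Sum>k=0..b. real (l1 choose k) * real (l2 choose (b - k)) *
        (\<Sum>m=0..b-k. real m * real (l1 choose (k + m)) * real (l2 choose (b - m - k))))
     + (\<mu> 4 - 3) * (\<Sum>k\<in>{0..<b}. real (l1 choose k) * real (l1 choose (k + 1))
        * real (l2 choose (b - 1 - k)) * real (l2 choose (b - k)))"
      unfolding T_def by (rule leading_sum_eq) (use that in \<open>simp_all add: L_def\<close>)
    have ring: "f * g * (2 * C + d * D) = 2 * f * g * C + d * (f * g * D)" for f g C D d :: real
      by (simp add: algebra_simps)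
    show ?thesis unfolding Tb Ccoef_def Dcoef_def L_def by (rule ring)
  qed
  \<comment> \<open>A common bound for the moments that can occur; the summand 1 gives
    \<open>A \<ge> 1\<close>.\<close>
  define A where "A = 1 + (\<Sum>k\<le>2 * L. \<bar>\<mu> k\<bar>)"
  have A1: "A \<ge> 1" unfolding A_def by (simp add: sum_nonneg)
  have Amu: "\<bar>\<mu> k\<bar> \<le> A" if "k \<le> 2 * L" for k
  proof -
    have "\<bar>\<mu> k\<bar> \<le> (\<Sum>k\<le>2 * L. \<bar>\<mu> k\<bar>)" by (rule member_le_sum) (use that in auto)
    then show ?thesis by (simp add: A_def)
  qed
  have wt: "\<bar>cov_weight \<mu> ?s ?P1 ?P2 x\<bar> \<le> 2 * A ^ (2 * L)" for x :: "_ \<Rightarrow> bool \<times> nat"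
  proof -
    let ?E = "edge ?s x"
    have "\<bar>multi_moment \<mu> ?P ?E\<bar> \<le> A ^ card ?P"
      by (rule abs_multi_moment_le) (use finP A1 Amu cardP in auto)
    moreover have "\<bar>multi_moment \<mu> ?P1 ?E\<bar> \<le> A ^ card ?P1"
      by (rule abs_multi_moment_le) (use finP A1 Amu in \<open>auto simp: card_positions L_def\<close>)
    moreover have "\<bar>multi_moment \<mu> ?P2 ?E\<bar> \<le> A ^ card ?P2"
      by (rule abs_multi_moment_le) (use finP A1 Amu in \<open>auto simp: card_positions L_def\<close>)
    ultimately have "\<bar>multi_moment \<mu> ?P ?E\<bar> \<le> A ^ (2 * L)"
      "\<bar>multi_moment \<mu> ?P1 ?E\<bar> * \<bar>multi_moment \<mu> ?P2 ?E\<bar> \<le> A ^ (2 * l1) * A ^ (2 * l2)"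
      using A1 by (auto simp: cardP card_positions intro!: mult_mono)
    moreover have "A ^ (2 * l1) * A ^ (2 * l2) = A ^ (2 * L)"
      by (simp add: L_def power_add[symmetric] distrib_left)
    ultimately show ?thesis unfolding cov_weight_def
      using abs_triangle_ineq4[of "multi_moment \<mu> ?P ?E" "multi_moment \<mu> ?P1 ?E * multi_moment \<mu> ?P2 ?E"]
      by (simp add: abs_mult)
  qed
  \<comment> \<open>The weight bound times the number of ways to fill \<open>2 * L\<close>
    positions, each with one of at most \<open>L\<close> labels.\<close>
  define K1 where "K1 = 2 * A ^ (2 * L) * real L ^ (2 * L)"
  have K1: "K1 \<ge> 0" using A1 by (simp add: K1_def)
  define S where "S p n b c = cov_sum \<mu> (matrix_labels p n) ?s ?P1 ?P2 row_pos {} (?bc b c)" for p n b c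
  have S_bound: "\<bar>S p n b c\<bar> \<le> K1 * real p ^ b * real n ^ c" if "b \<le> L" "c \<le> L" for p n b c
  proof -
    let ?X = "labellings (matrix_labels p n) ?s ?P row_pos {} (?bc b c)"
    have "\<bar>S p n b c\<bar> \<le> (\<Sum>x\<in>?X. \<bar>cov_weight \<mu> ?s ?P1 ?P2 x\<bar>)"
      unfolding S_def cov_sum_def by (rule sum_abs)
    also have "\<dots> \<le> (\<Sum>x\<in>?X. 2 * A ^ (2 * L))" by (rule sum_mono) (rule wt)
    also have "\<dots> = real (card ?X) * (2 * A ^ (2 * L))" by simp
    also have "\<dots> \<le> real (p ^ b * n ^ c * L ^ (2 * L)) * (2 * A ^ (2 * L))"
    proof (rule mult_right_mono)
      have "card ?X \<le> p ^ b * n ^ c * L ^ (2 * L)"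
        using card_labellings_le[of ?P "matrix_labels p n" "?bc b c" L ?s row_pos "{}"] finP finLab that
        by (simp add: cardLab cardP)
      then show "real (card ?X) \<le> real (p ^ b * n ^ c * L ^ (2 * L))" by (rule of_nat_mono)
    qed (use A1 in simp)
    also have "\<dots> = K1 * real p ^ b * real n ^ c" by (simp add: K1_def)
    finally show ?thesis .
  qed
  \<comment> \<open>One application covers \<open>b + c = L\<close> and, there being no closing
    sets, \<open>b + c > L\<close>.\<close>
  have S_top: "S p n b c = (if b + c = L then ?ff p b * ?ff n c * T b else 0)" if "b + c \<ge> L" for p n b c
  proof -
    have lead: "S p n b c = leading_count \<mu> (matrix_labels p n) ?s ?P1 ?P2 row_pos {} (?bc b c) (l1 + l2)"
      unfolding S_def by (rule cov_sum_eq_leading_count[OF lc]) (use that cardP in \<open>auto simp: L_def\<close>)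
    show ?thesis
    proof (cases "b + c = L")
      case True
      then have c: "L - b = c" by simp
      have "(\<Prod>\<tau>\<in>UNIV. \<Prod>i<?bc b c \<tau>. real (card (matrix_labels p n \<tau>)) - real i) = ?ff p b * ?ff n c"
        by (simp add: UNIV_bool cardLab mult.commute)
      then show ?thesis unfolding lead leading_count_def T_def if_P[OF True] c by (simp only:)
    next
      case False
      then have "closing_sets ?s ?P1 ?P2 row_pos {} (?bc b c) r = {}" for r
        by (intro closing_sets_empty_count finP) (simp add: card_positions L_def)
      then show ?thesis unfolding lead leading_count_def using False by simp
    qed
  qed
  define D where "D = real L * real L * (real L + 1) ^ L"
  have D: "D \<ge> 0" by (simp add: D_def)
  \<comment> \<open>The first summand pays for replacing \<open>n\<close> by \<open>n - b\<close> in
    the falling factorial, the second for the at most \<open>L\<close> values of \<open>c\<close>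
    with \<open>b + c < L\<close>.\<close>
  define K where "K = (\<Sum>b\<le>L. \<bar>T b\<bar>) * D + real L * K1"
  have K: "K \<ge> 0" using D K1 by (simp add: K_def sum_nonneg)
  show ?thesis
  proof (intro exI[of _ K] allI impI)
    fix p n :: nat
    assume pn: "1 \<le> p \<and> p \<le> n"
    then have n1: "n \<ge> 1" by simp
    have npos: "real n > 0" using n1 by simp
    let ?main = "\<lambda>b. real (p choose b) * real ((n - b) choose (L - b)) / real n ^ L
               * (Ccoef l1 l2 b + (\<mu> 4 - 3) * Dcoef l1 l2 b)"
    \<comment> \<open>The shift from \<open>n\<close> to \<open>n - b\<close> and all terms with too
      few columns; zero outside the summation range, so that the bound holds for every
      \<open>b\<close>.\<close>
    define e where "e b = (if b \<in> {1..min L p} then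
        (1 / real n) ^ L * (?ff p b * T b * (?ff n (L - b) - ?ff (n - b) (L - b)) + (\<Sum>c<L - b. S p n b c)) else 0)" for b
    have main: "?main b = (1 / real n) ^ L * (?ff p b * T b * ?ff (n - b) (L - b))" if "b \<le> L" for b
      unfolding T[OF that, symmetric] falling_factorial_binomial by (simp add: power_one_over divide_simps)
    have row: "(1 / real n) ^ L * (\<Sum>c=0..L. S p n b c) = ?main b + e b" if b: "b \<in> {1..min L p}" for b
    proof -
      \<comment> \<open>Fewer than \<open>L - b\<close> columns go into the error, exactly
        \<open>L - b\<close> give the leading term, and more contribute nothing.\<close>
      have "{0..L} = {..<L - b} \<union> {L - b..L}" using b by auto
      then have "(\<Sum>c=0..L. S p n b c) = (\<Sum>c<L - b. S p n b c) + (\<Sum>c=L - b..L. S p n b c)"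
        by (simp only:) (rule sum.union_disjoint, auto)
      also have "(\<Sum>c=L - b..L. S p n b c) = (\<Sum>c=L - b..L. if c = L - b then ?ff p b * ?ff n c * T b else 0)"
        using b by (intro sum.cong refl) (auto simp: S_top)
      also have "\<dots> = ?ff p b * ?ff n (L - b) * T b" using b by (subst sum.delta) auto
      finally show ?thesis using b main[of b] by (simp add: e_def algebra_simps)
    qed
    have "covar M (\<lambda>w. mtrace (Smat Y p n w ^\<^sub>m l1)) (\<lambda>w. mtrace (Smat Y p n w ^\<^sub>m l2))
      = (1 / real n) ^ L * (\<Sum>x\<in>PiE ?P (\<lambda>t. matrix_labels p n (row_pos t)). cov_weight \<mu> ?s ?P1 ?P2 x)"
      unfolding L_def \<mu>_def by (rule covar_trace_eq_sum[where Y=Y, OF assms(2,3,4) int assms(7,8)])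
    also have "\<dots> = (1 / real n) ^ L * (\<Sum>b=1..min L p. \<Sum>c=0..L. S p n b c)"
      unfolding S_def cov_sum_def L_def by (subst sum_labellings_by_counts[OF assms(7)]) (rule refl)
    also have "\<dots> = (\<Sum>b=1..min L p. ?main b + e b)"
      unfolding sum_distrib_left[of _ "\<lambda>b. \<Sum>c=0..L. S p n b c"] by (rule sum.cong[OF refl]) (rule row)
    finally have cov: "covar M (\<lambda>w. mtrace (Smat Y p n w ^\<^sub>m l1)) (\<lambda>w. mtrace (Smat Y p n w ^\<^sub>m l2))
      = (\<Sum>b=1..min L p. ?main b + e b)" .
    have bound: "\<bar>e b\<bar> \<le> K * real p ^ b / real n ^ (b + 1)" for b
    proof (cases "b \<in> {1..min L p}")
      case False
      then have "e b = 0" by (simp only: e_def if_False)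
      then show ?thesis using K by simp
    next
      case True
      then have b: "b \<le> L" "b \<le> p" "b \<le> n" using pn by auto
      let ?d = "?ff n (L - b) - ?ff (n - b) (L - b)" and ?r = "\<Sum>c<L - b. S p n b c"
      have f: "\<bar>?ff p b\<bar> \<le> real p ^ b"
      proof -
        have "(\<Prod>i<b. \<bar>real p - real i\<bar>) \<le> (\<Prod>i<b. real p)"
          by (rule prod_mono) (use b in auto)
        then show ?thesis by (simp add: abs_prod)
      qed
      have d: "\<bar>?d\<bar> * real n \<le> D * real n ^ (L - b)"
        unfolding D_def by (rule falling_factorial_shift_bound) (use n1 b in auto)
      have t: "\<bar>T b\<bar> \<le> (\<Sum>b\<le>L. \<bar>T b\<bar>)" by (rule member_le_sum) (use b in auto)
      have "\<bar>?ff p b * T b * ?d\<bar> * real n = \<bar>?ff p b\<bar> * \<bar>T b\<bar> * (\<bar>?d\<bar> * real n)"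
        by (simp add: abs_mult)
      also have "\<dots> \<le> real p ^ b * (\<Sum>b\<le>L. \<bar>T b\<bar>) * (D * real n ^ (L - b))"
        by (intro mult_mono f t d) (auto simp: sum_nonneg)
      finally have 1: "\<bar>?ff p b * T b * ?d\<bar> * real n \<le> real p ^ b * (\<Sum>b\<le>L. \<bar>T b\<bar>) * (D * real n ^ (L - b))" .
      have "\<bar>?r\<bar> * real n \<le> (\<Sum>c<L - b. \<bar>S p n b c\<bar>) * real n"
        by (intro mult_right_mono sum_abs) simp
      also have "\<dots> = (\<Sum>c<L - b. \<bar>S p n b c\<bar> * real n)" by (rule sum_distrib_right)
      \<comment> \<open>As \<open>c < L - b\<close>, the extra factor \<open>n\<close> still fits
        under \<open>n ^ (L - b)\<close>: this is the gain of 1/n in the error.\<close>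
      also have "\<dots> \<le> (\<Sum>c<L - b. K1 * real p ^ b * real n ^ (L - b))"
      proof (rule sum_mono)
        fix c assume c: "c \<in> {..<L - b}"
        have "\<bar>S p n b c\<bar> * real n \<le> K1 * real p ^ b * real n ^ c * real n"
          using b c by (intro mult_right_mono S_bound) auto
        also have "\<dots> = K1 * real p ^ b * real n ^ Suc c" by simp
        also have "\<dots> \<le> K1 * real p ^ b * real n ^ (L - b)"
          using c n1 K1 by (intro mult_left_mono power_increasing) auto
        finally show "\<bar>S p n b c\<bar> * real n \<le> K1 * real p ^ b * real n ^ (L - b)" .
      qed
      also have "\<dots> = real (L - b) * (K1 * real p ^ b * real n ^ (L - b))" by simp
      also have "\<dots> \<le> real L * (K1 * real p ^ b * real n ^ (L - b))"
        using K1 by (intro mult_right_mono) auto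
      finally have 2: "\<bar>?r\<bar> * real n \<le> real L * (K1 * real p ^ b * real n ^ (L - b))" .
      have "\<bar>?ff p b * T b * ?d + ?r\<bar> * real n \<le> \<bar>?ff p b * T b * ?d\<bar> * real n + \<bar>?r\<bar> * real n"
        unfolding distrib_right[symmetric] by (intro mult_right_mono abs_triangle_ineq) simp
      also have "\<dots> \<le> K * real p ^ b * real n ^ (L - b)"
        using 1 2 by (simp add: K_def algebra_simps)
      finally have 3: "\<bar>?ff p b * T b * ?d + ?r\<bar> \<le> K * real p ^ b * real n ^ (L - b) / real n"
        using npos by (simp add: pos_le_divide_eq)
      have "e b = (1 / real n) ^ L * (?ff p b * T b * ?d + ?r)" unfolding e_def if_P[OF True] ..
      then have "\<bar>e b\<bar> = (1 / real n) ^ L * \<bar>?ff p b * T b * ?d + ?r\<bar>" by (simp add: abs_mult)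
      also have "\<dots> \<le> (1 / real n) ^ L * (K * real p ^ b * real n ^ (L - b) / real n)"
        by (intro mult_left_mono 3) simp
      also have "\<dots> = K * real p ^ b / real n ^ (b + 1)"
      proof -
        have "real n ^ L = real n ^ b * real n ^ (L - b)" using b by (simp add: power_add[symmetric])
        then show ?thesis using npos by (simp add: power_one_over field_simps)
      qed
      finally show ?thesis .
    qed
    show "\<exists>e :: nat \<Rightarrow> real.
        (\<forall>b. \<bar>e b\<bar> \<le> K * real p ^ b / real n ^ (b + 1)) \<and>
        covar M (\<lambda>w. mtrace (Smat Y p n w ^\<^sub>m l1)) (\<lambda>w. mtrace (Smat Y p n w ^\<^sub>m l2))
        = (\<Sum>b = 1..min (l1 + l2) p.
             real (p choose b) * real ((n - b) choose (l1 + l2 - b)) / real n ^ (l1 + l2)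
               * (Ccoef l1 l2 b + ((\<integral>x. (Y 0 0 x)^4 \<partial>M) - 3) * Dcoef l1 l2 b)
             + e b)"
      using bound cov unfolding L_def \<mu>_def by blast
  qed
qed

end
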